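(* Let $N\ge1$ be an integer and suppose $a>\max\{0,2-N\}$. Let $h_a(x,y;t)$ be the $a$-deformed heat kernel on $\mathbb{R}^N$ and $\lambda_a=\frac{N-2}{a}$. Then for all $r,s\in\mathbb{R}_{\ge0}$, $\omega,\mu\in S^{N-1}$ and $t>0$, $$h_a(r\omega,s\mu;t)=t^{-(\lambda_a+1)}\,e^{-\frac{r^a+s^a}{at}}\;\mathscr{I}\left(\frac2a,\frac{N-2}{2},\frac{2(rs)^{a/2}}{at},\langle\omega,\mu\rangle\right).$$
   Context: Normalized I-Bessel function: for $\mu\in\mathbb{R}$ and $w\in\mathbb{C}$, $\tilde I_\mu(w)=\sum_{j=0}^\infty\frac{(w/2)^{2j}}{j!\,\Gamma(\mu+j+1)}$ (with $1/\Gamma=0$ at the poles of $\Gamma$). Normalized Gegenbauer polynomials $\check C^\nu_m(t)$ are defined by the formal power series expansion $\frac{1-x^2}{(1-2tx+x^2)^{\nu+1}}=\sum_{m=0}^\infty\check C^\nu_m(t)x^m$. For $b>0$, $\nu\in\mathbb{R}$ with $1+b\nu>0$, $w\in\mathbb{C}$, $t\in[-1,1]$, $$\mathscr{I}(b,\nu,w,t):=\Gamma(b\nu+1)\sum_{m=0}^\infty\left(\frac w2\right)^{bm}\tilde I_{b(m+\nu)}(w)\,\check C^\nu_m(t),$$ where $(w/2)^s=(|w|/2)^se^{i\theta s}$ for $w=|w|e^{i\theta}$, $\theta\in(-\pi,\pi]$; the series converges absolutely and locally uniformly. For $a>\max\{0,2-N\}$ put $B_a(r\omega,s\mu)=\mathscr{I}\left(\frac2a,\frac{N-2}{2},\frac{2(rs)^{a/2}}{ai},\langle\omega,\mu\rangle\right)$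 for $r,s\ge0$, $\omega,\mu\in S^{N-1}$ (the kernel of the $(0,a)$-generalized Fourier transform), and $c_a=\left(\int_{\mathbb{R}^N}e^{-\frac1a|x|^a}\frac{dx}{|x|^{2-a}}\right)^{-1}$. The $a$-deformed heat kernel is $$h_a(x,y;t)=c_a\int_{\mathbb{R}^N}\overline{B_a(x,\xi)}\,B_a(y,\xi)\,e^{-\frac ta|\xi|^a}\frac{d\xi}{|\xi|^{2-a}}\qquad(x,y\in\mathbb{R}^N,\ t>0),$$ an absolutely convergent integral. *)

theory Defs
  imports "HOL-Analysis.Analysis" "HOL-Computational_Algebra.Formal_Power_Series"
begin

(* rGamma is the entire function 1/Gamma, so it vanishes at the poles of Gamma. *)
definition bessel_I_norm :: "real \<Rightarrow> complex \<Rightarrow> complex" where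
  "bessel_I_norm \<mu> w =
     (\<Sum>j. (w / 2) ^ (2 * j) / fact j * of_real (rGamma (\<mu> + real j + 1)))"

(* fps_binomial c is the formal series (1 + X)^c; hence the denominator is
   (1 - 2 t X + X^2)^(\<nu> + 1). *)
definition gegenbauer_norm_fps :: "real \<Rightarrow> real \<Rightarrow> real fps" where
  "gegenbauer_norm_fps \<nu> t =
     (1 - fps_X ^ 2) /
     (fps_binomial (\<nu> + 1) oo (fps_X ^ 2 - fps_const (2 * t) * fps_X))"

definition gegenbauer_norm :: "real \<Rightarrow> nat \<Rightarrow> real \<Rightarrow> real" where
  "gegenbauer_norm \<nu> m t = fps_nth (gegenbauer_norm_fps \<nu> t) m"

(* The principal power z^s for s >= 0. The library has 0 powr 0 = 0, whereas the
   series below needs z^0 = 1 for z = 0 as well. *)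
definition cpow :: "complex \<Rightarrow> real \<Rightarrow> complex" where
  "cpow z s = (if s = 0 then 1 else z powr of_real s)"

definition script_I :: "real \<Rightarrow> real \<Rightarrow> complex \<Rightarrow> real \<Rightarrow> complex" where
  "script_I b \<nu> w t =
     of_real (Gamma (b * \<nu> + 1)) *
     (\<Sum>m. cpow (w / 2) (b * real m) * bessel_I_norm (b * (real m + \<nu>)) w *
          of_real (gegenbauer_norm \<nu> m t))"

(* The polar coordinates of x are norm x and sgn x = x / norm x. The direction of 0 is
   irrelevant, see kernel_B_polar below; here it is sgn 0 = 0. *)
definition kernel_B :: "real \<Rightarrow> real ^ 'n \<Rightarrow> real ^ 'n \<Rightarrow> complex" where
  "kernel_B a x y =
     script_I (2 / a) ((real CARD('n) - 2) / 2)
       (of_real (2 * (norm x * norm y) powr (a / 2)) / (of_real a * \<i>))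
       (sgn x \<bullet> sgn y)"

definition norm_const :: "'n::finite itself \<Rightarrow> real \<Rightarrow> real" where
  "norm_const _ a =
     inverse (\<integral>x. exp (- (1 / a) * norm x powr a) / norm x powr (2 - a)
                \<partial>(lborel :: (real ^ 'n) measure))"

definition heat_kernel :: "real \<Rightarrow> real ^ 'n \<Rightarrow> real ^ 'n \<Rightarrow> real \<Rightarrow> complex" where
  "heat_kernel a x y t =
     of_real (norm_const TYPE('n) a) *
     (\<integral>\<xi>. cnj (kernel_B a x \<xi>) * kernel_B a y \<xi> *
          of_real (exp (- (t / a) * norm \<xi> powr a) / norm \<xi> powr (2 - a))
        \<partial>(lborel :: (real ^ 'n) measure))"

lemma gegenbauer_norm_fps_mult:
  "gegenbauer_norm_fps \<nu> t *
     (fps_binomial (\<nu> + 1) oo (fps_X ^ 2 - fps_const (2 * t) * fps_X)) = 1 - fps_X ^ 2"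
proof -
  let ?g = "fps_binomial (\<nu> + 1) oo (fps_X ^ 2 - fps_const (2 * t) * fps_X)"
  have "fps_nth ?g 0 = 1"
    by simp
  then have "fps_nth ?g 0 \<noteq> 0"
    by simp
  then show ?thesis
    by (simp add: gegenbauer_norm_fps_def fps_divide_unit mult.assoc inverse_mult_eq_1)
qed

lemma gegenbauer_norm_0: "gegenbauer_norm \<nu> 0 t = 1"
  using arg_cong[OF gegenbauer_norm_fps_mult, of "\<lambda>f. fps_nth f 0" \<nu> t]
  by (simp add: gegenbauer_norm_def)

lemma script_I_0:
  assumes "b > 0"
  shows "script_I b \<nu> 0 t = of_real (Gamma (b * \<nu> + 1)) * bessel_I_norm (b * \<nu>) 0"
proof -
  have "(\<Sum>m. cpow (0 / 2) (b * real m) * bessel_I_norm (b * (real m + \<nu>)) 0 *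
          of_real (gegenbauer_norm \<nu> m t)) =
        (\<Sum>m\<in>{0}. cpow (0 / 2) (b * real m) * bessel_I_norm (b * (real m + \<nu>)) 0 *
          of_real (gegenbauer_norm \<nu> m t))"
    using assms by (intro suminf_finite) (auto simp: cpow_def)
  then show ?thesis
    by (simp add: script_I_def cpow_def gegenbauer_norm_0)
qed

lemma kernel_B_polar:
  fixes \<omega> \<mu> :: "real ^ 'n"
  assumes "a > 0" "r \<ge> 0" "s \<ge> 0" "\<omega> \<in> sphere 0 1" "\<mu> \<in> sphere 0 1"
  shows "kernel_B a (r *\<^sub>R \<omega>) (s *\<^sub>R \<mu>) =
    script_I (2 / a) ((real CARD('n) - 2) / 2)
      (of_real (2 * (r * s) powr (a / 2)) / (of_real a * \<i>)) (\<omega> \<bullet> \<mu>)"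
proof (cases "r = 0 \<or> s = 0")
  case True
  then show ?thesis
    using assms by (auto simp: kernel_B_def script_I_0)
next
  case False
  then show ?thesis
    using assms by (simp add: kernel_B_def sgn_div_norm)
qed

end

theory Submission
  imports Defs
begin

text \<open>
  With $u = \frac{t}{a}|\xi|^a$ and $\eta = \xi/|\xi|$, the integral splits into a radial one in $u$ and
  one over the sphere. Expanding both kernels in Gegenbauer polynomials and integrating over $\eta$,
  only the diagonal terms survive, because the normalized polynomials reproduce themselves:
  $\int \check C_m(\omega\cdot\eta)\check C_n(\mu\cdot\eta)\,d\eta$ is $\delta_{mn}\check C_m(\omega\cdot\mu)$
  times the total mass. What is left for each $m$ is Weber's integral
  \[ \int_0^\infty u^\lambda e^{-u} \tilde J_\lambda(X u) \tilde J_\lambda(Y u)\,du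
     = e^{-X-Y} \sum_j \frac{(XY)^j}{j!\,\Gamma(\lambda+j+1)} \]
  with $X = r^a/(at)$, $Y = s^a/(at)$, $\lambda = \frac 2a(m+\nu)$, which produces the $m$-th term of the series
  on the right-hand side. The reproducing property itself comes from the moments of the sphere,
  which are read off from the Gaussian integral of $e^{w\cdot x}$; it then reduces to the vanishing of finite
  differences of polynomials. Limits are only ever taken of square partial sums, by dominated
  convergence.
\<close>

text \<open>The argument of the kernel is -i times a nonnegative real, so every term of its series
  is a real number times a phase that depends on m alone. Orthogonality pairs m only with m, so each
  phase meets its own conjugate. What remains are two J-type factors, and their integral is an
  I-type function because X * Y is the square of half the new, real argument. Exchanging sum and
  integral is a contest of growth rates. The Gegenbauer polynomials are bounded only by a geometric
  sequence, while 1/Gamma beats every geometric sequence. The price is a factor exp(K * |w|), and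
  |w| is proportional to sqrt u, so that exp(-u) absorbs it. The hypothesis a > 2 - N says exactly
  that l = (N - 2) / a exceeds -1, which is integrability at the origin. N = 1 (nu = -1/2) and N = 2
  (nu = 0) are covered by the same argument: all formulas are stated for nu > -1 and never divide by
  nu.\<close>

subsection \<open>Polar coordinates\<close>

text \<open>The surface measure of the unit sphere divided by the dimension.\<close>

definition cone_measure :: "'a::euclidean_space measure" where
  "cone_measure = distr (density lborel (indicator (cball 0 1))) borel sgn"

text \<open>
  For \<open>p = DIM('a) / a\<close> this is the distribution of \<open>c * norm x powr a\<close> under Lebesgue measure.
\<close>

definition radial_measure :: "real \<Rightarrow> real \<Rightarrow> real measure" where
  "radial_measure p c =
     density lborel (\<lambda>u. ennreal (indicator {0<..} u * (p * c powr (- p) * u powr (p - 1))))"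

lemma sgn_borel_measurable [measurable]:
  "(sgn :: 'a::euclidean_space \<Rightarrow> 'a) \<in> borel_measurable borel"
  unfolding sgn_div_norm[abs_def] by measurable

lemma sets_cone_measure [simp, measurable_cong]: "sets cone_measure = sets borel"
  and space_cone_measure [simp]: "space cone_measure = UNIV"
  by (auto simp: cone_measure_def)

lemma sets_radial_measure [simp, measurable_cong]: "sets (radial_measure p c) = sets borel"
  and space_radial_measure [simp]: "space (radial_measure p c) = UNIV"
  by (auto simp: radial_measure_def)

lemma emeasure_cone_measure:
  assumes "B \<in> sets borel"
  shows "emeasure cone_measure B = emeasure lborel {x \<in> cball 0 1. sgn x \<in> B}"
proof -
  have "sgn -` B \<in> sets borel"
    using measurable_sets[OF sgn_borel_measurable assms] by simp
  then have "emeasure cone_measure B = emeasure (density lborel (indicator (cball 0 1))) (sgn -` B)"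
    using assms by (simp add: cone_measure_def emeasure_distr)
  also have "\<dots> = emeasure lborel (sgn -` B \<inter> cball 0 1)"
    using \<open>sgn -` B \<in> sets borel\<close>
    by (subst emeasure_restricted) (auto simp: Int_commute)
  also have "sgn -` B \<inter> cball 0 1 = {x \<in> cball 0 1. sgn x \<in> B}"
    by auto
  finally show ?thesis .
qed

lemma emeasure_cone_measure_UNIV:
  "emeasure (cone_measure :: 'a::euclidean_space measure) UNIV = ennreal (unit_ball_vol DIM('a))"
  using emeasure_cball[of 1 "0::'a"] by (subst emeasure_cone_measure) (auto simp: cball_def)

lemma finite_measure_cone_measure: "finite_measure cone_measure"
  by (rule finite_measureI) (simp add: emeasure_cone_measure_UNIV)

lemma measure_cone_measure_UNIV:
  "measure (cone_measure :: 'a::euclidean_space measure) UNIV = unit_ball_vol DIM('a)"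
  by (simp add: measure_def emeasure_cone_measure_UNIV)

lemma AE_cone_measure_norm: "AE \<eta> in (cone_measure :: 'a::euclidean_space measure). norm \<eta> = 1"
proof -
  have "AE x in lborel. (x::'a) \<noteq> 0"
    by (rule AE_lborel_singleton)
  then have "AE x in density lborel (indicator (cball (0::'a) 1)). x \<noteq> 0"
    by (subst AE_density) (auto intro!: borel_measurable_indicator elim!: eventually_mono)
  then show ?thesis
    unfolding cone_measure_def by (subst AE_distr_iff) (auto simp: norm_sgn elim!: eventually_mono)
qed

text \<open>Dilation by \<open>R\<close> preserves \<open>sgn\<close> and scales volume by the
  \<open>DIM('a)\<close>-th power, so every sector is a scaled copy of the unit sector that defines
  \<open>cone_measure\<close>.\<close>

lemma emeasure_sector:
  fixes B :: "'a::euclidean_space set"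
  assumes B: "B \<in> sets borel" and R: "R > 0"
  shows "emeasure lborel {x. norm x \<le> R \<and> sgn x \<in> B} = ennreal (R ^ DIM('a)) *
      emeasure cone_measure B"
proof -
  have [measurable]: "B \<in> sets borel" by fact
  have *: "{x. norm x \<le> R \<and> sgn x \<in> B} \<in> sets borel"
    by measurable
  have "emeasure lborel {x. norm x \<le> R \<and> sgn x \<in> B} =
     emeasure (density (distr lborel borel (\<lambda>x. 0 + R *\<^sub>R x)) (\<lambda>_. \<bar>R\<bar>^DIM('a))) {x. norm x \<le>
         R \<and> sgn x \<in> B}"
    using R by (subst lborel_affine[of R 0]) auto
  also have "\<dots> = ennreal (R ^ DIM('a)) * emeasure (distr lborel borel (\<lambda>x. R *\<^sub>R x)) {x. norm x \<le>
      R \<and> sgn x \<in> B}"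
    using * R by (subst emeasure_density) (auto simp: nn_integral_cmult)
  also have "emeasure (distr lborel borel (\<lambda>x. R *\<^sub>R x)) {x. norm x \<le> R \<and> sgn x \<in> B} =
      emeasure cone_measure B"
    using * R B
    by (subst emeasure_distr) (auto simp: emeasure_cone_measure sgn_scaleR
        intro!: arg_cong2[where f=emeasure])
  finally show ?thesis .
qed

text \<open>The density is the derivative of \<open>(u / c) powr p\<close>. For p = DIM / a this is
  R ^ DIM, where R is the radius with c * R powr a = u.\<close>

lemma emeasure_radial_measure_atMost:
  assumes p: "p > 0" and c: "c > 0"
  shows "emeasure (radial_measure p c) {..u} = (if u > 0 then ennreal ((u / c) powr p) else 0)"
proof (cases "u > 0")
  case True
  have "((\<lambda>x. p * c powr (-p) * x powr (p - 1)) has_integral p * c powr (-p) *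
      (u powr (p - 1 + 1) / (p - 1 + 1))) {0..u}"
    using has_integral_powr_from_0[of "p - 1" u] True p by (intro has_integral_mult_right) auto
  then have "((\<lambda>x. p * c powr (-p) * x powr (p - 1)) has_integral (u / c) powr p) {0..u}"
    using p c True by (simp add: powr_divide powr_minus field_simps)
  from nn_integral_has_integral_lebesgue[OF _ this] p
  have *: "(\<integral>\<^sup>+x. ennreal (indicator {0..u} x * (p * c powr (-p) * x powr (p - 1))) \<partial>lborel) =
      ennreal ((u / c) powr p)"
    by simp
  have "emeasure (radial_measure p c) {..u} =
     (\<integral>\<^sup>+x. ennreal (indicator {0<..} x * (p * c powr (-p) * x powr (p - 1))) * indicator {..u} x
         \<partial>lborel)"
    by (simp add: radial_measure_def emeasure_density)
  also have "\<dots> = (\<integral>\<^sup>+x. ennreal (indicator {0..u} x * (p * c powr (-p) * x powr (p - 1))) \<partial>lborel)"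
    by (intro nn_integral_cong) (auto simp: indicator_def)
  finally show ?thesis using True * by simp
next
  case False
  have "emeasure (radial_measure p c) {..u} =
     (\<integral>\<^sup>+x. ennreal (indicator {0<..} x * (p * c powr (-p) * x powr (p - 1))) * indicator {..u} x
         \<partial>lborel)"
    by (simp add: radial_measure_def emeasure_density)
  also have "\<dots> = (\<integral>\<^sup>+x. 0 \<partial>(lborel :: real measure))"
    using False by (intro nn_integral_cong) (auto simp: indicator_def)
  finally show ?thesis using False by simp
qed

lemma emeasure_radial_level:
  fixes B :: "'a::euclidean_space set"
  assumes B: "B \<in> sets borel" and a: "a > 0" and c: "c > 0"
  shows "emeasure lborel {x. c * norm x powr a \<le> u \<and> sgn x \<in> B} =
    emeasure (radial_measure (DIM('a) / a) c) {..u} * emeasure cone_measure B"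
proof -
  consider "u > 0" | "u = 0" | "u < 0" by linarith
  then show ?thesis
  proof cases
    case 1
    have "{x. c * norm x powr a \<le> u \<and> sgn x \<in> B} = {x. norm x \<le> (u / c) powr (1 / a) \<and> sgn x \<in> B}"
    proof -
      have "c * norm x powr a \<le> u \<longleftrightarrow> norm x \<le> (u / c) powr (1 / a)" for x :: 'a
      proof -
        have "norm x \<le> (u / c) powr (1 / a) \<longleftrightarrow> norm x powr a \<le> ((u / c) powr (1 / a)) powr a"
          using a by (simp add: powr_mono2 powr_less_mono2 linorder_not_less[symmetric]
              ) (metis a linorder_not_less norm_ge_zero powr_ge_zero powr_less_mono2 powr_mono2
                  less_imp_le)
        also have "((u / c) powr (1 / a)) powr a = u / c"
          using a c 1 by (simp add: powr_powr)
        finally show ?thesis using c by (simp add: field_simps)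
      qed
      then show ?thesis by auto
    qed
    then have "emeasure lborel {x. c * norm x powr a \<le> u \<and> sgn x \<in> B} =
        ennreal (((u / c) powr (1 / a)) ^ DIM('a)) * emeasure cone_measure B"
      using emeasure_sector[OF B, of "(u / c) powr (1 / a)"] 1 c by simp
    also have "((u / c) powr (1 / a)) ^ DIM('a) = (u / c) powr (DIM('a) / a)"
      using 1 c by (simp add: powr_realpow[symmetric] powr_powr)
    finally show ?thesis
      using 1 a c by (simp add: emeasure_radial_measure_atMost)
  next
    case 2
    have "emeasure lborel {x. c * norm x powr a \<le> u \<and> sgn x \<in> B} \<le> emeasure lborel {0::'a}"
      using 2 c a by (intro emeasure_mono) (auto simp: mult_le_0_iff)
    then show ?thesis
      using 2 a c by (simp add: emeasure_radial_measure_atMost)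
  next
    case 3
    have "{x. c * norm x powr a \<le> u \<and> sgn x \<in> B} = {}"
      using 3 c by (auto simp: not_le intro: less_le_trans[of _ 0])
    then have "emeasure lborel {x. c * norm x powr a \<le> u \<and> sgn x \<in> B} = 0"
      by (simp only: emeasure_empty)
    then show ?thesis
      using 3 a c by (simp add: emeasure_radial_measure_atMost)
  qed
qed

lemma sigma_finite_radial_measure: 
  assumes "p > 0" "c > 0"
  shows "sigma_finite_measure (radial_measure p c)"
proof
  show "\<exists>A. countable A \<and> A \<subseteq> sets (radial_measure p c) \<and> \<Union> A = space (radial_measure p c) \<and>
     (\<forall>a\<in>A. emeasure (radial_measure p c) a \<noteq> \<infinity>)"
    using assms
    by (intro exI[of _ "range (\<lambda>n::nat. {..real n})"])
       (auto simp: emeasure_radial_measure_atMost intro: real_arch_simple)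
qed

text \<open>A product measure is determined by its rectangles. For a fixed angular set
  \<open>B\<close> both sides are measures in the radial variable; on the half-lines
  \<open>{..u}\<close>, an intersection-stable generator, their equality is the scaling of
  sectors.\<close>

theorem polar_measure:
  fixes a c :: real
  assumes a: "a > 0" and c: "c > 0"
  shows "radial_measure (DIM('a) / a) c \<Otimes>\<^sub>M (cone_measure :: 'a::euclidean_space measure) =
     distr lborel (borel \<Otimes>\<^sub>M borel) (\<lambda>x. (c * norm x powr a, sgn x))"
proof (rule pair_measure_eqI)
  let ?p = "DIM('a) / a"
  let ?U = "\<lambda>x::'a. c * norm x powr a"
  have p: "?p > 0" using a by simp
  show "sigma_finite_measure (radial_measure ?p c)"
    by (rule sigma_finite_radial_measure) (use p c in auto)
  show "sigma_finite_measure (cone_measure :: 'a measure)"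
    using finite_measure_cone_measure finite_measure.axioms(1) by blast
  show "sets (radial_measure ?p c \<Otimes>\<^sub>M (cone_measure :: 'a measure)) =
     sets (distr lborel (borel \<Otimes>\<^sub>M borel) (\<lambda>x::'a. (?U x, sgn x)))"
    by (simp cong: sets_pair_measure_cong)
  fix A and B :: "'a set"
  assume "A \<in> sets (radial_measure ?p c)" "B \<in> sets (cone_measure :: 'a measure)"
  then have A[measurable]: "A \<in> sets borel" and B[measurable]: "B \<in> sets borel" by auto
  have *: "distr (density lborel (indicator (sgn -` B))) borel ?U =
      density (radial_measure ?p c) (\<lambda>_. emeasure cone_measure B)"
  proof (rule measure_eqI_generator_eq[where E="range atMost" and \<Omega>=UNIV and A="\<lambda>n. {..real n}"])
    have sB[measurable]: "sgn -` B \<in> sets borel"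
      using measurable_sets[OF sgn_borel_measurable B] by simp
    have fin: "emeasure cone_measure B < \<infinity>"
      using finite_measure.emeasure_finite[OF finite_measure_cone_measure, of B]
          by (simp add: top.not_eq_extremum)
    have L: "emeasure (distr (density lborel (indicator (sgn -` B))) borel ?U) {..u} =
       emeasure lborel {x. c * norm x powr a \<le> u \<and> sgn x \<in> B}" for u
    proof -
      have "emeasure (distr (density lborel (indicator (sgn -` B))) borel ?U) {..u} =
        emeasure (density lborel (indicator (sgn -` B))) (?U -` {..u})"
        by (subst emeasure_distr) auto
      also have "\<dots> = emeasure lborel (sgn -` B \<inter> ?U -` {..u})"
        using measurable_sets[of ?U borel borel "{..u}"] sB
        by (subst emeasure_restricted) auto
      also have "sgn -` B \<inter> ?U -` {..u} = {x. c * norm x powr a \<le> u \<and> sgn x \<in> B}"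
        by auto
      finally show ?thesis .
    qed
    show "emeasure (distr (density lborel (indicator (sgn -` B))) borel ?U) X =
       emeasure (density (radial_measure ?p c) (\<lambda>_. emeasure cone_measure B)) X" if X: "X \<in> range
           atMost" for X
    proof -
      obtain u where u: "X = {..u}" using X by auto
      show ?thesis
        unfolding u L emeasure_radial_level[OF B a c]
        by (subst emeasure_density) (auto simp: nn_integral_cmult ac_simps)
    qed
    show "emeasure (distr (density lborel (indicator (sgn -` B))) borel ?U) {..real i} \<noteq> \<infinity>" for i
      unfolding L emeasure_radial_level[OF B a c]
      using fin p c by (auto simp: emeasure_radial_measure_atMost ennreal_mult_eq_top_iff)
    show "Int_stable (range atMost :: real set set)"
      by (auto simp: Int_stable_def)
    show "(\<Union>i. {..real i}) = UNIV"
      by (auto intro: real_arch_simple)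
  qed (auto simp: borel_eq_atMost)
  have "emeasure (radial_measure ?p c) A * emeasure cone_measure B =
      emeasure (density (radial_measure ?p c) (\<lambda>_. emeasure cone_measure B)) A"
    by (subst emeasure_density) (auto simp: nn_integral_cmult_indicator
        mult.commute[of "emeasure (radial_measure ?p c) A"])
  also have "\<dots> = emeasure (density lborel (indicator (sgn -` B))) (?U -` A)"
    unfolding *[symmetric] by (subst emeasure_distr) auto
  also have "\<dots> = emeasure lborel (sgn -` B \<inter> ?U -` A)"
    using measurable_sets[of ?U borel borel A] measurable_sets[OF sgn_borel_measurable B]
    by (subst emeasure_restricted) auto
  also have "\<dots> = emeasure (distr lborel (borel \<Otimes>\<^sub>M borel) (\<lambda>x. (?U x, sgn x))) (A \<times> B)"
    by (subst emeasure_distr) (auto intro!: arg_cong2[where f=emeasure])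
  finally show "emeasure (radial_measure ?p c) A * emeasure cone_measure B =
     emeasure (distr lborel (borel \<Otimes>\<^sub>M borel) (\<lambda>x::'a. (?U x, sgn x))) (A \<times> B)" .
qed

section \<open>Integration in polar coordinates\<close>

lemma (in pair_sigma_finite) has_bochner_integral_prod:
  fixes f :: "'a \<Rightarrow> 'c::{real_normed_field, banach, second_countable_topology}"
  assumes f: "integrable M1 f" and g: "integrable M2 g"
  shows "has_bochner_integral (M1 \<Otimes>\<^sub>M M2) (\<lambda>z. f (fst z) * g (snd z))
    (integral\<^sup>L M1 f * integral\<^sup>L M2 g)"
proof -
  have [measurable]: "f \<in> borel_measurable M1" "g \<in> borel_measurable M2"
    using f g by auto
  have int: "integrable (M1 \<Otimes>\<^sub>M M2) (\<lambda>z. f (fst z) * g (snd z))"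
    by (rule Fubini_integrable) (use f g in \<open>auto simp: norm_mult\<close>)
  moreover have "integral\<^sup>L (M1 \<Otimes>\<^sub>M M2) (\<lambda>z. f (fst z) * g (snd z)) =
      integral\<^sup>L M1 f * integral\<^sup>L M2 g"
    using integral_fst'[OF int] by simp
  ultimately show ?thesis by (simp add: has_bochner_integral_iff)
qed

text \<open>The radial density u^(DIM/a - 1) and the factor |x|^(a - 2), a multiple of u^(1 - 2/a),
  combine to u^l with l = (DIM - 2) / a. The constants are left out, since Weber's integral has
  none.\<close>

definition power_measure :: "real \<Rightarrow> real measure" where
  "power_measure l = density lborel (\<lambda>u. ennreal (indicator {0<..} u * u powr l))"

lemma sets_power_measure [simp, measurable_cong]: "sets (power_measure l) = sets borel"
  and space_power_measure [simp]: "space (power_measure l) = UNIV"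
  by (auto simp: power_measure_def)

lemma AE_power_measure_pos: "AE u in power_measure l. u > 0"
  unfolding power_measure_def by (subst AE_density) (auto simp: indicator_def)

lemma has_bochner_integral_power_measure_Gamma:
  assumes "l + s > -1"
  shows "has_bochner_integral (power_measure l) (\<lambda>u. u powr s * exp (- u)) (Gamma (l + s + 1))"
proof -
  have "nn_integral (power_measure l) (\<lambda>u. ennreal (u powr s * exp (- u))) =
    nn_integral lborel (\<lambda>u. ennreal (indicator {0..} u * u powr (l + s + 1 - 1) / exp u))"
    unfolding power_measure_def
    by (subst nn_integral_density)
       (auto intro!: nn_integral_cong simp: indicator_def ennreal_mult'[symmetric] powr_add
           exp_minus field_simps)
  also have "\<dots> = ennreal (Gamma (l + s + 1))"
    using assms by (subst Gamma_conv_nn_integral_real) auto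
  finally show ?thesis
    using assms
    by (intro has_bochner_integral_nn_integral) (auto intro: Gamma_real_nonneg)
qed

text \<open>The universal dominating function: kernels grow like exp(K * sqrt u). By AM-GM, K * sqrt
  u is at most K^2/2 + u/2, which still leaves half of the decay of exp(-u).\<close>

lemma integrable_power_measure_exp_sqrt:
  assumes "l > -1"
  shows "integrable (power_measure l) (\<lambda>u. exp (K * sqrt u) * exp (- u))"
proof -
  have "integrable (power_measure l) (\<lambda>u. exp (K\<^sup>2 / 2) * exp (- u / 2))"
  proof (intro integrable_mult_right)
    \<comment> \<open>Halving the argument of the Gamma integrand produces exp(-u/2); the factor
      \<open>2 powr l\<close> turns \<open>(u / 2) powr l\<close> back into
      \<open>u powr l\<close>.\<close>
    define f where "f u = indicator {0<..} u * (u powr l * exp (- u))" for u :: real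
    have "integrable (power_measure l) (\<lambda>u. u powr 0 * exp (- u))"
      using has_bochner_integral_power_measure_Gamma[of l 0] assms
      by (simp add: has_bochner_integral_iff)
    then have "integrable lborel (\<lambda>u. (indicator {0<..} u * u powr l) *\<^sub>R (u powr 0 * exp (- u)))"
      unfolding power_measure_def by (subst (asm) integrable_density) auto
    also have "(\<lambda>u. (indicator {0<..} u * u powr l) *\<^sub>R (u powr 0 * exp (- u))) = f"
      by (auto simp: f_def indicator_def)
    finally have "integrable lborel (\<lambda>u. 2 powr l * f (0 + 1 / 2 * u))"
      by (intro integrable_mult_right lborel_integrable_real_affine) auto
    also have "(\<lambda>u. 2 powr l * f (0 + 1 / 2 * u)) =
        (\<lambda>u. (indicator {0<..} u * u powr l) *\<^sub>R exp (- u / 2))"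
      by (auto simp: f_def indicator_def powr_divide)
    finally show "integrable (power_measure l) (\<lambda>u. exp (- u / 2))"
      unfolding power_measure_def by (subst integrable_density) auto
  qed
  then show ?thesis
  proof (rule Bochner_Integration.integrable_bound)
    have "exp (K * sqrt u) * exp (- u) \<le> exp (K\<^sup>2 / 2) * exp (- u / 2)" if "u > 0" for u :: real
    proof -
      have "0 \<le> (K - sqrt u)\<^sup>2" by simp
      then have "K * sqrt u - u \<le> K\<^sup>2 / 2 - u / 2"
        using that by (simp add: power2_diff)
      then show ?thesis by (simp flip: exp_add)
    qed
    then show "AE u in power_measure l. norm (exp (K * sqrt u) * exp (- u)) \<le>
        norm (exp (K\<^sup>2 / 2) * exp (- u / 2))"
      using AE_power_measure_pos[of l] by (auto elim!: eventually_mono)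
  qed auto
qed

text \<open>Away from the origin |x|^(a - 2) equals (u / c)^(1 - 2/a), so the weight is a radial
  function and joins the density of \<open>radial_measure\<close>. The exponent of \<open>c\<close>
  is where the power of t in the heat kernel comes from.\<close>

lemma has_bochner_integral_polar:
  fixes \<phi> :: "real \<Rightarrow> 'c::{real_normed_field, banach, second_countable_topology}"
    and \<psi> :: "'a::euclidean_space \<Rightarrow> 'c"
  assumes a: "a > 0" and c: "c > 0"
    and \<phi>: "integrable (power_measure ((real DIM('a) - 2) / a)) \<phi>"
    and \<psi>: "integrable cone_measure \<psi>"
  shows "has_bochner_integral lborel
     (\<lambda>x. \<phi> (c * norm x powr a) * \<psi> (sgn x) * of_real (1 / norm x powr (2 - a)))
     (of_real (DIM('a) / a * c powr (- ((real DIM('a) - 2) / a + 1))) *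
      (\<integral>u. \<phi> u \<partial>power_measure ((real DIM('a) - 2) / a)) * (\<integral>\<eta>. \<psi> \<eta> \<partial>cone_measure))"
proof -
  define p where "p = DIM('a) / a"
  define l where "l = (real DIM('a) - 2) / a"
  define C where "C = p * c powr (- (l + 1))"
  have p: "p > 0" using a by (simp add: p_def)
  have pl: "p - 1 + (1 - 2 / a) = l" using a by (simp add: p_def l_def field_simps)
  have [measurable]: "\<phi> \<in> borel_measurable borel" "\<psi> \<in> borel_measurable borel"
    using borel_measurable_integrable[OF \<phi>] borel_measurable_integrable[OF \<psi>] by auto
  define \<rho> where "\<rho> u = \<phi> u * of_real ((u / c) powr (1 - 2 / a))" for u
  have [measurable]: "\<rho> \<in> borel_measurable borel" unfolding \<rho>_def by measurable
  have eq: "(indicator {0<..} u * (p * c powr - p * u powr (p - 1))) *\<^sub>R \<rho> u =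
      C *\<^sub>R ((indicator {0<..} u * u powr l) *\<^sub>R \<phi> u)" for u :: real
  proof (cases "u > 0")
    case True
    have e: "- (l + 1) = - p + - (1 - 2 / a)"
      using pl by linarith
    have c1: "c powr (- (l + 1)) = c powr (- p) * c powr (- (1 - 2 / a))"
      unfolding e by (rule powr_add)
    have u1: "u powr l = u powr (p - 1) * u powr (1 - 2 / a)"
      unfolding pl[symmetric] by (rule powr_add)
    have "(u / c) powr (1 - 2 / a) = u powr (1 - 2 / a) * c powr (- (1 - 2 / a))"
      using True c by (simp only: powr_divide powr_minus less_imp_le) (simp only: divide_inverse)
    then have *: "p * c powr (- p) * u powr (p - 1) * (u / c) powr (1 - 2 / a) = C * u powr l"
      unfolding C_def c1 u1 by (simp only: mult_ac)
    have "(indicator {0<..} u * (p * c powr - p * u powr (p - 1))) *\<^sub>R \<rho> u =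
       of_real (p * c powr (- p) * u powr (p - 1) * (u / c) powr (1 - 2 / a)) * \<phi> u"
      using True by (simp add: \<rho>_def scaleR_conv_of_real)
    then show ?thesis
      unfolding * using True by (simp add: scaleR_conv_of_real)
  qed simp
  have \<phi>': "integrable lborel (\<lambda>u. (indicator {0<..} u * u powr l) *\<^sub>R \<phi> u)"
    using \<phi> unfolding power_measure_def l_def[symmetric] by (subst (asm) integrable_density) auto
  have 1: "integrable (radial_measure p c) \<rho>"
    using p \<phi>' unfolding radial_measure_def
    by (subst integrable_density) (auto simp only: eq intro!: integrable_scaleR_right, auto)
  have 2: "(\<integral>u. \<rho> u \<partial>radial_measure p c) = of_real C * (\<integral>u. \<phi> u \<partial>power_measure l)"
  proof -
    have "(\<integral>u. \<rho> u \<partial>radial_measure p c) = (\<integral>u. C *\<^sub>R ((indicator {0<..} u * u powr l) *\<^sub>R \<phi> u)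
        \<partial>lborel)"
      using p unfolding radial_measure_def eq[symmetric] by (subst integral_density) auto
    also have "\<dots> = of_real C * (\<integral>u. (indicator {0<..} u * u powr l) *\<^sub>R \<phi> u \<partial>lborel)"
      by (simp only: integral_scaleR_right) (simp only: scaleR_conv_of_real)
    also have "(\<integral>u. (indicator {0<..} u * u powr l) *\<^sub>R \<phi> u \<partial>lborel) = (\<integral>u. \<phi> u \<partial>power_measure l)"
      unfolding power_measure_def by (subst integral_density) auto
    finally show ?thesis .
  qed
  interpret pair_sigma_finite "radial_measure p c" "cone_measure :: 'a measure"
    using sigma_finite_radial_measure[OF p c] finite_measure_cone_measure finite_measure.axioms(1)
    unfolding pair_sigma_finite_def by blast
  have "has_bochner_integral (distr lborel (borel \<Otimes>\<^sub>M borel) (\<lambda>x::'a. (c * norm x powr a, sgn x)))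
     (\<lambda>z. \<rho> (fst z) * \<psi> (snd z)) (of_real C * (\<integral>u. \<phi> u \<partial>power_measure l) * (\<integral>\<eta>. \<psi> \<eta> \<partial>cone_measure))"
    using has_bochner_integral_prod[OF 1 \<psi>] polar_measure[OF a c, where 'a='a] unfolding 2
        by (simp add: p_def)
  then have "integrable (distr lborel (borel \<Otimes>\<^sub>M borel) (\<lambda>x::'a. (c * norm x powr a, sgn x)))
      (\<lambda>z. \<rho> (fst z) * \<psi> (snd z))"
    and "integral\<^sup>L (distr lborel (borel \<Otimes>\<^sub>M borel) (\<lambda>x::'a. (c * norm x powr a, sgn x)))
        (\<lambda>z. \<rho> (fst z) * \<psi> (snd z)) =
      of_real C * (\<integral>u. \<phi> u \<partial>power_measure l) * (\<integral>\<eta>. \<psi> \<eta> \<partial>cone_measure)"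
    by (auto simp only: has_bochner_integral_iff)
  then have "has_bochner_integral lborel (\<lambda>x::'a. \<rho> (c * norm x powr a) * \<psi> (sgn x))
     (of_real C * (\<integral>u. \<phi> u \<partial>power_measure l) * (\<integral>\<eta>. \<psi> \<eta> \<partial>cone_measure))"
    by (subst (asm) integrable_distr_eq, measurable, subst (asm) integral_distr, measurable)
       (simp add: has_bochner_integral_iff)
  also have "?this \<longleftrightarrow> has_bochner_integral lborel
     (\<lambda>x. \<phi> (c * norm x powr a) * \<psi> (sgn x) * of_real (1 / norm x powr (2 - a)))
     (of_real C * (\<integral>u. \<phi> u \<partial>power_measure l) * (\<integral>\<eta>. \<psi> \<eta> \<partial>cone_measure))"
  proof (intro has_bochner_integral_cong_AE)
    show "AE x in lborel. \<rho> (c * norm x powr a) * \<psi> (sgn x) = \<phi> (c * norm x powr a) * \<psi> (sgn x) *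
        of_real (1 / norm (x::'a) powr (2 - a))"
      using AE_lborel_singleton[of "0::'a"]
    proof eventually_elim
      case (elim x)
      have "(c * norm x powr a / c) powr (1 - 2 / a) = norm x powr (a - 2)"
        using elim a c by (simp add: powr_powr right_diff_distrib)
      also have "\<dots> = 1 / norm x powr (2 - a)"
        using powr_minus_divide[of "norm x" "2 - a"] by simp
      finally show ?case by (simp add: \<rho>_def mult_ac)
    qed
  qed auto
  finally show ?thesis
    by (simp add: C_def p_def l_def)
qed

subsection \<open>Gegenbauer polynomials\<close>

text \<open>Exponents of binomial series add, also after composition, so division by the power nu +
  1 becomes multiplication by the power -(nu + 1), whose coefficients can be computed.\<close>

lemma gegenbauer_norm_fps_eq:
  "gegenbauer_norm_fps \<nu> t =
     (1 - fps_X ^ 2) * (fps_binomial (- (\<nu> + 1)) oo (fps_X ^ 2 - fps_const (2 * t) * fps_X))"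
proof -
  let ?Y = "fps_X ^ 2 - fps_const (2 * t) * fps_X :: real fps"
  have "(fps_binomial (\<nu> + 1) oo ?Y) * (fps_binomial (- (\<nu> + 1)) oo ?Y) =
      (fps_binomial (\<nu> + 1) * fps_binomial (- (\<nu> + 1))) oo ?Y"
    by (subst fps_compose_mult_distrib) auto
  also have "\<dots> = 1"
    by (simp flip: fps_binomial_add_mult)
  finally have "gegenbauer_norm_fps \<nu> t = gegenbauer_norm_fps \<nu> t *
      ((fps_binomial (\<nu> + 1) oo ?Y) * (fps_binomial (- (\<nu> + 1)) oo ?Y))"
    by simp
  then show ?thesis
    using gegenbauer_norm_fps_mult[of \<nu> t] by (metis mult.assoc)
qed

text \<open>Coefficients of the classical Gegenbauer polynomial with parameter nu + 1, in powers of
  2t.\<close>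

definition gegenbauer_coeff :: "real \<Rightarrow> nat \<Rightarrow> nat \<Rightarrow> real" where
  "gegenbauer_coeff \<nu> m l =
     (if 2 * l \<le> m then (-1) ^ l * pochhammer (\<nu> + 1) (m - l) / (fact l * fact (m - 2 * l)) else 0)"

lemma sum_gegenbauer_coeff_extend:
  "(\<Sum>l\<le>m div 2. gegenbauer_coeff \<nu> m l * x ^ (m - 2 * l)) = 
   (\<Sum>l\<le>m. gegenbauer_coeff \<nu> m l * x ^ (m - 2 * l))"
  by (rule sum.mono_neutral_left) (auto simp: gegenbauer_coeff_def)

lemma fps_nth_gegenbauer_kernel:
  "fps_nth (fps_binomial (- (\<nu> + 1)) oo (fps_X ^ 2 - fps_const (2 * t) * fps_X)) m =
     (\<Sum>l\<le>m. gegenbauer_coeff \<nu> m l * (2 * t) ^ (m - 2 * l))"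
proof -
  let ?Y = "fps_X ^ 2 - fps_const (2 * t) * fps_X :: real fps"
  have Yn: "fps_nth (?Y ^ i) m = of_nat (i choose (m - i)) * (- 2 * t) ^ (2 * i - m)" if "i \<le>
      m" for i
  proof -
    \<comment> \<open>After this factorization the m-th coefficient of \<open>?Y ^ i\<close> is a
      single binomial term. Writing l = m - i then gives the usual form of the sum.\<close>
    have "?Y = fps_X * (fps_X + fps_const (- 2 * t))"
      by (simp add: algebra_simps power2_eq_square flip: fps_const_neg)
    then have Yi: "?Y ^ i = fps_X ^ i * (fps_X + fps_const (- 2 * t)) ^ i"
      by (simp only: power_mult_distrib)
    have "fps_nth ((fps_X + fps_const (- 2 * t)) ^ i) (m - i) =
        of_nat (i choose (m - i)) * (- 2 * t) ^ (i - (m - i))"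
    proof -
      have "(fps_X + fps_const (- 2 * t)) ^ i =
         (\<Sum>k\<le>i. of_nat (i choose k) * fps_X ^ k * fps_const (- 2 * t) ^ (i - k))"
        by (rule binomial_ring)
      then have "fps_nth ((fps_X + fps_const (- 2 * t)) ^ i) (m - i) =
         (\<Sum>k\<le>i. if k = m - i then of_nat (i choose k) * (- 2 * t) ^ (i - k) else 0)"
        by (simp only: fps_sum_nth)
          (intro sum.cong refl, auto simp: fps_X_power_mult_nth mult.assoc fps_const_power
              fps_of_nat[symmetric]
            simp del: fps_of_nat)
      then show ?thesis
        by (simp add: sum.delta binomial_eq_0)
    qed
    then have "fps_nth (?Y ^ i) m = of_nat (i choose (m - i)) * (- 2 * t) ^ (i - (m - i))"
      using that by (simp only: Yi fps_X_power_mult_nth) simp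
    also have "i - (m - i) = 2 * i - m"
      using that by simp
    finally show ?thesis .
  qed
  have "fps_nth (fps_binomial (- (\<nu> + 1)) oo ?Y) m =
     (\<Sum>i=0..m. ((- (\<nu> + 1)) gchoose i) * (of_nat (i choose (m - i)) * (- 2 * t) ^ (2 * i - m)))"
    by (simp only: fps_compose_nth) (intro sum.cong refl, simp add: Yn)
  also have "\<dots> = (\<Sum>l\<le>m. ((- (\<nu> + 1)) gchoose (m - l)) * (of_nat ((m - l) choose l) *
      (- 2 * t) ^ (m - 2 * l)))"
  proof (rule sum.reindex_bij_witness[of _ "\<lambda>l. m - l" "\<lambda>l. m - l"], goal_cases)
    case (5 i)
    then have "m - (m - i) = i" "m - 2 * (m - i) = 2 * i - m" by auto
    then show ?case by (simp only:)
  qed auto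
  also have "\<dots> = (\<Sum>l\<le>m. gegenbauer_coeff \<nu> m l * (2 * t) ^ (m - 2 * l))"
  proof (rule sum.cong[OF refl])
    fix l assume "l \<in> {..m}"
    show "((- (\<nu> + 1)) gchoose (m - l)) * (of_nat ((m - l) choose l) * (- 2 * t) ^ (m - 2 * l)) =
       gegenbauer_coeff \<nu> m l * (2 * t) ^ (m - 2 * l)"
    proof (cases "2 * l \<le> m")
      case True
      define d where "d = m - 2 * l"
      have m: "m = d + 2 * l" using True unfolding d_def by simp
      have ch: "real ((d + l) choose l) = fact (d + l) / (fact l * fact d)"
        by (subst binomial_fact) auto
      have s: "(-1::real) ^ (d + l) * (-1) ^ d = (-1) ^ l"
        by (cases "even d"; cases "even l") simp_all
      have pow: "(- 2 * t) ^ d = (-1) ^ d * (2 * t) ^ d"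
        using power_minus[of "2 * t" d] by simp
      have g: "(- (\<nu> + 1)) gchoose (d + l) = (-1) ^ (d + l) * pochhammer (\<nu> + 1) (d + l) /
          fact (d + l)"
        by (simp only: gbinomial_pochhammer minus_minus)
      have idx: "m - l = d + l" "m - 2 * l = d" using m by auto
      have "((- (\<nu> + 1)) gchoose (d + l)) * (real ((d + l) choose l) * (- 2 * t) ^ d) =
         ((-1) ^ (d + l) * (-1) ^ d) * (pochhammer (\<nu> + 1) (d + l) / (fact l * fact d)) *
             (2 * t) ^ d"
        unfolding g ch pow by simp
      then show ?thesis
        unfolding gegenbauer_coeff_def idx s using True by simp
    next
      case False
      then show ?thesis
        by (simp add: gegenbauer_coeff_def binomial_eq_0)
    qed
  qed
  finally show ?thesis .
qed

text \<open>Coefficients of (m + nu)/nu times the classical polynomial with parameter nu, where the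
  factor nu of its Pochhammer symbol has been cancelled. In this form nu = 0 is admissible.\<close>

definition gegenbauer_norm_coeff :: "real \<Rightarrow> nat \<Rightarrow> nat \<Rightarrow> real" where
  "gegenbauer_norm_coeff \<nu> m l =
     (-1) ^ l * (real m + \<nu>) * pochhammer (\<nu> + 1) (m - l - 1) / (fact l * fact (m - 2 * l))"

text \<open>The factor 1 - X^2 makes the m-th coefficient a difference of classical polynomials with
  parameter nu + 1 and degrees m and m - 2. For m = 0 the truncated index m - l - 1 would give nu
  instead of 1.\<close>

lemma gegenbauer_norm_explicit:
  assumes "m > 0"
  shows "gegenbauer_norm \<nu> m t = (\<Sum>l\<le>m div 2. gegenbauer_norm_coeff \<nu> m l * (2 * t) ^ (m - 2 * l))"
proof -
  let ?K = "fps_binomial (- (\<nu> + 1)) oo (fps_X ^ 2 - fps_const (2 * t) * fps_X) :: real fps"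
  have "gegenbauer_norm \<nu> m t = fps_nth (?K - fps_X ^ 2 * ?K) m"
    by (simp add: gegenbauer_norm_def gegenbauer_norm_fps_eq algebra_simps)
  also have "\<dots> = fps_nth ?K m - (if m < 2 then 0 else fps_nth ?K (m - 2))"
    by (simp add: fps_X_power_mult_nth)
  also have "\<dots> = (\<Sum>l\<le>m div 2. gegenbauer_norm_coeff \<nu> m l * (2 * t) ^ (m - 2 * l))"
  proof (cases "m < 2")
    case True
    then have "m = 1" using assms by simp
    then show ?thesis
      unfolding fps_nth_gegenbauer_kernel
      by (simp add: gegenbauer_coeff_def gegenbauer_norm_coeff_def add.commute)
  next
    case False
    \<comment> \<open>Index shift by one, so that the polynomial of degree m - 2 is also written in
      the powers m - 2 * l.\<close>
    define g where "g l = (if l = 0 then 0 else gegenbauer_coeff \<nu> (m - 2) (l - 1))" for l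
    have "(\<Sum>l\<le>m div 2. g l * (2 * t) ^ (m - 2 * l)) =
          (\<Sum>l\<le>(m - 2) div 2. gegenbauer_coeff \<nu> (m - 2) l * (2 * t) ^ (m - 2 - 2 * l))"
    proof -
      have "m div 2 = Suc ((m - 2) div 2)" using False by simp
      then show ?thesis
        by (simp only: sum.atMost_Suc_shift) (simp add: g_def diff_diff_left)
    qed
    then have "fps_nth ?K m - fps_nth ?K (m - 2) =
       (\<Sum>l\<le>m div 2. (gegenbauer_coeff \<nu> m l - g l) * (2 * t) ^ (m - 2 * l))"
      unfolding fps_nth_gegenbauer_kernel sum_gegenbauer_coeff_extend[symmetric]
      by (simp only: left_diff_distrib sum_subtractf)
    also have "\<dots> = (\<Sum>l\<le>m div 2. gegenbauer_norm_coeff \<nu> m l * (2 * t) ^ (m - 2 * l))"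
    proof (rule sum.cong[OF refl])
      fix l assume "l \<in> {..m div 2}"
      then have l: "2 * l \<le> m" by auto
      have "gegenbauer_coeff \<nu> m l - g l = gegenbauer_norm_coeff \<nu> m l"
      proof (cases l)
        case 0
        have "m = Suc (m - 1)" using False by simp
        then have "pochhammer (\<nu> + 1) m = pochhammer (\<nu> + 1) (m - 1) * (\<nu> + 1 + real (m - 1))"
          by (metis pochhammer_Suc)
        then show ?thesis
          using 0 False by (simp add: g_def gegenbauer_coeff_def gegenbauer_norm_coeff_def
              of_nat_diff)
      next
        case (Suc k)
        define e where "e = m - 2 * l"
        have m: "m = e + 2 * k + 2" using l Suc by (simp add: e_def)
        have "m - l = Suc (e + k)" "m - l - 1 = e + k" "m - 2 - (l - 1) = e + k" "m - 2 * l =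
            e" "m - 2 - 2 * (l - 1) = e"
           "2 * (l - 1) \<le> m - 2" "real m = real e + 2 * real k + 2"
          using Suc m by auto
        then have 1: "gegenbauer_coeff \<nu> m l = (-1) ^ l * pochhammer (\<nu> + 1) (Suc (e + k)) /
            (fact l * fact e)"
          and 2: "g l = (-1) ^ k * pochhammer (\<nu> + 1) (e + k) / (fact k * fact e)"
          and 3: "gegenbauer_norm_coeff \<nu> m l = (-1) ^ l * (real e + 2 * real k + 2 + \<nu>) *
              pochhammer (\<nu> + 1) (e + k) / (fact l * fact e)"
          using l Suc unfolding gegenbauer_coeff_def gegenbauer_norm_coeff_def g_def by auto
        have 4: "g l = - ((-1) ^ l * pochhammer (\<nu> + 1) (e + k) * real (Suc k) / (fact l * fact e))"
          by (subst 2) (simp add: Suc divide_simps del: of_nat_Suc)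
        show ?thesis
          by (simp only: 1 3 4 pochhammer_Suc) (simp add: Suc divide_simps, simp add: algebra_simps)
      qed
      then show "(gegenbauer_coeff \<nu> m l - g l) * (2 * t) ^ (m - 2 * l) =
         gegenbauer_norm_coeff \<nu> m l * (2 * t) ^ (m - 2 * l)" by simp
    qed
    finally show ?thesis using False by simp
  qed
  finally show ?thesis .
qed

section \<open>Continuity and growth of the normalized polynomials\<close>

lemma continuous_on_gegenbauer_norm: "continuous_on UNIV (gegenbauer_norm \<nu> m)"
proof (cases "m = 0")
  case True
  then show ?thesis by (simp add: gegenbauer_norm_0 cong: continuous_on_cong)
next
  case False
  then have "gegenbauer_norm \<nu> m = (\<lambda>t. \<Sum>l\<le>m div 2. gegenbauer_norm_coeff \<nu> m l *
      (2 * t) ^ (m - 2 * l))"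
    by (intro ext gegenbauer_norm_explicit) simp
  then show ?thesis by (simp only:) (intro continuous_intros)
qed

lemma borel_measurable_gegenbauer_norm [measurable]: "gegenbauer_norm \<nu> m \<in> borel_measurable borel"
  by (intro borel_measurable_continuous_onI continuous_on_gegenbauer_norm)

lemma pochhammer_le_fact:
  assumes "(x::real) > 0"
  shows "pochhammer x k \<le> (x + 1) ^ k * fact k"
proof (induction k)
  case (Suc k)
  have "pochhammer x (Suc k) = pochhammer x k * (x + real k)"
    by (rule pochhammer_Suc)
  also have "\<dots> \<le> ((x + 1) ^ k * fact k) * ((x + 1) * real (Suc k))"
    using assms Suc by (intro mult_mono pochhammer_nonneg) (auto simp: algebra_simps
        pochhammer_nonneg)
  finally show ?case by (simp add: algebra_simps)
qed auto

text \<open>Crude but sufficient, since any geometric rate in m will be outweighed by the Bessel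
  factors. Each coefficient is compared with a binomial coefficient of row m, and the row sums to
  2^m.\<close>

lemma abs_gegenbauer_norm_le:
  assumes \<nu>: "\<nu> > -1" and t: "\<bar>t\<bar> \<le> 1"
  shows "\<bar>gegenbauer_norm \<nu> m t\<bar> \<le> 2 * (\<nu> + 2) * (4 * (\<nu> + 2)) ^ m"
proof (cases "m = 0")
  case True
  then show ?thesis using \<nu> by (simp add: gegenbauer_norm_0)
next
  case False
  define A where "A = \<nu> + 2"
  have A: "A \<ge> 1" using \<nu> by (simp add: A_def)
  have c: "\<bar>gegenbauer_norm_coeff \<nu> m l\<bar> * 2 ^ (m - 2 * l) \<le> 2 * A * (2 * A) ^ m *
      real (m choose l)"
    if l: "2 * l \<le> m" for l
  proof -
    have "\<bar>gegenbauer_norm_coeff \<nu> m l\<bar> = (real m + \<nu>) * pochhammer (\<nu> + 1) (m - l - 1) /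
        (fact l * fact (m - 2 * l))"
      using \<nu> False
      by (simp add: gegenbauer_norm_coeff_def abs_mult pochhammer_nonneg)
    also have "(real m + \<nu>) * pochhammer (\<nu> + 1) (m - l - 1) \<le>
        (real m * A) * (A ^ (m - l - 1) * fact (m - l - 1))"
    proof (intro mult_mono)
      have "\<nu> \<le> real m * (\<nu> + 1)" if "m > 0"
      proof -
        have "1 * (\<nu> + 1) \<le> real m * (\<nu> + 1)" using that \<nu> by (intro mult_right_mono) auto
        then show ?thesis by simp
      qed
      then show "real m + \<nu> \<le> real m * A"
        using False by (simp add: A_def algebra_simps)
      show "pochhammer (\<nu> + 1) (m - l - 1) \<le> A ^ (m - l - 1) * fact (m - l - 1)"
        using pochhammer_le_fact[of "\<nu> + 1" "m - l - 1"] \<nu> by (simp add: A_def add.commute)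
    qed (use A \<nu> in \<open>auto intro!: pochhammer_nonneg\<close>)
    \<comment> \<open>As 2 * l is at most m, m is at most 2 * (m - l). The factor m - l then
      completes the factorial, and the quotient of factorials becomes a binomial
      coefficient.\<close>
    also have "(real m * A) * (A ^ (m - l - 1) * fact (m - l - 1)) \<le> (2 * real (m - l) * A) *
        (A ^ m * fact (m - l - 1))"
      using l A by (intro mult_mono mult_right_mono power_increasing) auto
    also have "\<dots> = 2 * A * A ^ m * fact (m - l)"
      using l False by (simp add: fact_reduce[of "m - l"])
    finally have "\<bar>gegenbauer_norm_coeff \<nu> m l\<bar> \<le>
        2 * A * A ^ m * (fact (m - l) / (fact l * fact (m - 2 * l)))"
      by (simp add: divide_right_mono)
    also have "fact (m - l) / (fact l * fact (m - 2 * l)) = real ((m - l) choose l)"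
      using l by (subst binomial_fact) (auto simp: mult_2 diff_diff_left)
    also have "2 * A * A ^ m * real ((m - l) choose l) \<le> 2 * A * A ^ m * real (m choose l)"
      using A by (intro mult_left_mono) (auto intro!: binomial_right_mono)
    finally have "\<bar>gegenbauer_norm_coeff \<nu> m l\<bar> * 2 ^ (m - 2 * l) \<le>
        2 * A * A ^ m * real (m choose l) * 2 ^ m"
      using A by (intro mult_mono) (auto intro!: power_increasing)
    then show ?thesis by (simp add: power_mult_distrib mult_ac)
  qed
  have "\<bar>gegenbauer_norm \<nu> m t\<bar> \<le> (\<Sum>l\<le>m div 2. \<bar>gegenbauer_norm_coeff \<nu> m l *
      (2 * t) ^ (m - 2 * l)\<bar>)"
    using False by (simp add: gegenbauer_norm_explicit sum_abs)
  also have "\<dots> \<le> (\<Sum>l\<le>m div 2. 2 * A * (2 * A) ^ m * real (m choose l))"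
  proof (rule sum_mono)
    fix l assume l: "l \<in> {..m div 2}"
    have "\<bar>2 * t\<bar> ^ (m - 2 * l) \<le> 2 ^ (m - 2 * l)"
      using t by (intro power_mono) auto
    then have "\<bar>gegenbauer_norm_coeff \<nu> m l * (2 * t) ^ (m - 2 * l)\<bar> \<le>
        \<bar>gegenbauer_norm_coeff \<nu> m l\<bar> * 2 ^ (m - 2 * l)"
      by (simp add: abs_mult power_abs mult_left_mono)
    also have "\<dots> \<le> 2 * A * (2 * A) ^ m * real (m choose l)"
      using l by (intro c) auto
    finally show "\<bar>gegenbauer_norm_coeff \<nu> m l * (2 * t) ^ (m - 2 * l)\<bar> \<le> 2 * A * (2 * A) ^ m *
        real (m choose l)" .
  qed
  also have "\<dots> \<le> (\<Sum>l\<le>m. 2 * A * (2 * A) ^ m * real (m choose l))"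
    using A by (intro sum_mono2) auto
  also have "\<dots> = 2 * A * (2 * A) ^ m * real (\<Sum>l\<le>m. m choose l)"
    by (simp add: sum_distrib_left)
  also have "\<dots> = 2 * A * (4 * A) ^ m"
  proof -
    have "(4 * A) ^ m = (2 * A * 2) ^ m" by simp
    then show ?thesis by (simp only: choose_row_sum power_mult_distrib) simp
  qed
  finally show ?thesis by (simp add: A_def)
qed

subsection \<open>Orthogonality on the sphere\<close>

text \<open>Pascal's rule: a finite difference of order p + 1 is one of order p applied to the first
  difference. Both evaluations below are inductions along this step.\<close>

lemma alternating_binomial_sum_Suc:
  fixes f :: "nat \<Rightarrow> real"
  shows "(\<Sum>l\<le>Suc p. (-1) ^ l * of_nat (Suc p choose l) * f l) =
    (\<Sum>l\<le>p. (-1) ^ l * of_nat (p choose l) * (f l - f (Suc l)))"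
proof -
  have "(\<Sum>l\<le>Suc p. (-1) ^ l * of_nat (Suc p choose l) * f l) =
     f 0 + (\<Sum>l\<le>p. (-1) ^ Suc l * of_nat (Suc p choose Suc l) * f (Suc l))"
    by (subst sum.atMost_Suc_shift) simp
  also have "(\<Sum>l\<le>p. (-1) ^ Suc l * of_nat (Suc p choose Suc l) * f (Suc l)) =
     (\<Sum>l\<le>p. (-1) ^ Suc l * of_nat (p choose Suc l) * f (Suc l)) -
     (\<Sum>l\<le>p. (-1) ^ l * of_nat (p choose l) * f (Suc l))"
    by (simp only: sum_subtractf[symmetric]) (intro sum.cong refl, simp add: algebra_simps)
  also have "f 0 + ((\<Sum>l\<le>p. (-1) ^ Suc l * of_nat (p choose Suc l) * f (Suc l)) -
     (\<Sum>l\<le>p. (-1) ^ l * of_nat (p choose l) * f (Suc l))) =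
     (\<Sum>l\<le>Suc p. (-1) ^ l * of_nat (p choose l) * f l) - (\<Sum>l\<le>p. (-1) ^ l * of_nat (p choose l) *
         f (Suc l))"
    by (subst sum.atMost_Suc_shift) simp
  also have "(\<Sum>l\<le>Suc p. (-1) ^ l * of_nat (p choose l) * f l) =
      (\<Sum>l\<le>p. (-1) ^ l * of_nat (p choose l) * f l)"
    by simp
  finally show ?thesis by (simp add: sum_subtractf[symmetric] algebra_simps)
qed

text \<open>The summand is a polynomial of degree d in l, and differences of order p > d annihilate
  it. The backward difference of a rising factorial is d times the one of length d - 1, which drives
  the induction.\<close>

lemma alternating_binomial_sum_pochhammer:
  fixes z :: real
  assumes "d < p"
  shows "(\<Sum>l\<le>p. (-1) ^ l * of_nat (p choose l) * pochhammer (z - of_nat l) d) = 0"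
  using assms
proof (induction p arbitrary: z d)
  case (Suc p)
  show ?case
  proof (cases d)
    case 0
    then show ?thesis by (simp only: alternating_binomial_sum_Suc) simp
  next
    case (Suc e)
    have "pochhammer x (Suc e) - pochhammer (x - 1) (Suc e) = real (Suc e) * pochhammer x e"
        for x :: real
      using pochhammer_rec[of "x - 1" e] by (simp add: pochhammer_rec' algebra_simps)
    then have "pochhammer (z - of_nat l) d - pochhammer (z - of_nat (Suc l)) d =
        real (Suc e) * pochhammer (z - of_nat l) e" for l
      unfolding Suc by (metis diff_diff_eq of_nat_Suc add.commute)
    then have "(\<Sum>l\<le>Suc p. (-1) ^ l * of_nat (Suc p choose l) * pochhammer (z - of_nat l) d) =
       real (Suc e) * (\<Sum>l\<le>p. (-1) ^ l * of_nat (p choose l) * pochhammer (z - of_nat l) e)"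
      by (simp only: alternating_binomial_sum_Suc sum_distrib_left) (simp only: mult_ac)
    then show ?thesis
      using Suc.IH[of e z] Suc.prems Suc by simp
  qed
qed simp

text \<open>Partial fractions of 1 / ((y - p) ... (y - 1) y), up to the factor (-1)^p * p!. The
  bound on \<open>y\<close> keeps all poles away.\<close>

lemma alternating_binomial_sum_inverse:
  fixes y :: real
  assumes "y > of_nat p"
  shows "(\<Sum>l\<le>p. (-1) ^ l * of_nat (p choose l) * inverse (y - of_nat l)) =
     (-1) ^ p * fact p / pochhammer (y - of_nat p) (Suc p)"
  using assms
proof (induction p arbitrary: y)
  case (Suc p)
  define P where "P = pochhammer (y - of_nat p) p"
  have y: "y > of_nat p" "y - 1 > of_nat p" "y > 0" using Suc.prems by auto
  have P: "P > 0" using y by (auto simp: P_def intro!: pochhammer_pos)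
  have 1: "pochhammer (y - of_nat p) (Suc p) = P * y"
    by (simp add: P_def pochhammer_Suc)
  have 2: "pochhammer (y - 1 - of_nat p) (Suc p) = (y - 1 - of_nat p) * P"
    by (simp add: P_def pochhammer_rec)
  have "y - of_nat (Suc p) = y - 1 - of_nat p"
    by simp
  then have 3: "pochhammer (y - of_nat (Suc p)) (Suc (Suc p)) = (y - 1 - of_nat p) * P * y"
    by (simp only: pochhammer_Suc[of _ "Suc p"] 2) simp
  have "(\<Sum>l\<le>Suc p. (-1) ^ l * of_nat (Suc p choose l) * inverse (y - of_nat l)) =
      (\<Sum>l\<le>p. (-1) ^ l * of_nat (p choose l) * inverse (y - of_nat l)) - 
      (\<Sum>l\<le>p. (-1) ^ l * of_nat (p choose l) * inverse (y - 1 - of_nat l))"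
    by (simp only: alternating_binomial_sum_Suc) (simp add: sum_subtractf[symmetric] algebra_simps)
  also have "\<dots> = (-1) ^ p * fact p / (P * y) - (-1) ^ p * fact p / ((y - 1 - of_nat p) * P)"
    using y by (simp only: Suc.IH 1 2)
  also have "\<dots> = (-1) ^ Suc p * fact (Suc p) / ((y - 1 - of_nat p) * P * y)"
    using y P by (simp add: divide_simps) (simp add: algebra_simps)
  finally show ?case unfolding 3 .
qed (simp add: inverse_eq_divide)

lemma powser_sums_0_imp_0:
  fixes d :: "nat \<Rightarrow> real"
  assumes "\<And>x. x \<noteq> 0 \<Longrightarrow> (\<lambda>n. d n * x ^ n) sums 0"
  shows "d n = 0"
  using assms
proof (induction n arbitrary: d)
  have d0: "d 0 = 0" if "\<And>x. x \<noteq> 0 \<Longrightarrow> (\<lambda>n. d n * x ^ n) sums 0" for d :: "nat \<Rightarrow> real"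
    using powser_limit_0_strong[of 1 d "\<lambda>_. 0"] that by (simp add: tendsto_const_iff)
  {
    case 0
    then show ?case by (rule d0)
  next
    case (Suc n)
    have "(\<lambda>n. d (Suc n) * x ^ n) sums 0" if "x \<noteq> 0" for x
    proof -
      have "(\<lambda>n. d (Suc n) * x ^ Suc n) sums 0"
        using Suc.prems[OF that] d0[OF Suc.prems] by (subst sums_Suc_iff) simp
      then have "(\<lambda>n. inverse x * (d (Suc n) * x ^ Suc n)) sums (inverse x * 0)"
        by (rule sums_mult)
      then show ?thesis using that by (simp add: field_simps)
    qed
    then show ?case by (rule Suc.IH)
  }
qed

text \<open>The binomial theorem twice, collected by the total power i = k + 2q of u. The index set
  says k >= 0 and k + q <= n, so that no natural subtraction in the factorials truncates.\<close>

lemma trinomial_expansion: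
  fixes u c :: real
  shows "(1 + 2 * c * u + u\<^sup>2) ^ n =
    (\<Sum>i\<le>2 * n. (\<Sum>q \<in> {q. q \<le> i div 2 \<and> i \<le> n + q}. fact n / (fact (i - 2 * q) * fact q *
        fact (n + q - i)) * (2 * c) ^ (i - 2 * q)) * u ^ i)"
proof -
  have "(1 + 2 * c * u + u\<^sup>2) ^ n = (2 * c * u + (u\<^sup>2 + 1)) ^ n"
    by (simp add: add_ac)
  also have "\<dots> = (\<Sum>k\<le>n. of_nat (n choose k) * (2 * c * u) ^ k *
      (\<Sum>q\<le>n - k. of_nat (n - k choose q) * (u\<^sup>2) ^ q * 1 ^ (n - k - q)))"
    by (simp only: binomial_ring)
  also have "\<dots> = (\<Sum>(k, q)\<in>(SIGMA k:{..n}. {..n - k}). fact n /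
      (fact k * fact q * fact (n - k - q)) * (2 * c) ^ k * u ^ (k + 2 * q))"
    by (subst sum.Sigma[symmetric])
       (auto simp: sum_distrib_left binomial_fact power_mult_distrib power_add power_mult
           intro!: sum.cong)
  also have "\<dots> = (\<Sum>(i, q)\<in>(SIGMA i:{..2 * n}. {q. q \<le> i div 2 \<and> i \<le> n + q}).
      fact n / (fact (i - 2 * q) * fact q * fact (n + q - i)) * (2 * c) ^ (i - 2 * q) * u ^ i)"
  proof (rule sum.reindex_bij_witness[of _ "\<lambda>(i, q). (i - 2 * q, q)" "\<lambda>(k, q). (k + 2 * q, q)"],
      goal_cases)
    case (5 a)
    obtain k q where a: "a = (k, q)" by (cases a)
    then have "n + q - (k + 2 * q) = n - k - q" by auto
    then show ?case unfolding a by simp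
  qed auto
  also have "\<dots> = (\<Sum>i\<le>2 * n. \<Sum>q \<in> {q. q \<le> i div 2 \<and> i \<le> n + q}. 
      fact n / (fact (i - 2 * q) * fact q * fact (n + q - i)) * (2 * c) ^ (i - 2 * q) * u ^ i)"
    by (subst sum.Sigma) (auto intro: finite_subset[of _ "{..i div 2}" for i])
  finally show ?thesis by (simp add: sum_distrib_right)
qed

section \<open>Moments of the sphere\<close>

lemma integrable_cone_measure:
  fixes f :: "'a::euclidean_space \<Rightarrow> 'b::{banach, second_countable_topology}"
  assumes "f \<in> borel_measurable borel" "\<And>\<eta>. norm \<eta> = 1 \<Longrightarrow> norm (f \<eta>) \<le> B"
  shows "integrable cone_measure f"
proof (rule finite_measure.integrable_const_bound[OF finite_measure_cone_measure])
  show "AE \<eta> in cone_measure. norm (f \<eta>) \<le> B"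
    using AE_cone_measure_norm by eventually_elim (rule assms)
qed (use assms in simp)

lemma integrable_cone_measure_inner_power:
  fixes v w :: "'a::euclidean_space"
  shows "integrable cone_measure (\<lambda>\<eta>. (v \<bullet> \<eta>) ^ i * (w \<bullet> \<eta>) ^ j)"
proof (rule integrable_cone_measure)
  fix \<eta> :: 'a assume "norm \<eta> = 1"
  then have "\<bar>v \<bullet> \<eta>\<bar> \<le> norm v" "\<bar>w \<bullet> \<eta>\<bar> \<le> norm w"
    using Cauchy_Schwarz_ineq2[of v \<eta>] Cauchy_Schwarz_ineq2[of w \<eta>] by auto
  then show "norm ((v \<bullet> \<eta>) ^ i * (w \<bullet> \<eta>) ^ j) \<le> norm v ^ i * norm w ^ j"
    by (auto simp: abs_mult power_abs intro!: mult_mono power_mono)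
qed simp

text \<open>Left unnormalized: the total mass cancels when moments are compared with the moment of
  order 0, so its value is never computed.\<close>

definition gauss :: "'a::euclidean_space \<Rightarrow> real" where
  "gauss x = exp (- ((norm x)\<^sup>2 / 2))"

lemma borel_measurable_gauss [measurable]: "gauss \<in> borel_measurable borel"
  unfolding gauss_def[abs_def] by measurable

text \<open>Completing the square. Together with translation invariance it evaluates the moment
  generating function.\<close>

lemma gauss_translate: "gauss (w + x) * exp ((w + x) \<bullet> w) = exp ((norm w)\<^sup>2 / 2) * gauss x"
proof -
  have "- ((norm (w + x))\<^sup>2 / 2) + (w + x) \<bullet> w = (norm w)\<^sup>2 / 2 + - ((norm x)\<^sup>2 / 2)"
    by (simp add: power2_norm_eq_inner inner_add_left inner_add_right inner_commute field_simps)
  then show ?thesis unfolding gauss_def exp_add[symmetric] by simp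
qed

text \<open>The polar formula with a = 2 and c = 1/2, for which the weight is trivial and u = |x|^2
  / 2. Hence |x|^k = (2u)^(k/2), and the radial integral is a Gamma value.\<close>

lemma has_bochner_integral_gauss_moment:
  fixes w :: "'a::euclidean_space"
  shows "has_bochner_integral lborel (\<lambda>x. (w \<bullet> x) ^ k * gauss x)
    (DIM('a) / 2 * 2 powr (real DIM('a) / 2) * 2 powr (k / 2) * Gamma ((real DIM('a) + k) / 2) *
     (\<integral>\<eta>. (w \<bullet> \<eta>) ^ k \<partial>cone_measure))"
proof -
  have l: "(real DIM('a) - 2) / 2 + real k / 2 > -1" "(real DIM('a) - 2) / 2 + k / 2 + 1 =
      (real DIM('a) + k) / 2"
    using DIM_positive[where 'a='a] by (auto simp: field_simps simp del: DIM_positive)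
  have "has_bochner_integral (power_measure ((real DIM('a) - 2) / 2)) (\<lambda>u. 2 powr (k / 2) *
      (u powr (k / 2) * exp (- u)))
    (2 powr (k / 2) * Gamma ((real DIM('a) + k) / 2))"
    using has_bochner_integral_power_measure_Gamma[OF l(1)] unfolding l(2)
    by (intro has_bochner_integral_mult_right)
  then have \<phi>: "integrable (power_measure ((real DIM('a) - 2) / 2)) (\<lambda>u. 2 powr (k / 2) *
      (u powr (k / 2) * exp (- u)))"
    "(\<integral>u. 2 powr (k / 2) * (u powr (k / 2) * exp (- u)) \<partial>power_measure ((real DIM('a) - 2) / 2)) =
      2 powr (k / 2) * Gamma ((real DIM('a) + k) / 2)"
    by (auto simp only: has_bochner_integral_iff)
  have "integrable cone_measure (\<lambda>\<eta>. (w \<bullet> \<eta>) ^ k)"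
    using integrable_cone_measure_inner_power[of w k 0 0] by simp
  from has_bochner_integral_polar[where a=2 and c="1/2", OF _ _ \<phi>(1) this]
  have "has_bochner_integral lborel
     (\<lambda>x. 2 powr (k / 2) * ((1 / 2 * norm x powr 2) powr (k / 2) *
         exp (- (1 / 2 * norm x powr 2))) *
           (w \<bullet> sgn x) ^ k * (1 / norm x powr (2 - 2)))
     (DIM('a) / 2 * (1 / 2) powr (- ((real DIM('a) - 2) / 2 + 1)) *
         (2 powr (k / 2) * Gamma ((real DIM('a) + k) / 2)) *
      (\<integral>\<eta>. (w \<bullet> \<eta>) ^ k \<partial>cone_measure))"
    unfolding \<phi>(2) by simp
  also have "(1 / 2 :: real) powr (- ((real DIM('a) - 2) / 2 + 1)) = 2 powr (real DIM('a) / 2)"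
    by (simp add: powr_divide powr_minus field_simps)
  also have "DIM('a) / 2 * 2 powr (real DIM('a) / 2) *
      (2 powr (k / 2) * Gamma ((real DIM('a) + k) / 2)) * (\<integral>\<eta>. (w \<bullet> \<eta>) ^ k \<partial>cone_measure) =
     DIM('a) / 2 * 2 powr (real DIM('a) / 2) * 2 powr (k / 2) * Gamma ((real DIM('a) + k) / 2) *
         (\<integral>\<eta>. (w \<bullet> \<eta>) ^ k \<partial>cone_measure)"
    by (simp only: mult.assoc)
  also have "has_bochner_integral lborel
     (\<lambda>x. 2 powr (k / 2) * ((1 / 2 * norm x powr 2) powr (k / 2) *
         exp (- (1 / 2 * norm x powr 2))) *
           (w \<bullet> sgn x) ^ k * (1 / norm x powr (2 - 2))) v \<longleftrightarrow>
     has_bochner_integral lborel (\<lambda>x. (w \<bullet> x) ^ k * gauss x) v" for v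
  proof (intro has_bochner_integral_cong_AE)
    show "AE x::'a in lborel. 2 powr (k / 2) * ((1 / 2 * norm x powr 2) powr (k / 2) *
        exp (- (1 / 2 * norm x powr 2))) *
           (w \<bullet> sgn x) ^ k * (1 / norm x powr (2 - 2)) = (w \<bullet> x) ^ k * gauss x"
      using AE_lborel_singleton[of "0::'a"]
    proof eventually_elim
      case (elim x)
      have "2 powr (k / 2) * (1 / 2 * norm x powr 2) powr (k / 2) = (norm x powr 2) powr (k / 2)"
        by (simp add: powr_mult[symmetric])
      also have "\<dots> = norm x ^ k"
        using elim by (simp only: powr_powr) (simp add: powr_realpow)
      finally have 1: "2 powr (k / 2) * (1 / 2 * norm x powr 2) powr (k / 2) = norm x ^ k" .
      have 2: "norm x ^ k * (w \<bullet> sgn x) ^ k = (w \<bullet> x) ^ k"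
        using elim by (simp add: power_mult_distrib[symmetric] sgn_div_norm flip: mult.assoc)
      have 3: "exp (- (1 / 2 * norm x powr 2)) = gauss x"
        by (simp add: gauss_def)
      have "2 powr (k / 2) * ((1 / 2 * norm x powr 2) powr (k / 2) *
          exp (- (1 / 2 * norm x powr 2))) *
           (w \<bullet> sgn x) ^ k * (1 / norm x powr (2 - 2)) =
         (2 powr (k / 2) * (1 / 2 * norm x powr 2) powr (k / 2)) * (w \<bullet> sgn x) ^ k *
             exp (- (1 / 2 * norm x powr 2))"
        using elim by simp
      then show ?case
        by (simp only: 1 2 3)
    qed
  qed auto
  finally show ?thesis .
qed

text \<open>Both sides are the moment generating function at tau * w: on the left expanded under the
  integral, on the right computed by translation. The bookkeeping variable tau separates the
  moments.\<close>

lemma gauss_moment_sums: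
  fixes w :: "'a::euclidean_space"
  shows "(\<lambda>k. (\<integral>x. (w \<bullet> x) ^ k * gauss x \<partial>lborel) / fact k * \<tau> ^ k) sums
    (exp (\<tau>\<^sup>2 * (norm w)\<^sup>2 / 2) * (\<integral>x. gauss (x::'a) \<partial>lborel))"
proof -
  have int0: "integrable lborel (gauss :: 'a \<Rightarrow> real)"
    using has_bochner_integral_gauss_moment[of "0::'a" 0] by (simp add: has_bochner_integral_iff)
  have mgf: "integrable lborel (\<lambda>x. exp (x \<bullet> v) * gauss x)"
    "(\<integral>x. exp (x \<bullet> v) * gauss x \<partial>lborel) = exp ((norm v)\<^sup>2 / 2) * (\<integral>x. gauss (x::'a) \<partial>lborel)"
        for v :: 'a
  proof -
    have "has_bochner_integral lborel (\<lambda>x::'a. exp ((norm v)\<^sup>2 / 2) * gauss x)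
        (exp ((norm v)\<^sup>2 / 2) * (\<integral>x. gauss (x::'a) \<partial>lborel))"
      using int0 by (simp add: has_bochner_integral_iff)
    then have "has_bochner_integral lborel (\<lambda>x. exp ((v + x) \<bullet> v) * gauss (v + x))
        (exp ((norm v)\<^sup>2 / 2) * (\<integral>x. gauss (x::'a) \<partial>lborel))"
      by (simp only: mult.commute[of "exp ((v + _) \<bullet> v)"] gauss_translate)
    then have "has_bochner_integral (distr lborel borel ((+) v)) (\<lambda>x. exp (x \<bullet> v) * gauss x)
        (exp ((norm v)\<^sup>2 / 2) * (\<integral>x. gauss (x::'a) \<partial>lborel))"
      by (intro has_bochner_integral_distr) auto
    then show "integrable lborel (\<lambda>x. exp (x \<bullet> v) * gauss x)"
      "(\<integral>x. exp (x \<bullet> v) * gauss x \<partial>lborel) = exp ((norm v)\<^sup>2 / 2) * (\<integral>x. gauss (x::'a) \<partial>lborel)"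
      by (simp_all add: lborel_distr_plus has_bochner_integral_iff)
  qed
  have int: "integrable lborel (\<lambda>x. (w \<bullet> x) ^ k * gauss x)" for k
    using has_bochner_integral_gauss_moment[of w k] by (simp add: has_bochner_integral_iff)
  define v where "v = \<tau> *\<^sub>R w"
  define s where "s n x = (\<Sum>k<n. (x \<bullet> v) ^ k / fact k * gauss x)" for n x
  have "(\<lambda>n. \<integral>x. s n x \<partial>lborel) \<longlonglongrightarrow> (\<integral>x. exp (x \<bullet> v) * gauss x \<partial>lborel)"
  proof (rule integral_dominated_convergence)
    \<comment> \<open>This sum dominates exp |x . v|, which bounds all partial sums of the
      exponential series, and its two summands are already known to be integrable.\<close>
    show "integrable lborel (\<lambda>x. exp (x \<bullet> v) * gauss x + exp (x \<bullet> (- v)) * gauss x)"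
      using mgf(1)[of v] mgf(1)[of "- v"] by (rule Bochner_Integration.integrable_add)
    have "(\<lambda>n. s n x) \<longlonglongrightarrow> exp (x \<bullet> v) * gauss x" for x
    proof -
      have "(\<lambda>k. (x \<bullet> v) ^ k / fact k) sums exp (x \<bullet> v)"
        using exp_converges[of "x \<bullet> v"] by (simp add: field_simps)
      then have "(\<lambda>k. (x \<bullet> v) ^ k / fact k * gauss x) sums (exp (x \<bullet> v) * gauss x)"
        by (rule sums_mult2)
      then show ?thesis by (simp add: sums_def s_def)
    qed
    then show "AE x in lborel. (\<lambda>n. s n x) \<longlonglongrightarrow> exp (x \<bullet> v) * gauss x" by simp
    show "AE x in lborel. norm (s n x) \<le> exp (x \<bullet> v) * gauss x + exp (x \<bullet> (- v)) * gauss x" for n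
    proof (rule AE_I2)
      fix x :: 'a
      have "norm (s n x) \<le> (\<Sum>k<n. \<bar>x \<bullet> v\<bar> ^ k / fact k * gauss x)"
        unfolding s_def by (rule sum_norm_le) (auto simp: abs_mult power_abs gauss_def)
      also have "\<dots> = (\<Sum>k<n. \<bar>x \<bullet> v\<bar> ^ k / fact k) * gauss x"
        by (simp add: sum_distrib_right)
      also have "(\<Sum>k<n. \<bar>x \<bullet> v\<bar> ^ k / fact k) \<le> exp \<bar>x \<bullet> v\<bar>"
      proof -
        have "(\<lambda>k. \<bar>x \<bullet> v\<bar> ^ k / fact k) sums exp \<bar>x \<bullet> v\<bar>"
          using exp_converges[of "\<bar>x \<bullet> v\<bar>"] by (simp add: field_simps)
        then have "summable (\<lambda>k. \<bar>x \<bullet> v\<bar> ^ k / fact k)" "exp \<bar>x \<bullet> v\<bar> = (\<Sum>k. \<bar>x \<bullet> v\<bar> ^ k / fact k)"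
          by (simp_all add: sums_iff)
        then show ?thesis
          by (auto intro!: sum_le_suminf)
      qed
      also have "exp \<bar>x \<bullet> v\<bar> \<le> exp (x \<bullet> v) + exp (x \<bullet> (- v))"
        by (cases "x \<bullet> v \<ge> 0") auto
      finally show "norm (s n x) \<le> exp (x \<bullet> v) * gauss x + exp (x \<bullet> (- v)) * gauss x"
        by (simp add: distrib_right mult_right_mono gauss_def)
    qed
  qed (auto simp: s_def)
  also have "(\<lambda>n. \<integral>x. s n x \<partial>lborel) = (\<lambda>n. \<Sum>k<n. (\<integral>x. (w \<bullet> x) ^ k * gauss x \<partial>lborel) / fact k *
      \<tau> ^ k)"
  proof
    fix n
    have "(\<integral>x. s n x \<partial>lborel) = (\<integral>x. (\<Sum>k<n. \<tau> ^ k / fact k * ((w \<bullet> x) ^ k * gauss x)) \<partial>lborel)"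
      by (simp add: s_def v_def power_mult_distrib inner_commute mult_ac)
    also have "\<dots> = (\<Sum>k<n. \<tau> ^ k / fact k * (\<integral>x. (w \<bullet> x) ^ k * gauss x \<partial>lborel))"
      using int by (subst Bochner_Integration.integral_sum) auto
    finally show "(\<integral>x. s n x \<partial>lborel) = (\<Sum>k<n. (\<integral>x. (w \<bullet> x) ^ k * gauss x \<partial>lborel) / fact k *
        \<tau> ^ k)"
      by (simp add: mult_ac)
  qed
  finally show ?thesis
    unfolding sums_def mgf(2) by (simp add: v_def power_mult_distrib)
qed

text \<open>Comparison of coefficients in tau; the generating function is even, so odd moments
  vanish.\<close>

lemma gauss_moment:
  fixes w :: "'a::euclidean_space"
  shows "(\<integral>x. (w \<bullet> x) ^ k * gauss x \<partial>lborel) =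
    (if even k then fact k / fact (k div 2) * ((norm w)\<^sup>2 / 2) ^ (k div 2) *
        (\<integral>x. gauss (x::'a) \<partial>lborel) else 0)"
proof -
  define E where "E = (\<integral>x. gauss (x::'a) \<partial>lborel)"
  define b where "b k = (if even k then ((norm w)\<^sup>2 / 2) ^ (k div 2) / fact (k div 2) * E else 0)"
      for k
  have "(\<lambda>k. b k * \<tau> ^ k) sums (exp (\<tau>\<^sup>2 * (norm w)\<^sup>2 / 2) * E)" for \<tau>
  proof -
    have "(\<lambda>n. (\<tau>\<^sup>2 * (norm w)\<^sup>2 / 2) ^ n / fact n * E) sums (exp (\<tau>\<^sup>2 * (norm w)\<^sup>2 / 2) * E)"
      using exp_converges[of "\<tau>\<^sup>2 * (norm w)\<^sup>2 / 2"] by (intro sums_mult2) (simp add: field_simps)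
    also have "(\<lambda>n. (\<tau>\<^sup>2 * (norm w)\<^sup>2 / 2) ^ n / fact n * E) = (\<lambda>n. b (2 * n) * \<tau> ^ (2 * n))"
      by (simp add: b_def fun_eq_iff power_mult_distrib power_divide power_mult[symmetric] mult_ac)
    finally show ?thesis
      by (subst (asm) sums_mono_reindex[of "(*) 2" "\<lambda>k. b k * \<tau> ^ k"])
         (auto simp: strict_mono_def b_def elim!: evenE)
  qed
  then have "(\<lambda>k. ((\<integral>x. (w \<bullet> x) ^ k * gauss x \<partial>lborel) / fact k - b k) * \<tau> ^ k) sums 0" for \<tau>
    using sums_diff[OF gauss_moment_sums[of w \<tau>], of "\<lambda>k. b k * \<tau> ^ k" "exp (\<tau>\<^sup>2 * (norm w)\<^sup>2 / 2)
        * E"]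
    by (simp only: left_diff_distrib E_def) simp
  then have "(\<integral>x. (w \<bullet> x) ^ k * gauss x \<partial>lborel) / fact k - b k = 0"
    by (rule powser_sums_0_imp_0)
  then show ?thesis
    by (simp add: b_def E_def field_simps split: if_splits)
qed

text \<open>Divide the Gaussian moment by its radial part. The case k = 0 expresses the total
  Gaussian mass by the volume of the ball, and the quotient of the two Gamma values is a Pochhammer
  symbol.\<close>

lemma cone_moment:
  fixes w :: "'a::euclidean_space"
  shows "(\<integral>\<eta>. (w \<bullet> \<eta>) ^ k \<partial>cone_measure) =
    (if even k then unit_ball_vol DIM('a) * fact k /
       (4 ^ (k div 2) * fact (k div 2) * pochhammer (DIM('a) / 2) (k div 2)) * norm w ^ k else 0)"
proof -
  define N where "N = real DIM('a)"
  have N: "N > 0" by (simp add: N_def)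
  define C where "C = N / 2 * 2 powr (N / 2)"
  have C: "C > 0" using N by (simp add: C_def)
  have G: "Gamma ((N + k) / 2) > 0" for k :: nat using N
      by (intro Gamma_real_pos) (simp add: add_pos_nonneg)
  have mom: "(\<integral>x. (v \<bullet> x) ^ k * gauss x \<partial>lborel) =
     C * 2 powr (k / 2) * Gamma ((N + k) / 2) * (\<integral>\<eta>. (v \<bullet> \<eta>) ^ k \<partial>cone_measure)" for v :: 'a and k
    using has_bochner_integral_gauss_moment[of v k]
        by (simp add: C_def N_def has_bochner_integral_iff)
  have E: "(\<integral>x. gauss (x::'a) \<partial>lborel) = C * Gamma (N / 2) * unit_ball_vol N"
    using mom[of 0 0] by (simp add: measure_cone_measure_UNIV N_def)
  show ?thesis
  proof (cases "even k")
    case False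
    then show ?thesis
      using mom[of w k] gauss_moment[of w k] C G[of k] by simp
  next
    case True
    then obtain n where k: "k = 2 * n" by (elim evenE)
    have p: "2 powr (k / 2) = (2::real) ^ n" by (simp add: k powr_realpow)
    have "N / 2 \<notin> \<int>\<^sub>\<le>\<^sub>0" using N by (auto elim!: nonpos_Ints_cases)
    then have "pochhammer (N / 2) n = Gamma (N / 2 + real n) / Gamma (N / 2)"
      by (rule pochhammer_Gamma)
    moreover have Nk: "(N + k) / 2 = N / 2 + real n"
      by (simp add: k add_divide_distrib)
    moreover have G0: "Gamma (N / 2) > 0" using G[of 0] by simp
    ultimately have g: "Gamma ((N + k) / 2) = pochhammer (N / 2) n * Gamma (N / 2)"
      unfolding Nk by simp
    have poch: "pochhammer (N / 2) n > 0" using N by (intro pochhammer_pos) simp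
    have "C * 2 ^ n * (pochhammer (N / 2) n * Gamma (N / 2)) * (\<integral>\<eta>. (w \<bullet> \<eta>) ^ k \<partial>cone_measure) =
       fact k / fact n * ((norm w)\<^sup>2 / 2) ^ n * (C * Gamma (N / 2) * unit_ball_vol N)"
      using mom[of w k] gauss_moment[of w k] unfolding p g E by (simp add: k)
    then have "(\<integral>\<eta>. (w \<bullet> \<eta>) ^ k \<partial>cone_measure) =
       (fact k / fact n * ((norm w)\<^sup>2 / 2) ^ n * (C * Gamma (N / 2) * unit_ball_vol N)) /
           (C * 2 ^ n * (pochhammer (N / 2) n * Gamma (N / 2)))"
      using C G0 poch by (subst nonzero_eq_divide_eq) (auto simp: mult_ac)
    also have "\<dots> = unit_ball_vol N * fact k / (4 ^ n * fact n * pochhammer (N / 2) n) * norm w ^ k"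
    proof -
      have "(4::real) ^ n = 2 ^ n * 2 ^ n" by (simp flip: power_mult_distrib)
      moreover have "((norm w)\<^sup>2 / 2) ^ n = norm w ^ k / 2 ^ n"
        by (simp add: k power_mult power_divide)
      ultimately show ?thesis
        using C G0 poch by (simp add: mult_ac)
    qed
    finally show ?thesis by (simp add: k N_def)
  qed
qed

text \<open>Polarization: apply \<open>cone_moment\<close> to u * omega + mu, whose squared norm is
  1 + 2cu + u^2, and compare coefficients of u^i. The factors 2 match the powers of 2t in the
  Gegenbauer polynomials and cancel the 4^n in the moment.\<close>

lemma cone_moment_mixed:
  fixes \<omega> \<mu> :: "'a::euclidean_space"
  assumes "norm \<omega> = 1" "norm \<mu> = 1" "i \<le> 2 * n"
  shows "(\<integral>\<eta>. (2 * (\<omega> \<bullet> \<eta>)) ^ i * (2 * (\<mu> \<bullet> \<eta>)) ^ (2 * n - i) \<partial>cone_measure) =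
    unit_ball_vol DIM('a) * fact i * fact (2 * n - i) / pochhammer (DIM('a) / 2) n *
    (\<Sum>q \<in> {q. q \<le> i div 2 \<and> i \<le> n + q}.
       (2 * (\<omega> \<bullet> \<mu>)) ^ (i - 2 * q) / (fact (i - 2 * q) * fact q * fact (n + q - i)))"
proof -
  define c where "c = \<omega> \<bullet> \<mu>"
  define M where "M i = (\<integral>\<eta>. (\<omega> \<bullet> \<eta>) ^ i * (\<mu> \<bullet> \<eta>) ^ (2 * n - i) \<partial>cone_measure)" for i
  define K where "K = unit_ball_vol DIM('a) * fact (2 * n) /
      (4 ^ n * fact n * pochhammer (DIM('a) / 2) n)"
  define d where "d i = (\<Sum>q \<in> {q. q \<le> i div 2 \<and> i \<le> n + q}.
     fact n / (fact (i - 2 * q) * fact q * fact (n + q - i)) * (2 * c) ^ (i - 2 * q))" for i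
  have "(\<Sum>i\<le>2 * n. (of_nat (2 * n choose i) * M i) * u ^ i) = (\<Sum>i\<le>2 * n. K * d i * u ^ i)" for u
  proof -
    have "(\<Sum>i\<le>2 * n. (of_nat (2 * n choose i) * M i) * u ^ i) =
       (\<integral>\<eta>. (\<Sum>i\<le>2 * n. of_nat (2 * n choose i) * u ^ i * ((\<omega> \<bullet> \<eta>) ^ i * (\<mu> \<bullet> \<eta>) ^ (2 * n - i)))
           \<partial>cone_measure)"
      by (subst Bochner_Integration.integral_sum)
         (auto simp: M_def mult.assoc mult.commute[of _ "u ^ _"] intro!: integrable_mult_right
             integrable_cone_measure_inner_power)
    also have "\<dots> = (\<integral>\<eta>. ((u *\<^sub>R \<omega> + \<mu>) \<bullet> \<eta>) ^ (2 * n) \<partial>cone_measure)"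
      by (simp only: inner_add_left inner_scaleR_left binomial_ring power_mult_distrib mult_ac)
    also have "\<dots> = K * norm (u *\<^sub>R \<omega> + \<mu>) ^ (2 * n)"
      by (simp add: cone_moment K_def)
    also have "norm (u *\<^sub>R \<omega> + \<mu>) ^ (2 * n) = (1 + 2 * c * u + u\<^sup>2) ^ n"
    proof -
      have "(norm (u *\<^sub>R \<omega> + \<mu>))\<^sup>2 = u\<^sup>2 * (norm \<omega>)\<^sup>2 + 2 * u * c + (norm \<mu>)\<^sup>2"
        by (simp only: power2_norm_eq_inner inner_add_left inner_add_right inner_scaleR_left
            inner_scaleR_right
            c_def inner_commute[of \<mu> \<omega>]) (simp add: power2_eq_square algebra_simps)
      then have "(norm (u *\<^sub>R \<omega> + \<mu>))\<^sup>2 = 1 + 2 * c * u + u\<^sup>2"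
        by (simp add: assms mult_ac)
      then show ?thesis
        by (simp only: power_mult)
    qed
    also have "\<dots> = (\<Sum>i\<le>2 * n. d i * u ^ i)"
      by (simp add: trinomial_expansion d_def)
    finally show ?thesis by (simp add: sum_distrib_left mult_ac)
  qed
  then have "of_nat (2 * n choose i) * M i = K * d i"
    using polyfun_eq_coeffs[where n = "2 * n" and c = "\<lambda>i. of_nat (2 * n choose i) * M i" and d =
        "\<lambda>i. K * d i"] assms(3) by blast
  moreover have "real (2 * n choose i) = fact (2 * n) / (fact i * fact (2 * n - i))"
    using assms(3) by (rule binomial_fact)
  ultimately have "fact (2 * n) / (fact i * fact (2 * n - i)) * M i = K * d i"
    by (simp only:)
  then have M: "M i = K * d i * (fact i * fact (2 * n - i)) / fact (2 * n)"
    by (simp add: field_simps)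
  have "(\<integral>\<eta>. (2 * (\<omega> \<bullet> \<eta>)) ^ i * (2 * (\<mu> \<bullet> \<eta>)) ^ (2 * n - i) \<partial>cone_measure) = 4 ^ n * M i"
  proof -
    have "(2::real) ^ i * 2 ^ (2 * n - i) = 4 ^ n"
      using assms(3) by (simp flip: power_add) (simp add: power_mult)
    then have "(2 * (\<omega> \<bullet> \<eta>)) ^ i * (2 * (\<mu> \<bullet> \<eta>)) ^ (2 * n - i) =
        4 ^ n * ((\<omega> \<bullet> \<eta>) ^ i * (\<mu> \<bullet> \<eta>) ^ (2 * n - i))" for \<eta>
      by (simp add: power_mult_distrib mult_ac)
    then show ?thesis by (simp only: M_def) simp
  qed
  also have "\<dots> = unit_ball_vol DIM('a) * fact i * fact (2 * n - i) / pochhammer (DIM('a) / 2) n *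
      (d i / fact n)"
    unfolding M K_def by (simp add: field_simps)
  also have "d i / fact n = (\<Sum>q \<in> {q. q \<le> i div 2 \<and> i \<le> n + q}.
       (2 * c) ^ (i - 2 * q) / (fact (i - 2 * q) * fact q * fact (n + q - i)))"
    by (simp add: d_def sum_divide_distrib)
  finally show ?thesis by (simp add: c_def)
qed

text \<open>The same polarization, starting from the vanishing of odd moments.\<close>

lemma cone_moment_mixed_odd:
  fixes \<omega> \<mu> :: "'a::euclidean_space"
  assumes "norm \<omega> = 1" "norm \<mu> = 1" "odd (i + j)"
  shows "(\<integral>\<eta>. (2 * (\<omega> \<bullet> \<eta>)) ^ i * (2 * (\<mu> \<bullet> \<eta>)) ^ j \<partial>cone_measure) = 0"
proof -
  define k where "k = i + j"
  define M where "M i = (\<integral>\<eta>. (\<omega> \<bullet> \<eta>) ^ i * (\<mu> \<bullet> \<eta>) ^ (k - i) \<partial>cone_measure)" for i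
  have "(\<Sum>i\<le>k. (of_nat (k choose i) * M i) * u ^ i) = (\<Sum>i\<le>k. 0 * u ^ i)" for u
  proof -
    have "(\<Sum>i\<le>k. (of_nat (k choose i) * M i) * u ^ i) =
       (\<integral>\<eta>. (\<Sum>i\<le>k. of_nat (k choose i) * u ^ i * ((\<omega> \<bullet> \<eta>) ^ i * (\<mu> \<bullet> \<eta>) ^ (k - i))) \<partial>cone_measure)"
      by (subst Bochner_Integration.integral_sum)
         (auto simp: M_def mult.assoc mult.commute[of _ "u ^ _"] intro!: integrable_mult_right
             integrable_cone_measure_inner_power)
    also have "\<dots> = (\<integral>\<eta>. ((u *\<^sub>R \<omega> + \<mu>) \<bullet> \<eta>) ^ k \<partial>cone_measure)"
      by (simp only: inner_add_left inner_scaleR_left binomial_ring power_mult_distrib mult_ac)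
    also have "\<dots> = 0"
      using assms(3) by (simp add: cone_moment k_def)
    finally show ?thesis by simp
  qed
  then have "of_nat (k choose i) * M i = 0"
    using polyfun_eq_coeffs[where n = k and c = "\<lambda>i. of_nat (k choose i) * M i" and d = "\<lambda>_. 0"]
        by (auto simp: k_def)
  then have "M i = 0" by (simp add: k_def)
  then show ?thesis
    by (simp add: M_def k_def power_mult_distrib mult.assoc mult.left_commute[of _ "2 ^ j"])
qed

text \<open>Insert the coefficients (index l) and the mixed moments (index q), and sum first over l
  with p = l + q fixed. The part depending on p alone factors out, and the rest is the alternating
  binomial sum \<open>S p\<close>. It vanishes for j < m; for j = m partial fractions turn it back
  into the p-th coefficient, now at omega . mu.\<close>

lemma cone_integral_gegenbauer_power:
  fixes \<omega> \<mu> :: "'a::euclidean_space"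
  defines "\<nu> \<equiv> (real DIM('a) - 2) / 2"
  assumes unit: "norm \<omega> = 1" "norm \<mu> = 1" and m: "m > 0" and j: "j \<le> m"
  shows "(\<integral>\<eta>. gegenbauer_norm \<nu> m (\<omega> \<bullet> \<eta>) * (2 * (\<mu> \<bullet> \<eta>)) ^ j \<partial>cone_measure) =
    (if j = m then unit_ball_vol DIM('a) * fact m / pochhammer (\<nu> + 1) m * gegenbauer_norm \<nu> m
        (\<omega> \<bullet> \<mu>) else 0)"
proof -
  define V where "V = unit_ball_vol DIM('a)"
  define c where "c = \<omega> \<bullet> \<mu>"
  have \<nu>: "\<nu> + 1 = DIM('a) / 2" "\<nu> + 1 > 0" by (auto simp: \<nu>_def field_simps)
  have DIM1: "real DIM('a) \<ge> 1"
    using DIM_positive[where 'a='a] by linarith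
  \<comment> \<open>Needed for the partial fractions below; it also holds in dimension 1, where nu =
    -1/2.\<close>
  have \<nu>m: "real m + \<nu> > real p" if "2 * p \<le> m" for p
  proof -
    have "p < m" using that m by simp
    then have "real p + 1 \<le> real m" by linarith
    moreover have "2 * \<nu> = real DIM('a) - 2" by (simp add: \<nu>_def)
    ultimately show ?thesis using DIM1 by linarith
  qed
  define I where "I i = (\<integral>\<eta>. (2 * (\<omega> \<bullet> \<eta>)) ^ i * (2 * (\<mu> \<bullet> \<eta>)) ^ j \<partial>cone_measure)" for i
  have int: "integrable cone_measure (\<lambda>\<eta>::'a. (2 * (\<omega> \<bullet> \<eta>)) ^ i * (2 * (\<mu> \<bullet> \<eta>)) ^ j)" for i
    using integrable_cone_measure_inner_power[of "2 *\<^sub>R \<omega>" i "2 *\<^sub>R \<mu>" j] by simp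
  have L: "(\<integral>\<eta>. gegenbauer_norm \<nu> m (\<omega> \<bullet> \<eta>) * (2 * (\<mu> \<bullet> \<eta>)) ^ j \<partial>cone_measure) =
      (\<Sum>l\<le>m div 2. gegenbauer_norm_coeff \<nu> m l * I (m - 2 * l))"
  proof -
    have "(\<integral>\<eta>. gegenbauer_norm \<nu> m (\<omega> \<bullet> \<eta>) * (2 * (\<mu> \<bullet> \<eta>)) ^ j \<partial>cone_measure) =
      (\<integral>\<eta>. (\<Sum>l\<le>m div 2. gegenbauer_norm_coeff \<nu> m l * ((2 * (\<omega> \<bullet> \<eta>)) ^ (m - 2 * l) *
          (2 * (\<mu> \<bullet> \<eta>)) ^ j)) \<partial>cone_measure)"
      by (simp only: gegenbauer_norm_explicit[OF m] sum_distrib_right mult.assoc)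
    also have "\<dots> = (\<Sum>l\<le>m div 2. gegenbauer_norm_coeff \<nu> m l * I (m - 2 * l))"
      unfolding I_def using int by (subst Bochner_Integration.integral_sum) auto
    finally show ?thesis .
  qed
  show ?thesis
  proof (cases "even (m + j)")
    case False
    have "I (m - 2 * l) = 0" if "l \<le> m div 2" for l
      unfolding I_def using unit False that by (intro cone_moment_mixed_odd) auto
    then show ?thesis using False unfolding L by (auto intro!: sum.neutral)
  next
    case True
    then obtain n where n: "m + j = 2 * n" by (elim evenE)
    define w where "w p = (2 * c) ^ (m - 2 * p) / (fact (m - 2 * p) * fact (n + p - m) * fact p)"
        for p
    define S where "S p = (\<Sum>l\<le>p. (-1) ^ l * of_nat (p choose l) *
        (pochhammer (\<nu> + 1) (m - l - 1) / pochhammer (\<nu> + 1) (n - l)))" for p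
    have term_eq: "gegenbauer_norm_coeff \<nu> m l * I (m - 2 * l) = 
       (\<Sum>p \<in> {p. l \<le> p \<and> p \<le> m div 2 \<and> m \<le> n + p}. V * fact j * (real m + \<nu>) *
           (w p * ((-1) ^ l * of_nat (p choose l) *
          (pochhammer (\<nu> + 1) (m - l - 1) / pochhammer (\<nu> + 1) (n - l)))))" if "l \<le> m div 2" for l
    proof -
      have l: "2 * l \<le> m" "l \<le> n" using that n j by auto
      have "2 * (n - l) - (m - 2 * l) = j" using l n by auto
      then have "I (m - 2 * l) = V * fact (m - 2 * l) * fact j / pochhammer (\<nu> + 1) (n - l) *
         (\<Sum>q \<in> {q. q \<le> (m - 2 * l) div 2 \<and> m - 2 * l \<le> (n - l) + q}.
           (2 * c) ^ ((m - 2 * l) - 2 * q) / (fact ((m - 2 * l) - 2 * q) * fact q *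
               fact ((n - l) + q - (m - 2 * l))))"
        using cone_moment_mixed[OF unit, of "m - 2 * l" "n - l"] l n unfolding I_def V_def c_def
            \<nu>(1) by simp
      also have "(\<Sum>q \<in> {q. q \<le> (m - 2 * l) div 2 \<and> m - 2 * l \<le> (n - l) + q}.
           (2 * c) ^ ((m - 2 * l) - 2 * q) / (fact ((m - 2 * l) - 2 * q) * fact q *
               fact ((n - l) + q - (m - 2 * l)))) =
         (\<Sum>p \<in> {p. l \<le> p \<and> p \<le> m div 2 \<and> m \<le> n + p}. w p * (fact l * of_nat (p choose l)))"
      proof (rule sum.reindex_bij_witness[of _ "\<lambda>p. p - l" "\<lambda>q. q + l"], goal_cases)
        case (5 q)
        have "m - 2 * l - 2 * q = m - 2 * (q + l)" "n - l + q - (m - 2 * l) = n + (q + l) - m"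
          using 5 l by auto
        moreover have "real ((q + l) choose l) = fact (q + l) / (fact l * fact q)"
          by (subst binomial_fact) auto
        ultimately show ?case by (simp add: w_def)
      qed (use l in auto)
      finally have I: "I (m - 2 * l) = V * fact (m - 2 * l) * fact j / pochhammer (\<nu> + 1) (n - l) *
         (\<Sum>p \<in> {p. l \<le> p \<and> p \<le> m div 2 \<and> m \<le> n + p}. w p * (fact l * of_nat (p choose l)))" .
      show ?thesis
        unfolding I sum_distrib_left gegenbauer_norm_coeff_def
        by (intro sum.cong refl) (simp add: mult_ac)
    qed
    have "(\<Sum>l\<le>m div 2. gegenbauer_norm_coeff \<nu> m l * I (m - 2 * l)) =
      (\<Sum>l\<le>m div 2. \<Sum>p \<in> {p \<in> {p. p \<le> m div 2 \<and> m \<le> n + p}. l \<le> p}. V * fact j * (real m + \<nu>) *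
          (w p * ((-1) ^ l * of_nat (p choose l) *
          (pochhammer (\<nu> + 1) (m - l - 1) / pochhammer (\<nu> + 1) (n - l)))))"
      by (intro sum.cong refl, subst term_eq) (auto intro!: sum.cong)
    also have "\<dots> = (\<Sum>p \<in> {p. p \<le> m div 2 \<and> m \<le> n + p}. \<Sum>l \<in> {l \<in> {..m div 2}. l \<le> p}. V * fact j *
        (real m + \<nu>) * (w p * ((-1) ^ l * of_nat (p choose l) *
          (pochhammer (\<nu> + 1) (m - l - 1) / pochhammer (\<nu> + 1) (n - l)))))"
      by (rule sum.swap_restrict) (auto intro: finite_subset[of _ "{..m div 2}"])
    also have "\<dots> = (\<Sum>p \<in> {p. p \<le> m div 2 \<and> m \<le> n + p}. V * fact j * (real m + \<nu>) * (w p * S p))"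
    proof (rule sum.cong[OF refl])
      fix p assume "p \<in> {p. p \<le> m div 2 \<and> m \<le> n + p}"
      then have "{l \<in> {..m div 2}. l \<le> p} = {..p}" by auto
      then show "(\<Sum>l \<in> {l \<in> {..m div 2}. l \<le> p}. V * fact j * (real m + \<nu>) *
          (w p * ((-1) ^ l * of_nat (p choose l) *
          (pochhammer (\<nu> + 1) (m - l - 1) / pochhammer (\<nu> + 1) (n - l))))) =
              V * fact j * (real m + \<nu>) * (w p * S p)"
        by (simp only: S_def sum_distrib_left)
    qed
    finally have L': "(\<Sum>l\<le>m div 2. gegenbauer_norm_coeff \<nu> m l * I (m - 2 * l)) =
       (\<Sum>p \<in> {p. p \<le> m div 2 \<and> m \<le> n + p}. V * fact j * (real m + \<nu>) * (w p * S p))" .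
    (* For n < m, S p is a p-th finite difference of a polynomial of degree m - 1 - n < p. *)
    show ?thesis
    proof (cases "j = m")
      case False
      then have nm': "n \<le> m - 1" using n j by simp
      have "S p = 0" if p: "p \<le> m div 2" "m \<le> n + p" for p
      proof -
        have "pochhammer (\<nu> + 1) (m - l - 1) / pochhammer (\<nu> + 1) (n - l) =
            pochhammer (\<nu> + 1 + real n - real l) (m - 1 - n)"
          if l: "l \<le> p" for l
        proof -
          have ln: "l \<le> n" "n - l \<le> m - l - 1" "m - l - 1 - (n - l) = m - 1 - n" using l p n nm' m
              by auto
          have "pochhammer (\<nu> + 1) (n - l) > 0" using \<nu> by (intro pochhammer_pos)
          then show ?thesis
            using pochhammer_product[OF ln(2), of "\<nu> + 1"] ln by (simp add: of_nat_diff add_diff_eq)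
        qed
        then have "S p = (\<Sum>l\<le>p. (-1) ^ l * of_nat (p choose l) * pochhammer (\<nu> + 1 + real n -
            real l) (m - 1 - n))"
          unfolding S_def by (intro sum.cong refl) simp
        also have "\<dots> = 0"
          using p nm' m by (intro alternating_binomial_sum_pochhammer) auto
        finally show ?thesis .
      qed
      then show ?thesis using False unfolding L L' by (auto intro!: sum.neutral)
    next
      case True
      then have nm': "n = m" using n by simp
      \<comment> \<open>With n = m the two Pochhammer symbols differ by one factor, so the quotient
        in \<open>S p\<close> is 1 / (m + nu - l).\<close>
      have wS: "V * fact j * (real m + \<nu>) * (w p * S p) =
         V * fact m / pochhammer (\<nu> + 1) m * (gegenbauer_norm_coeff \<nu> m p *
             (2 * c) ^ (m - 2 * p))" if p: "p \<le> m div 2" for p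
      proof -
        have "pochhammer (\<nu> + 1) (m - l - 1) / pochhammer (\<nu> + 1) (m - l) =
            inverse (real m + \<nu> - real l)" if l: "l \<le> p" for l
        proof -
          have "m - l = Suc (m - l - 1)" using l p m by auto
          then have "pochhammer (\<nu> + 1) (m - l) = pochhammer (\<nu> + 1) (m - l - 1) *
              (\<nu> + 1 + real (m - l - 1))"
            by (metis pochhammer_Suc)
          moreover have "\<nu> + 1 + real (m - l - 1) = real m + \<nu> - real l"
            using l p m by (auto simp: of_nat_diff)
          moreover have "pochhammer (\<nu> + 1) (m - l - 1) > 0" using \<nu> by (intro pochhammer_pos)
          ultimately show ?thesis by (simp add: inverse_eq_divide)
        qed
        then have "S p = (\<Sum>l\<le>p. (-1) ^ l * of_nat (p choose l) * inverse (real m + \<nu> - real l))"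
          unfolding S_def nm' by (intro sum.cong refl) simp
        also have "\<dots> = (-1) ^ p * fact p / pochhammer (real m + \<nu> - real p) (Suc p)"
          using \<nu>m[of p] p by (intro alternating_binomial_sum_inverse) auto
        also have "\<dots> = (-1) ^ p * fact p * pochhammer (\<nu> + 1) (m - p - 1) / pochhammer (\<nu> + 1) m"
        proof -
          have *: "m - p - 1 \<le> m" "m - (m - p - 1) = Suc p" "\<nu> + 1 + real (m - p - 1) =
              real m + \<nu> - real p"
            using p m by (auto simp: of_nat_diff)
          have "pochhammer (\<nu> + 1) (m - p - 1) > 0" using \<nu> by (intro pochhammer_pos)
          then show ?thesis
            using pochhammer_product[OF *(1), of "\<nu> + 1"] unfolding *(2,3) by simp
        qed
        finally have S: "S p = (-1) ^ p * fact p * pochhammer (\<nu> + 1) (m - p - 1) /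
            pochhammer (\<nu> + 1) m" .
        show ?thesis
          unfolding S w_def gegenbauer_norm_coeff_def nm' True by (simp add: field_simps)
      qed
      have "(\<Sum>p \<in> {p. p \<le> m div 2 \<and> m \<le> n + p}. V * fact j * (real m + \<nu>) * (w p * S p)) =
         (\<Sum>p\<le>m div 2. V * fact m / pochhammer (\<nu> + 1) m * (gegenbauer_norm_coeff \<nu> m p *
             (2 * c) ^ (m - 2 * p)))"
        by (rule sum.cong) (use wS nm' in auto)
      also have "\<dots> = V * fact m / pochhammer (\<nu> + 1) m * gegenbauer_norm \<nu> m c"
        by (simp only: gegenbauer_norm_explicit[OF m] sum_distrib_left)
      finally show ?thesis
        using True unfolding L L' by (simp add: V_def c_def)
    qed
  qed
qed

text \<open>By symmetry assume n <= m and expand the polynomial of degree n. Every power below m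
  integrates to 0, so only the leading term can survive, and only for n = m. Its coefficient
  \<open>pochhammer (\<nu> + 1) m / fact m\<close> cancels the constant of
  \<open>cone_integral_gegenbauer_power\<close>.\<close>

theorem cone_integral_gegenbauer:
  fixes \<omega> \<mu> :: "'a::euclidean_space"
  defines "\<nu> \<equiv> (real DIM('a) - 2) / 2"
  assumes unit: "norm \<omega> = 1" "norm \<mu> = 1"
  shows "(\<integral>\<eta>. gegenbauer_norm \<nu> m (\<omega> \<bullet> \<eta>) * gegenbauer_norm \<nu> n (\<mu> \<bullet> \<eta>) \<partial>cone_measure) =
    (if m = n then unit_ball_vol DIM('a) * gegenbauer_norm \<nu> m (\<omega> \<bullet> \<mu>) else 0)"
proof -
  have \<nu>: "\<nu> > -1" "\<nu> + 1 > 0" by (auto simp: \<nu>_def field_simps)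
  have le: "(\<integral>\<eta>. gegenbauer_norm \<nu> m (\<omega> \<bullet> \<eta>) * gegenbauer_norm \<nu> n (\<mu> \<bullet> \<eta>) \<partial>cone_measure) =
    (if m = n then unit_ball_vol DIM('a) * gegenbauer_norm \<nu> m (\<omega> \<bullet> \<mu>) else 0)"
    if unit: "norm \<omega> = 1" "norm \<mu> = 1" and mn: "n \<le> m" and m: "m > 0" for m n and \<omega> \<mu> :: 'a
  proof -
    \<comment> \<open>The explicit coefficient formula requires positive degree, and n = 0 may still
      meet m > 0.\<close>
    define d where "d l = (if n = 0 then 1 else gegenbauer_norm_coeff \<nu> n l)" for l
    have d: "gegenbauer_norm \<nu> n t = (\<Sum>l\<le>n div 2. d l * (2 * t) ^ (n - 2 * l))" for t
      by (cases "n = 0") (simp_all add: d_def gegenbauer_norm_0 gegenbauer_norm_explicit)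
    have int: "integrable cone_measure (\<lambda>\<eta>. gegenbauer_norm \<nu> m (\<omega> \<bullet> \<eta>) * (2 * (\<mu> \<bullet> \<eta>)) ^ j)" for j
    proof (rule integrable_cone_measure)
      fix \<eta> :: 'a assume "norm \<eta> = 1"
      then have *: "\<bar>\<omega> \<bullet> \<eta>\<bar> \<le> 1" "\<bar>\<mu> \<bullet> \<eta>\<bar> \<le> 1"
        using Cauchy_Schwarz_ineq2[of \<omega> \<eta>] Cauchy_Schwarz_ineq2[of \<mu> \<eta>] unit by auto
      then have "\<bar>2 * (\<mu> \<bullet> \<eta>)\<bar> \<le> 2" by simp
      then have "\<bar>2 * (\<mu> \<bullet> \<eta>)\<bar> ^ j \<le> 2 ^ j" by (intro power_mono) auto
      then show "norm (gegenbauer_norm \<nu> m (\<omega> \<bullet> \<eta>) * (2 * (\<mu> \<bullet> \<eta>)) ^ j) \<le>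
          (2 * (\<nu> + 2) * (4 * (\<nu> + 2)) ^ m) * 2 ^ j"
        using abs_gegenbauer_norm_le[OF \<nu>(1) *(1), of m] \<nu>
        by (simp only: real_norm_def abs_mult[of "gegenbauer_norm _ _ _"] power_abs)
            (intro mult_mono, auto)
    qed simp
    have "(\<integral>\<eta>. gegenbauer_norm \<nu> m (\<omega> \<bullet> \<eta>) * gegenbauer_norm \<nu> n (\<mu> \<bullet> \<eta>) \<partial>cone_measure) =
       (\<integral>\<eta>. (\<Sum>l\<le>n div 2. d l * (gegenbauer_norm \<nu> m (\<omega> \<bullet> \<eta>) * (2 * (\<mu> \<bullet> \<eta>)) ^ (n - 2 * l)))
           \<partial>cone_measure)"
      by (simp only: d[of "\<mu> \<bullet> _"] sum_distrib_left mult.left_commute)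
    also have "\<dots> = (\<Sum>l\<le>n div 2. d l * (\<integral>\<eta>. gegenbauer_norm \<nu> m (\<omega> \<bullet> \<eta>) * (2 * (\<mu> \<bullet> \<eta>)) ^
        (n - 2 * l) \<partial>cone_measure))"
      using int by (subst Bochner_Integration.integral_sum) auto
    also have "\<dots> = (\<Sum>l\<le>n div 2. if l = 0 then (if m = n then unit_ball_vol DIM('a) *
        gegenbauer_norm \<nu> m (\<omega> \<bullet> \<mu>) else 0) else 0)"
    proof (rule sum.cong[OF refl])
      fix l assume "l \<in> {..n div 2}"
      then have l: "n - 2 * l \<le> m" "n - 2 * l = m \<longleftrightarrow> l = 0 \<and> m = n" using mn m by auto
      have d0: "d 0 * fact m / pochhammer (\<nu> + 1) m = 1" if "m = n"
      proof -
        have "m = Suc (m - 1)" using m by simp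
        then have "pochhammer (\<nu> + 1) m = pochhammer (\<nu> + 1) (m - 1) * (\<nu> + 1 + real (m - 1))"
          by (metis pochhammer_Suc)
        also have "\<nu> + 1 + real (m - 1) = real m + \<nu>" using m by (simp add: of_nat_diff)
        finally have "pochhammer (\<nu> + 1) m = pochhammer (\<nu> + 1) (m - 1) * (real m + \<nu>)" .
        moreover have "pochhammer (\<nu> + 1) (m - 1) > 0" using \<nu> by (intro pochhammer_pos)
        moreover have "real m + \<nu> > 0" using \<nu>(1) m by linarith
        ultimately show ?thesis
          using that m by (simp add: d_def gegenbauer_norm_coeff_def mult.commute)
      qed
      show "d l * (\<integral>\<eta>. gegenbauer_norm \<nu> m (\<omega> \<bullet> \<eta>) * (2 * (\<mu> \<bullet> \<eta>)) ^ (n - 2 * l) \<partial>cone_measure) =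
         (if l = 0 then (if m = n then unit_ball_vol DIM('a) * gegenbauer_norm \<nu> m (\<omega> \<bullet> \<mu>) else 0)
             else 0)"
        unfolding \<nu>_def cone_integral_gegenbauer_power[OF unit m l(1)] l(2)
        using d0 by (auto simp: \<nu>_def[symmetric] field_simps)
    qed
    also have "\<dots> = (if m = n then unit_ball_vol DIM('a) * gegenbauer_norm \<nu> m (\<omega> \<bullet> \<mu>) else 0)"
      by (simp add: sum.delta)
    finally show ?thesis .
  qed
  consider "m = 0" "n = 0" | "n \<le> m" "m > 0" | "m \<le> n" "n > 0" by linarith
  then show ?thesis
  proof cases
    case 1
    then show ?thesis by (simp add: gegenbauer_norm_0 measure_cone_measure_UNIV)
  next
    case 2
    then show ?thesis using le[OF unit] by blast
  next
    case 3
    then show ?thesis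
      using le[OF unit(2,1) 3] by (simp only: mult.commute[of "gegenbauer_norm \<nu> m (\<omega> \<bullet> _)"]
          inner_commute[of \<mu> \<omega>]) auto
  qed
qed

subsection \<open>Bounds for Bessel functions\<close>

text \<open>Restrict the Gamma integral to [R, R + 1]. Since \<open>R\<close> is free, this shows
  that Gamma outgrows every geometric sequence, with explicit constants.\<close>

lemma powr_le_Gamma:
  assumes x: "x \<ge> 1" and R: "R > (0::real)"
  shows "R powr (x - 1) \<le> exp (R + 1) * Gamma x"
proof -
  have i: "(\<lambda>t. t powr (x - 1) / exp t) integrable_on {R..R + 1}"
    using R by (intro integrable_continuous_interval continuous_intros) auto
  have "((\<lambda>t. R powr (x - 1) / exp (R + 1)) has_integral (R + 1 - R) *\<^sub>R (R powr (x - 1) /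
      exp (R + 1))) {R..R + 1}"
    using R has_integral_const_real[of "R powr (x - 1) / exp (R + 1)" R "R + 1"] by simp
  then have "((\<lambda>t. R powr (x - 1) / exp (R + 1)) has_integral (R powr (x - 1) / exp (R + 1)))
      {R..R + 1}"
    by simp
  from this integrable_integral[OF i] have "R powr (x - 1) / exp (R + 1) \<le>
      integral {R..R + 1} (\<lambda>t. t powr (x - 1) / exp t)"
    by (rule has_integral_le) (use x R in \<open>auto intro!: frac_le powr_mono2\<close>)
  also have "\<dots> \<le> Gamma x"
    using x R by (intro has_integral_subset_le[OF _ integrable_integral[OF i]
        Gamma_integral_real]) auto
  finally show ?thesis by (simp add: field_simps)
qed

lemma rGamma_real_pos: "x > 0 \<Longrightarrow> rGamma (x::real) > 0"
  by (simp add: rGamma_inverse_Gamma)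

text \<open>\<open>powr_le_Gamma\<close> asks for an argument of at least 1. Applying it at x + 1
  and using the recurrence reaches every x > 0, at the cost of the factor x.\<close>

lemma rGamma_le_powr:
  assumes x: "x > 0" and R: "R > (0::real)"
  shows "rGamma x \<le> x * exp (R + 1) * R powr (- x)"
proof -
  have "R powr x \<le> exp (R + 1) * Gamma (x + 1)"
    using powr_le_Gamma[of "x + 1" R] x R by simp
  then have "rGamma (x + 1) \<le> exp (R + 1) * R powr (- x)"
    using x R by (simp add: rGamma_inverse_Gamma powr_minus field_simps)
  then have "x * rGamma (x + 1) \<le> x * (exp (R + 1) * R powr (- x))"
    using x by (intro mult_left_mono) auto
  then show ?thesis
    by (simp add: rGamma_plus1 mult_ac)
qed

text \<open>\<open>R\<close> stays free so that the decay in the order mu can be made as fast as the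
  sum over m requires. R >= |w| lets R^j absorb half of the powers of w; the linear factor mu + j +
  1 is at most (mu + 2) * 2^j, whence 2 * |w|.\<close>

lemma bessel_I_norm_term_le:
  fixes w :: complex
  assumes \<mu>: "\<mu> > -1" and R: "R \<ge> 1" "R \<ge> norm w"
  shows "norm ((w / 2) ^ (2 * j) / fact j * of_real (rGamma (\<mu> + real j + 1))) \<le>
    exp (R + 1) * R powr (- (\<mu> + 1)) * (\<mu> + 2) * ((2 * norm w) ^ j / fact j)"
proof -
  define x where "x = \<mu> + real j + 1"
  have x: "x > 0" using \<mu> by (simp add: x_def)
  have "norm ((w / 2) ^ (2 * j) / fact j * of_real (rGamma (\<mu> + real j + 1))) =
    (norm w / 2) ^ (2 * j) / fact j * rGamma x"
    using rGamma_real_pos[OF x] by (simp add: norm_mult norm_divide norm_power x_def)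
  also have "\<dots> \<le> (norm w / 2) ^ (2 * j) / fact j * (x * exp (R + 1) * R powr (- x))"
    using rGamma_le_powr[OF x, of R] R by (intro mult_left_mono) auto
  also have "\<dots> = exp (R + 1) * R powr (- (\<mu> + 1)) * (x * ((norm w / 2) ^ (2 * j) / R ^ j)) / fact j"
  proof -
    have "- x = - (\<mu> + 1) + - real j" by (simp add: x_def)
    then have "R powr (- x) = R powr (- (\<mu> + 1)) * R powr (- real j)"
      by (simp only: powr_add)
    also have "R powr (- real j) = 1 / R ^ j"
      using R by (simp add: powr_minus powr_realpow divide_inverse)
    finally show ?thesis by (simp add: mult_ac)
  qed
  also have "\<dots> \<le> exp (R + 1) * R powr (- (\<mu> + 1)) * ((\<mu> + 2) * (2 * norm w) ^ j) / fact j"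
  proof (intro divide_right_mono mult_left_mono)
    have 1: "x \<le> (\<mu> + 2) * 2 ^ j"
    proof -
      have "real (Suc j) \<le> real (2 ^ j)" using less_exp[of j]
          by (intro of_nat_mono) (simp add: Suc_le_eq)
      then have "(\<mu> + 2) * (1 + real j) \<le> (\<mu> + 2) * 2 ^ j"
        using \<mu> by (intro mult_left_mono) auto
      moreover have "0 \<le> (\<mu> + 1) * real j" using \<mu> by simp
      ultimately show ?thesis by (simp add: x_def algebra_simps)
    qed
    have 2: "(norm w / 2) ^ (2 * j) / R ^ j \<le> norm w ^ j"
    proof -
      have "(norm w / 2) ^ (2 * j) = (norm w * norm w / 4) ^ j"
        by (simp add: power_mult power2_eq_square)
      also have "\<dots> \<le> (norm w * R) ^ j"
      proof (rule power_mono)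
        have "norm w * norm w \<le> norm w * R" "0 \<le> norm w * R"
          using R by (auto intro: mult_left_mono)
        then show "norm w * norm w / 4 \<le> norm w * R" by linarith
      qed simp
      finally show ?thesis using R by (simp add: power_mult_distrib divide_le_eq)
    qed
    have "x * ((norm w / 2) ^ (2 * j) / R ^ j) \<le> ((\<mu> + 2) * 2 ^ j) * norm w ^ j"
      using 1 2 x \<mu> R by (intro mult_mono) auto
    then show "x * ((norm w / 2) ^ (2 * j) / R ^ j) \<le> (\<mu> + 2) * (2 * norm w) ^ j"
      by (simp add: power_mult_distrib mult_ac)
  qed auto
  finally show ?thesis by (simp add: mult_ac)
qed

lemma exp_sums: "(\<lambda>n. (x::real) ^ n / fact n) sums exp x"
  using exp_converges[of x] by (simp add: field_simps)

lemma summable_bessel_I_norm: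
  assumes "\<mu> > -1"
  shows "summable (\<lambda>j. norm ((w / 2) ^ (2 * j) / fact j * of_real (rGamma (\<mu> + real j + 1)) ::
      complex))"
proof (rule summable_comparison_test')
  show "summable (\<lambda>j. exp (1 + norm w + 1) * (1 + norm w) powr (- (\<mu> + 1)) * (\<mu> + 2) *
      ((2 * norm w) ^ j / fact j))"
    using exp_sums[of "2 * norm w"] by (intro summable_mult) (auto simp: sums_iff)
qed (use bessel_I_norm_term_le[OF assms, of "1 + norm w" w] in auto)

lemma norm_bessel_I_norm_le:
  assumes \<mu>: "\<mu> > -1" and R: "R \<ge> 1" "R \<ge> norm w"
  shows "norm (bessel_I_norm \<mu> w) \<le> exp (R + 1) * R powr (- (\<mu> + 1)) * (\<mu> + 2) * exp (2 * norm w)"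
proof -
  have "norm (bessel_I_norm \<mu> w) \<le> (\<Sum>j. exp (R + 1) * R powr (- (\<mu> + 1)) * (\<mu> + 2) *
      ((2 * norm w) ^ j / fact j))"
    unfolding bessel_I_norm_def
    by (rule norm_suminf_le[OF bessel_I_norm_term_le[OF \<mu> R]])
       (intro summable_mult sums_summable[OF exp_sums])
  also have "\<dots> = exp (R + 1) * R powr (- (\<mu> + 1)) * (\<mu> + 2) * exp (2 * norm w)"
    using exp_sums[of "2 * norm w"] by (subst suminf_mult) (auto simp: sums_iff)
  finally show ?thesis .
qed

lemma norm_cpow: "norm (cpow z s) = (if s = 0 then 1 else norm z powr s)"
  by (simp add: cpow_def norm_powr_real_powr')

text \<open>Take R proportional to 1 + |w|: then (|w|/2)^(bm) * R^(-bm) is at most H^(-bm),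
  uniformly in w, while exp(R + 1) only costs exponential growth in |w|. The bound without the
  polynomial serves the radial factors alone.\<close>

lemma script_I_term_le:
  assumes b: "b > 0" and \<nu>: "\<nu> > -1" "b * \<nu> + 1 > 0"
  obtains K where "K > 0"
    and "\<And>w m. norm (cpow (w / 2) (b * real m) * bessel_I_norm (b * (real m + \<nu>)) w) \<le>
        K * exp (K * norm w)"
    and "\<And>w t m. \<bar>t\<bar> \<le> 1 \<Longrightarrow> norm (cpow (w / 2) (b * real m) * bessel_I_norm (b * (real m + \<nu>)) w *
          of_real (gegenbauer_norm \<nu> m t)) \<le> K * exp (K * norm w) * (1 / 2) ^ m"
proof -
  define D where "D = 4 * (\<nu> + 2)"
  have D: "D > 4" using \<nu> by (simp add: D_def)
  \<comment> \<open>Chosen so that H^b = 4D. Of the resulting decay (4D)^(-m), a factor D^m pays for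
    the Gegenbauer polynomial and 2^m for the factor mu + 2, which leaves 2^(-m).\<close>
  define H where "H = (4 * D) powr (1 / b)"
  have H: "H \<ge> 1" unfolding H_def using D b by (intro ge_one_powr_ge_zero) auto
  define A where "A = b + (b * \<nu> + 2)"
  have A: "A > 0" using b \<nu> by (simp add: A_def)
  define K where "K = max (H + 2) (D * A * exp (H + 1))"
  have bound: "norm (cpow (w / 2) (b * real m) * bessel_I_norm (b * (real m + \<nu>)) w) \<le>
      K * exp (K * norm w) \<and>
      norm (cpow (w / 2) (b * real m) * bessel_I_norm (b * (real m + \<nu>)) w *
          of_real (gegenbauer_norm \<nu> m t))
      \<le> K * exp (K * norm w) * (1 / 2) ^ m" if t: "\<bar>t\<bar> \<le> 1" for w t m
  proof -
    define R where "R = H * (1 + norm w)"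
    have R: "R \<ge> 1" "R \<ge> norm w"
    proof -
      have "1 * (1 + norm w) \<le> R" unfolding R_def using H by (intro mult_right_mono) auto
      then have "1 + norm w \<le> R" by simp
      then show "R \<ge> 1" "R \<ge> norm w" by (smt (verit) norm_ge_zero)+
    qed
    define \<mu> where "\<mu> = b * (real m + \<nu>)"
    have \<mu>: "\<mu> > -1"
    proof -
      have "0 \<le> b * real m" using b by simp
      then show ?thesis using \<nu> by (simp only: \<mu>_def distrib_left)
    qed
    have P: "norm (cpow (w / 2) (b * real m)) * R powr (- (\<mu> + 1)) \<le> (1 / (4 * D)) ^ m"
    proof -
      have "R powr (- (\<mu> + 1)) = R powr (- (b * real m)) * R powr (- (b * \<nu> + 1))"
        unfolding powr_add[symmetric] by (simp add: \<mu>_def algebra_simps)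
      also have "\<dots> \<le> R powr (- (b * real m)) * 1"
      proof (rule mult_left_mono)
        have "R powr (- (b * \<nu> + 1)) \<le> R powr 0"
          using R \<nu> by (intro powr_mono) auto
        then show "R powr (- (b * \<nu> + 1)) \<le> 1" using R by simp
      qed simp
      finally have 1: "R powr (- (\<mu> + 1)) \<le> R powr (- (b * real m))" by simp
      have 2: "norm (cpow (w / 2) (b * real m)) \<le> (1 + norm w) powr (b * real m)"
      proof (cases "m = 0")
        case True
        have "1 + norm w > 0" by (rule add_pos_nonneg) auto
        then show ?thesis using True by (simp add: norm_cpow)
      next
        case False
        then show ?thesis
          using b by (simp add: norm_cpow norm_divide) (intro powr_mono2, auto)
      qed
      have "norm (cpow (w / 2) (b * real m)) * R powr (- (\<mu> + 1)) \<le> (1 + norm w) powr (b * real m)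
          * R powr (- (b * real m))"
        using 1 2 by (intro mult_mono) auto
      also have "\<dots> = ((1 + norm w) / R) powr (b * real m)"
        using R by (simp add: powr_minus_divide powr_divide)
      also have "(1 + norm w) / R = 1 / H"
      proof -
        have "1 + norm w > 0" using norm_ge_zero[of w] by linarith
        then show ?thesis using H by (simp add: R_def)
      qed
      also have "(1 / H) powr (b * real m) = (1 / (4 * D)) ^ m"
      proof -
        have "H powr (b * real m) = (4 * D) ^ m"
          unfolding H_def using b D by (simp add: powr_powr powr_realpow)
        then show ?thesis using H D by (simp add: powr_divide power_one_over)
      qed
      finally show ?thesis .
    qed
    have G: "norm (of_real (gegenbauer_norm \<nu> m t) :: complex) \<le> D * D ^ m"
    proof -
      have "\<bar>gegenbauer_norm \<nu> m t\<bar> \<le> 2 * (\<nu> + 2) * D ^ m"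
        unfolding D_def by (rule abs_gegenbauer_norm_le[OF \<nu>(1) t])
      also have "\<dots> \<le> D * D ^ m" using D by (intro mult_right_mono) (auto simp: D_def)
      finally show ?thesis by simp
    qed
    have M: "\<mu> + 2 \<le> A * 2 ^ m"
    proof -
      have "real (Suc m) \<le> real (2 ^ m)" using less_exp[of m]
          by (intro of_nat_mono) (simp add: Suc_le_eq)
      then have m2: "real (Suc m) \<le> 2 ^ m" by simp
      have "\<mu> + 2 \<le> A * real (Suc m)"
      proof -
        have "0 \<le> (b * \<nu> + 2) * real m" using \<nu> by simp
        then show ?thesis using b by (simp add: A_def \<mu>_def algebra_simps)
      qed
      also have "\<dots> \<le> A * 2 ^ m" using A m2 by (intro mult_left_mono) auto
      finally show ?thesis .
    qed
    have "norm (cpow (w / 2) (b * real m) * bessel_I_norm \<mu> w) \<le>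
       norm (cpow (w / 2) (b * real m)) * (exp (R + 1) * R powr (- (\<mu> + 1)) * (\<mu> + 2) *
           exp (2 * norm w))"
      unfolding norm_mult using norm_bessel_I_norm_le[OF \<mu> R] by (rule mult_left_mono) simp
    also have "\<dots> = (norm (cpow (w / 2) (b * real m)) * R powr (- (\<mu> + 1))) * (\<mu> + 2) *
        (exp (R + 1) * exp (2 * norm w))"
      by (simp only: mult_ac)
    also have "\<dots> \<le> (1 / (4 * D)) ^ m * (A * 2 ^ m) * (exp (R + 1) * exp (2 * norm w))"
      using P M D A \<mu> by (intro mult_mono mult_nonneg_nonneg) auto
    also have "\<dots> = A * (exp (R + 1) * exp (2 * norm w)) * ((1 / (4 * D)) * 2) ^ m"
      by (simp only: power_mult_distrib mult_ac)
    also have "exp (R + 1) * exp (2 * norm w) = exp (H + 1) * exp ((H + 2) * norm w)"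
      unfolding exp_add[symmetric] by (simp add: R_def algebra_simps)
    also have "1 / (4 * D) * 2 = 1 / (2 * D)" by simp
    finally have CB: "norm (cpow (w / 2) (b * real m) * bessel_I_norm \<mu> w) \<le>
      A * (exp (H + 1) * exp ((H + 2) * norm w)) * (1 / (2 * D)) ^ m" .
    have EK: "D * (A * (exp (H + 1) * exp ((H + 2) * norm w))) \<le> K * exp (K * norm w)"
    proof -
      have "(D * A * exp (H + 1)) * exp ((H + 2) * norm w) \<le> K * exp (K * norm w)"
        using H by (intro mult_mono) (auto simp: K_def intro!: mult_right_mono)
      then show ?thesis by (simp only: mult.assoc)
    qed
    have "norm (cpow (w / 2) (b * real m) * bessel_I_norm \<mu> w) \<le>
        A * (exp (H + 1) * exp ((H + 2) * norm w)) * 1"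
      using D A by (intro order_trans[OF CB] mult_left_mono power_le_one) auto
    also have "\<dots> \<le> D * (A * (exp (H + 1) * exp ((H + 2) * norm w)))"
      using D A mult_right_mono[of 1 D "A * (exp (H + 1) * exp ((H + 2) * norm w))"] by simp
    finally have 1: "norm (cpow (w / 2) (b * real m) * bessel_I_norm \<mu> w) \<le> K * exp (K * norm w)"
      using EK by linarith
    have "norm (cpow (w / 2) (b * real m) * bessel_I_norm \<mu> w * of_real (gegenbauer_norm \<nu> m t)) \<le>
       A * (exp (H + 1) * exp ((H + 2) * norm w)) * (1 / (2 * D)) ^ m * (D * D ^ m)"
      unfolding norm_mult[of _ "of_real (gegenbauer_norm \<nu> m t)"] using CB G D A
          by (intro mult_mono) auto
    also have "\<dots> = D * (A * (exp (H + 1) * exp ((H + 2) * norm w))) * (1 / (2 * D) * D) ^ m"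
      by (simp only: power_mult_distrib mult_ac)
    also have "1 / (2 * D) * D = 1 / 2" using D by simp
    also have "D * (A * (exp (H + 1) * exp ((H + 2) * norm w))) * (1 / 2) ^ m \<le>
        K * exp (K * norm w) * (1 / 2) ^ m"
      by (rule mult_right_mono[OF EK]) simp
    finally show ?thesis using 1 by (simp add: \<mu>_def)
  qed
  show thesis
    by (rule that[OF _ bound[THEN conjunct1, of 0] bound[THEN conjunct2]]) (use H in \<open>auto
        simp: K_def max_def\<close>)
qed

subsection \<open>Weber's second exponential integral\<close>

text \<open>
  \<open>bessel_J_norm l z\<close> is the normalized I-Bessel function at \<open>w\<close> with \<open>(w / 2)\<^sup>2 = - z\<close>; the
  variable \<open>z\<close> avoids the square root.
\<close>

definition bessel_J_term :: "real \<Rightarrow> real \<Rightarrow> nat \<Rightarrow> real" where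
  "bessel_J_term l z j = (- z) ^ j / fact j * rGamma (l + real j + 1)"

definition bessel_J_norm :: "real \<Rightarrow> real \<Rightarrow> real" where
  "bessel_J_norm l z = (\<Sum>j. bessel_J_term l z j)"

lemma bessel_I_norm_term_conv_J:
  fixes w :: complex
  assumes "(w / 2)\<^sup>2 = - of_real z"
  shows "(w / 2) ^ (2 * j) / fact j * of_real (rGamma (l + real j + 1)) =
      of_real (bessel_J_term l z j)"
  by (simp only: power_mult assms) (simp add: bessel_J_term_def)

lemma summable_bessel_J_term:
  assumes "l > -1"
  shows "summable (\<lambda>j. \<bar>bessel_J_term l z j\<bar>)"
proof -
  have w: "(2 * csqrt (- of_real z) / 2)\<^sup>2 = - of_real z"
    by simp
  show ?thesis
    using summable_bessel_I_norm[OF assms, of "2 * csqrt (- of_real z)"]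
    by (simp only: bessel_I_norm_term_conv_J[OF w] norm_of_real)
qed

lemma bessel_I_norm_conv_J:
  assumes "l > -1" "(w / 2)\<^sup>2 = - of_real z"
  shows "bessel_I_norm l w = of_real (bessel_J_norm l z)"
  unfolding bessel_I_norm_def bessel_J_norm_def bessel_I_norm_term_conv_J[OF assms(2)]
  using summable_rabs_cancel[OF summable_bessel_J_term[OF assms(1)]]
      by (intro suminf_of_real[symmetric])

text \<open>A bound on all partial sums at once, for dominated convergence in Weber's integral. Here
  |w| = 2 * sqrt u and R = 1 + |w|; the exponent 6 is 2 from exp(R + 1) plus 4 from the series in 2
  * |w|.\<close>

lemma sum_abs_bessel_J_le:
  assumes l: "l > -1" and u: "u \<ge> 0"
  shows "(\<Sum>j<n. \<bar>bessel_J_term l u j\<bar>) \<le> exp 2 * (l + 2) * exp (6 * sqrt u)"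
proof -
  define w where "w = \<i> * of_real (2 * sqrt u)"
  have w: "(w / 2)\<^sup>2 = - of_real u" "norm w = 2 * sqrt u"
    using u by (auto simp: w_def power_mult_distrib norm_mult simp flip: of_real_power)
  define R where "R = 1 + norm w"
  have R: "R \<ge> 1" "R \<ge> norm w" by (auto simp: R_def)
  have term_le: "\<bar>bessel_J_term l u j\<bar> \<le> exp 2 * (l + 2) * exp (2 * sqrt u) *
      ((4 * sqrt u) ^ j / fact j)" for j
  proof -
    have "\<bar>bessel_J_term l u j\<bar> = norm ((w / 2) ^ (2 * j) / fact j *
        of_real (rGamma (l + real j + 1)))"
      by (simp only: power_mult w) (simp add: bessel_J_term_def abs_mult norm_mult norm_divide
          norm_power power_abs)
    also have "\<dots> \<le> exp (R + 1) * R powr (- (l + 1)) * (l + 2) * ((2 * norm w) ^ j / fact j)"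
      by (rule bessel_I_norm_term_le[OF l R])
    also have "\<dots> \<le> exp (R + 1) * 1 * (l + 2) * ((2 * norm w) ^ j / fact j)"
    proof (intro mult_right_mono mult_left_mono)
      have "R powr (- (l + 1)) \<le> R powr 0" using R l by (intro powr_mono) auto
      then show "R powr (- (l + 1)) \<le> 1" using R by simp
    qed (use l in auto)
    also have "exp (R + 1) = exp 2 * exp (2 * sqrt u)"
      unfolding exp_add[symmetric] by (simp add: R_def w)
    finally show ?thesis by (simp add: w mult_ac)
  qed
  have "(\<Sum>j<n. \<bar>bessel_J_term l u j\<bar>) \<le> (\<Sum>j<n. exp 2 * (l + 2) * exp (2 * sqrt u) *
      ((4 * sqrt u) ^ j / fact j))"
    by (intro sum_mono term_le)
  also have "\<dots> \<le> exp 2 * (l + 2) * exp (2 * sqrt u) * exp (4 * sqrt u)"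
    unfolding sum_distrib_left[symmetric]
  proof (rule mult_left_mono)
    have "(\<Sum>j<n. (4 * sqrt u) ^ j / fact j) \<le> (\<Sum>j. (4 * sqrt u) ^ j / fact j)"
      using exp_sums[of "4 * sqrt u"] u by (intro sum_le_suminf) (auto simp: sums_iff)
    then show "(\<Sum>j<n. (4 * sqrt u) ^ j / fact j) \<le> exp (4 * sqrt u)"
      using exp_sums[of "4 * sqrt u"] by (simp add: sums_iff)
  qed (use l in auto)
  also have "\<dots> = exp 2 * (l + 2) * exp (6 * sqrt u)"
    by (simp add: mult.assoc flip: exp_add)
  finally show ?thesis .
qed

text \<open>Chu-Vandermonde for the binomial coefficient of l + j + k over k, split as j plus l + k.
  It decouples the Gamma value of the moment of order j + k: apart from i, only j - i and k - i
  remain.\<close>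

lemma rGamma_Vandermonde:
  assumes l: "l > (-1::real)"
  shows "rGamma (l + real j + 1) * rGamma (l + real k + 1) * Gamma (l + real (j + k) + 1) /
      (fact j * fact k) =
    (\<Sum>i\<le>min j k. rGamma (l + real i + 1) / (fact i * fact (j - i) * fact (k - i)))"
proof -
  have inv: "rGamma (l + real n + 1) * Gamma (l + real n + 1) = 1" for n
  proof -
    have "l + real n + 1 > 0" using l by linarith
    then have "Gamma (l + real n + 1) > 0" by (rule Gamma_real_pos)
    then show ?thesis by (simp add: rGamma_inverse_Gamma)
  qed
  have gb: "(l + real (n + m)) gchoose m = rGamma (l + real n + 1) * Gamma (l + real (n + m) +
      1) / fact m" for n m
  proof -
    have "(l + real (n + m)) gchoose m = pochhammer (l + real n + 1) m / fact m"
      by (simp add: gbinomial_pochhammer' add_ac)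
    moreover have "rGamma (l + real n + 1) = pochhammer (l + real n + 1) m *
        rGamma (l + real (n + m) + 1)"
      using pochhammer_rGamma[of "l + real n + 1" m] by (simp add: add_ac)
    ultimately show ?thesis
      using inv[of "n + m"] by simp
  qed
  have "rGamma (l + real j + 1) * rGamma (l + real k + 1) * Gamma (l + real (j + k) + 1) /
      (fact j * fact k) =
      rGamma (l + real k + 1) / fact j * ((l + real (j + k)) gchoose k)"
    by (simp only: gb) simp
  also have "(l + real (j + k)) gchoose k = (\<Sum>i\<le>k. (real j gchoose i) *
      ((l + real k) gchoose (k - i)))"
    using gbinomial_Vandermonde[of "real j" "l + real k" k] by (simp add: atMost_atLeast0 add_ac)
  also have "\<dots> = (\<Sum>i\<le>min j k. (real j gchoose i) * ((l + real k) gchoose (k - i)))"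
    by (rule sum.mono_neutral_right) (auto simp: binomial_gbinomial[symmetric] binomial_eq_0)
  also have "rGamma (l + real k + 1) / fact j * \<dots> =
      (\<Sum>i\<le>min j k. rGamma (l + real i + 1) / (fact i * fact (j - i) * fact (k - i)))"
    unfolding sum_distrib_left
  proof (rule sum.cong[OF refl])
    fix i assume "i \<in> {..min j k}"
    then have i: "i \<le> j" "i \<le> k" "i + (k - i) = k" by auto
    have "(l + real k) gchoose (k - i) = rGamma (l + real i + 1) * Gamma (l + real k + 1) /
        fact (k - i)"
      using gb[of i "k - i"] i by simp
    moreover have "real j gchoose i = fact j / (fact i * fact (j - i))"
      using i by (simp add: binomial_gbinomial[symmetric] binomial_fact)
    ultimately have "rGamma (l + real k + 1) / fact j *
        ((real j gchoose i) * ((l + real k) gchoose (k - i))) =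
      (rGamma (l + real k + 1) * Gamma (l + real k + 1)) * (rGamma (l + real i + 1) /
          (fact i * fact (j - i) * fact (k - i)))"
      by simp
    then show "rGamma (l + real k + 1) / fact j *
        ((real j gchoose i) * ((l + real k) gchoose (k - i))) =
      rGamma (l + real i + 1) / (fact i * fact (j - i) * fact (k - i))"
      by (simp only: inv mult_1)
  qed
  finally show ?thesis .
qed

text \<open>With j = p + i and k = q + i the square sum becomes a sum over i whose terms contain
  truncated series of exp(-X) and exp(-Y). The signs of (-X)^i and (-Y)^i cancel, hence the argument
  -(X * Y) of the limit.\<close>

lemma weber_double_sum_tendsto:
  assumes l: "l > (-1::real)" and XY: "X \<ge> 0" "Y \<ge> 0"
  shows "(\<lambda>n. \<Sum>j<n. \<Sum>k<n. (- X) ^ j * (- Y) ^ k * (rGamma (l + real j + 1) *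
      rGamma (l + real k + 1) * Gamma (l + real (j + k) + 1) / (fact j * fact k)))
    \<longlonglongrightarrow> exp (- X - Y) * bessel_J_norm l (- (X * Y))"
proof -
  define f where "f i = bessel_J_term l (- (X * Y)) i" for i
  define G where "G Z n = (\<Sum>p<n. (- Z) ^ p / fact p)" for Z :: real and n :: nat
  have f_eq: "f i = (X * Y) ^ i / fact i * rGamma (l + real i + 1)" for i
    by (simp add: f_def bessel_J_term_def)
  have sumf: "summable (\<lambda>i. \<bar>f i\<bar>)"
    unfolding f_def by (rule summable_bessel_J_term[OF l])
  have G_lim: "G Z \<longlonglongrightarrow> exp (- Z)" for Z
    using exp_sums[of "- Z"] by (simp add: sums_def G_def[abs_def])
  have G_le: "\<bar>G Z n\<bar> \<le> exp Z" if "Z \<ge> 0" for Z n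
  proof -
    have "\<bar>G Z n\<bar> \<le> (\<Sum>p<n. Z ^ p / fact p)"
      unfolding G_def using that by (intro order_trans[OF sum_abs] sum_mono) (simp add: power_abs)
    also have "\<dots> \<le> (\<Sum>p. Z ^ p / fact p)"
      using exp_sums[of Z] that by (intro sum_le_suminf) (auto simp: sums_iff)
    also have "\<dots> = exp Z" using exp_sums[of Z] by (simp add: sums_iff)
    finally show ?thesis .
  qed
  have eq: "(\<Sum>j<n. \<Sum>k<n. (- X) ^ j * (- Y) ^ k * (rGamma (l + real j + 1) *
      rGamma (l + real k + 1) * Gamma (l + real (j + k) + 1) / (fact j * fact k))) =
     (\<Sum>i. if i < n then f i * G X (n - i) * G Y (n - i) else 0)" for n
  proof -
    have "(\<Sum>j<n. \<Sum>k<n. (- X) ^ j * (- Y) ^ k * (rGamma (l + real j + 1) * rGamma (l + real k + 1)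
        * Gamma (l + real (j + k) + 1) / (fact j * fact k))) =
      (\<Sum>(j, k)\<in>{..<n} \<times> {..<n}. \<Sum>i\<le>min j k. (- X) ^ j * (- Y) ^ k * (rGamma (l + real i + 1) /
          (fact i * fact (j - i) * fact (k - i))))"
      by (simp only: rGamma_Vandermonde[OF l] sum.cartesian_product sum_distrib_left)
    also have "\<dots> = (\<Sum>x\<in>(SIGMA jk:{..<n} \<times> {..<n}. {..min (fst jk) (snd jk)}). (- X) ^ fst (fst x)
        * (- Y) ^ snd (fst x) *
        (rGamma (l + real (snd x) + 1) / (fact (snd x) * fact (fst (fst x) - snd x) *
            fact (snd (fst x) - snd x))))"
      by (simp only: case_prod_unfold, subst sum.Sigma, simp, simp, simp only: case_prod_unfold)
    also have "\<dots> = (\<Sum>x\<in>(SIGMA i:{..<n}. {..<n - i} \<times> {..<n - i}). f (fst x) *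
        ((- X) ^ fst (snd x) / fact (fst (snd x))) * ((- Y) ^ snd (snd x) / fact (snd (snd x))))"
    proof (rule sum.reindex_bij_witness[of _ "\<lambda>(i, p, q). ((p + i, q + i), i)" "\<lambda>((j, k), i).
        (i, j - i, k - i)"], goal_cases)
      case (5 x)
      then obtain j k i where x: "x = ((j, k), i)" "i \<le> j" "i \<le> k" by (cases x) auto
      define p q where "p = j - i" and "q = k - i"
      have jk: "j = p + i" "k = q + i" using x by (auto simp: p_def q_def)
      have XY_i: "(X * Y) ^ i = (- X) ^ i * (- Y) ^ i" by (simp flip: power_mult_distrib)
      have "(- X) ^ j * (- Y) ^ k = (X * Y) ^ i * (- X) ^ p * (- Y) ^ q"
        unfolding jk power_add XY_i by (simp only: mult_ac)
      then show ?case
        by (simp add: x f_eq flip: p_def q_def)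
    qed auto
    also have "\<dots> = (\<Sum>i<n. \<Sum>(p, q)\<in>{..<n - i} \<times> {..<n - i}. f i * ((- X) ^ p / fact p) *
        ((- Y) ^ q / fact q))"
      by (subst sum.Sigma) (auto simp: case_prod_unfold)
    also have "\<dots> = (\<Sum>i<n. f i * G X (n - i) * G Y (n - i))"
      unfolding G_def sum.cartesian_product[symmetric]
      by (simp add: sum_distrib_left sum_distrib_right mult_ac)
    also have "\<dots> = (\<Sum>i. if i < n then f i * G X (n - i) * G Y (n - i) else 0)"
      by (subst suminf_finite[of "{..<n}"]) auto
    finally show ?thesis .
  qed
  have "(\<lambda>n. \<Sum>i. if i < n then f i * G X (n - i) * G Y (n - i) else 0) \<longlonglongrightarrow>
      (\<Sum>i. f i * exp (- X) * exp (- Y))"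
  \<comment> \<open>The truncation orders n - i vary with i, but the truncated series are bounded by
    exp X and exp Y for all n, so Tannery's theorem applies with majorant |f i| * exp X * exp
    Y.\<close>
  proof (rule tannerys_theorem[THEN conjunct2, THEN conjunct2])
    show "(\<lambda>n. if i < n then f i * G X (n - i) * G Y (n - i) else 0) \<longlonglongrightarrow>
        f i * exp (- X) * exp (- Y)" for i
    proof (rule Lim_transform_eventually)
      have sub: "(\<lambda>n. G Z (n - i)) \<longlonglongrightarrow> exp (- Z)" for Z
        by (rule filterlim_compose[OF G_lim filterlim_minus_const_nat_at_top])
      show "(\<lambda>n. f i * G X (n - i) * G Y (n - i)) \<longlonglongrightarrow> f i * exp (- X) * exp (- Y)"
        by (intro tendsto_intros sub)
      show "\<forall>\<^sub>F n in sequentially. f i * G X (n - i) * G Y (n - i) =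
          (if i < n then f i * G X (n - i) * G Y (n - i) else 0)"
        using eventually_gt_at_top[of i] by eventually_elim simp
    qed
    show "\<forall>\<^sub>F (i, n) in sequentially \<times>\<^sub>F sequentially. norm (if i < n then f i * G X (n - i) *
        G Y (n - i) else 0) \<le> \<bar>f i\<bar> * (exp X * exp Y)"
    proof (intro always_eventually allI, clarify)
      fix i n
      have "\<bar>f i\<bar> * (\<bar>G X (n - i)\<bar> * \<bar>G Y (n - i)\<bar>) \<le> \<bar>f i\<bar> * (exp X * exp Y)"
        using XY G_le by (intro mult_left_mono mult_mono) auto
      then show "norm (if i < n then f i * G X (n - i) * G Y (n - i) else 0) \<le>
          \<bar>f i\<bar> * (exp X * exp Y)"
        by (simp add: abs_mult mult.assoc)
    qed
    show "summable (\<lambda>i. \<bar>f i\<bar> * (exp X * exp Y))"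
      using sumf by (rule summable_mult2)
  qed simp
  also have "(\<Sum>i. f i * exp (- X) * exp (- Y)) = exp (- X - Y) * bessel_J_norm l (- (X * Y))"
    using summable_rabs_cancel[OF sumf]
    by (simp only: mult.assoc suminf_mult2[symmetric] bessel_J_norm_def f_def[symmetric])
       (simp flip: exp_add)
  finally show ?thesis unfolding eq .
qed

theorem weber_integral:
  assumes l: "l > -1" and XY: "X \<ge> 0" "Y \<ge> 0"
  shows "(\<integral>u. bessel_J_norm l (X * u) * bessel_J_norm l (Y * u) * exp (- u) \<partial>power_measure l) =
    exp (- X - Y) * bessel_J_norm l (- (X * Y))"
proof -
  define S where "S n Z u = (\<Sum>j<n. bessel_J_term l (Z * u) j)" for n :: nat and Z u :: real
  have [measurable]: "(\<lambda>u. S n Z u) \<in> borel_measurable borel" for n Z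
    unfolding S_def bessel_J_term_def by measurable
  define B where "B Z u = exp 2 * (l + 2) * exp (6 * sqrt (Z * u))" for Z u :: real
  have S_lim: "(\<lambda>n. S n Z u) \<longlonglongrightarrow> bessel_J_norm l (Z * u)" if "Z * u \<ge> 0" for Z u
  proof -
    have "summable (\<lambda>j. \<bar>bessel_J_term l (Z * u) j\<bar>)"
      by (rule summable_bessel_J_term[OF l])
    then show ?thesis
      unfolding S_def bessel_J_norm_def by (rule summable_LIMSEQ[OF summable_rabs_cancel])
  qed
  have S_le: "\<bar>S n Z u\<bar> \<le> B Z u" if "Z * u \<ge> 0" for n Z u
    unfolding S_def B_def using sum_abs_bessel_J_le[OF l that, of n]
    by (rule order_trans[OF sum_abs])
  have [measurable]: "(\<lambda>u. bessel_J_norm l (Z * u)) \<in> borel_measurable borel" for Z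
    unfolding bessel_J_norm_def bessel_J_term_def by measurable
  have "(\<lambda>n. \<integral>u. S n X u * S n Y u * exp (- u) \<partial>power_measure l) \<longlonglongrightarrow>
     (\<integral>u. bessel_J_norm l (X * u) * bessel_J_norm l (Y * u) * exp (- u) \<partial>power_measure l)"
  proof (rule integral_dominated_convergence)
    have "integrable (power_measure l) (\<lambda>u. (exp 2 * (l + 2)) * (exp 2 * (l + 2)) *
        (exp ((6 * sqrt X + 6 * sqrt Y) * sqrt u) * exp (- u)))"
      by (intro integrable_mult_right integrable_power_measure_exp_sqrt l)
    also have "(\<lambda>u. (exp 2 * (l + 2)) * (exp 2 * (l + 2)) *
        (exp ((6 * sqrt X + 6 * sqrt Y) * sqrt u) * exp (- u))) = (\<lambda>u. B X u * B Y u * exp (- u))"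
    proof
      fix u
      have "exp ((6 * sqrt X + 6 * sqrt Y) * sqrt u) = exp (6 * sqrt (X * u)) *
          exp (6 * sqrt (Y * u))"
        by (simp add: real_sqrt_mult distrib_right flip: exp_add)
      then show "(exp 2 * (l + 2)) * (exp 2 * (l + 2)) * (exp ((6 * sqrt X + 6 * sqrt Y) * sqrt u)
          * exp (- u)) = B X u * B Y u * exp (- u)"
        by (simp only: B_def mult_ac)
    qed
    finally show "integrable (power_measure l) (\<lambda>u. B X u * B Y u * exp (- u))" .
    show "AE u in power_measure l. (\<lambda>n. S n X u * S n Y u * exp (- u)) \<longlonglongrightarrow> bessel_J_norm l (X * u) *
        bessel_J_norm l (Y * u) * exp (- u)"
      using AE_power_measure_pos[of l]
          by eventually_elim (use XY in \<open>auto intro!: tendsto_intros S_lim\<close>)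
    show "AE u in power_measure l. norm (S n X u * S n Y u * exp (- u)) \<le>
        B X u * B Y u * exp (- u)" for n
      using AE_power_measure_pos[of l]
    proof eventually_elim
      case (elim u)
      have "\<bar>S n X u\<bar> * \<bar>S n Y u\<bar> \<le> B X u * B Y u"
        using XY elim S_le by (intro mult_mono order_trans[OF abs_ge_zero S_le]) auto
      then show ?case by (simp add: abs_mult mult_right_mono)
    qed
  qed auto
  also have "(\<lambda>n. \<integral>u. S n X u * S n Y u * exp (- u) \<partial>power_measure l) =
     (\<lambda>n. \<Sum>j<n. \<Sum>k<n. (- X) ^ j * (- Y) ^ k * (rGamma (l + real j + 1) * rGamma (l + real k + 1) *
         Gamma (l + real (j + k) + 1) / (fact j * fact k)))"
  proof
    fix n
    define c where "c j k = (- X) ^ j * (- Y) ^ k * (rGamma (l + real j + 1) *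
        rGamma (l + real k + 1) / (fact j * fact k))" for j k
    have mom: "has_bochner_integral (power_measure l) (\<lambda>u. c j k *
        (u powr real (j + k) * exp (- u))) (c j k * Gamma (l + real (j + k) + 1))" for j k
    proof -
      have "l + real (j + k) > -1" using l by linarith
      from has_bochner_integral_power_measure_Gamma[OF this] show ?thesis
        by (intro has_bochner_integral_mult_right)
    qed
    have "has_bochner_integral (power_measure l) (\<lambda>u. \<Sum>j<n. \<Sum>k<n. c j k *
        (u powr real (j + k) * exp (- u))) (\<Sum>j<n. \<Sum>k<n. c j k * Gamma (l + real (j + k) + 1))"
      by (intro has_bochner_integral_sum mom)
    then have "(\<integral>u. (\<Sum>j<n. \<Sum>k<n. c j k * (u powr real (j + k) * exp (- u))) \<partial>power_measure l) =
        (\<Sum>j<n. \<Sum>k<n. c j k * Gamma (l + real (j + k) + 1))"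
      by (rule has_bochner_integral_integral_eq)
    moreover have "(\<integral>u. (\<Sum>j<n. \<Sum>k<n. c j k * (u powr real (j + k) * exp (- u))) \<partial>power_measure l)
        = (\<integral>u. S n X u * S n Y u * exp (- u) \<partial>power_measure l)"
    proof (rule integral_cong_AE)
      show "AE u in power_measure l. (\<Sum>j<n. \<Sum>k<n. c j k * (u powr real (j + k) * exp (- u))) =
          S n X u * S n Y u * exp (- u)"
        using AE_power_measure_pos[of l]
      proof eventually_elim
        case (elim u)
        have "S n X u * S n Y u * exp (- u) =
            (\<Sum>j<n. \<Sum>k<n. bessel_J_term l (X * u) j * bessel_J_term l (Y * u) k * exp (- u))"
        proof -
          have "S n X u * S n Y u = (\<Sum>j<n. \<Sum>k<n. bessel_J_term l (X * u) j * bessel_J_term l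
              (Y * u) k)"
            unfolding S_def by (rule sum_product)
          then show ?thesis by (simp only: sum_distrib_right)
        qed
        also have "\<dots> = (\<Sum>j<n. \<Sum>k<n. c j k * (u powr real (j + k) * exp (- u)))"
        proof (intro sum.cong refl)
          fix j k
          have neg: "- (Z * u) = (- Z) * u" for Z by simp
          show "bessel_J_term l (X * u) j * bessel_J_term l (Y * u) k * exp (- u) =
              c j k * (u powr real (j + k) * exp (- u))"
            unfolding bessel_J_term_def c_def neg power_mult_distrib powr_realpow[OF elim]
                power_add by simp
        qed
        finally show ?case by simp
      qed
    qed auto
    ultimately show "(\<integral>u. S n X u * S n Y u * exp (- u) \<partial>power_measure l) =
        (\<Sum>j<n. \<Sum>k<n. (- X) ^ j * (- Y) ^ k * (rGamma (l + real j + 1) * rGamma (l + real k + 1) *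
        Gamma (l + real (j + k) + 1) / (fact j * fact k)))"
      by (simp add: c_def mult_ac)
  qed
  finally show ?thesis
    by (rule LIMSEQ_unique[OF _ weber_double_sum_tendsto[OF l XY]])
qed

subsection \<open>The heat kernel\<close>

text \<open>Moves the power u^p, left by the two factors (w/2)^(bm), into the measure. Weber's
  integral then applies with index l + p, the order of the m-th Bessel function.\<close>

lemma integral_power_measure_add:
  fixes f :: "real \<Rightarrow> real"
  assumes [measurable]: "f \<in> borel_measurable borel"
  shows "(\<integral>u. u powr p * f u \<partial>power_measure l) = (\<integral>u. f u \<partial>power_measure (l + p))"
proof -
  have "(\<integral>u. u powr p * f u \<partial>power_measure l) =
      (\<integral>u. (indicator {0<..} u * u powr l) *\<^sub>R (u powr p * f u) \<partial>lborel)"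
    unfolding power_measure_def by (subst integral_density) auto
  also have "\<dots> = (\<integral>u. (indicator {0<..} u * u powr (l + p)) *\<^sub>R f u \<partial>lborel)"
    by (simp add: powr_add mult_ac)
  also have "\<dots> = (\<integral>u. f u \<partial>power_measure (l + p))"
    unfolding power_measure_def by (subst integral_density) auto
  finally show ?thesis .
qed

lemma borel_measurable_bessel_J_norm [measurable]: "bessel_J_norm l \<in> borel_measurable borel"
  unfolding bessel_J_norm_def[abs_def] bessel_J_term_def by measurable

text \<open>As in \<^const>\<open>cpow\<close>, the value at \<open>y = s = 0\<close> is 1.\<close>

definition rpow :: "real \<Rightarrow> real \<Rightarrow> real" where
  "rpow y s = (if s = 0 then 1 else y powr s)"

lemma rpow_mult: "y \<ge> 0 \<Longrightarrow> z \<ge> 0 \<Longrightarrow> rpow (y * z) s = rpow y s * rpow z s"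
  by (simp add: rpow_def powr_mult)

lemma cpow_of_real: "y \<ge> 0 \<Longrightarrow> cpow (of_real y) s = of_real (rpow y s)"
  by (simp add: cpow_def rpow_def powr_of_real)

text \<open>The principal logarithm of -i * y is ln y - i * pi/2. This splits off the phase of the
  kernel's argument 2 (rs)^(a/2) / (a i).\<close>

lemma cpow_minus_i_times:
  assumes "y \<ge> 0"
  shows "cpow (- (\<i> * of_real y)) s = of_real (rpow y s) * cis (- (pi * s / 2))"
proof (cases "s = 0 \<or> y = 0")
  case True
  then show ?thesis by (auto simp: cpow_def rpow_def)
next
  case False
  with assms have y: "y > 0" by simp
  have Ln: "Ln (- (\<i> * of_real y)) = of_real (ln y) - \<i> * of_real pi / 2"
    using Ln_times_of_real[OF y, of "- \<i>"] y by (simp add: mult.commute Ln_of_real)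
  have "cpow (- (\<i> * of_real y)) s = exp (of_real s * Ln (- (\<i> * of_real y)))"
    using False by (simp add: cpow_def powr_def)
  also have "\<dots> = exp (of_real (s * ln y) + \<i> * of_real (- (pi * s / 2)))"
    unfolding Ln by (simp add: algebra_simps)
  also have "\<dots> = of_real (rpow y s) * cis (- (pi * s / 2))"
    using False y by (simp only: exp_add cis_conv_exp exp_of_real) (simp add: rpow_def powr_def)
  finally show ?thesis .
qed

text \<open>The polar formula with c = 1/a and angular function 1.\<close>

lemma norm_const_eq:
  assumes a: "a > max 0 (2 - real CARD('n))"
  defines "l \<equiv> (real CARD('n) - 2) / a"
  shows "norm_const TYPE('n::finite) a =
    inverse (CARD('n) / a * (1 / a) powr (- (l + 1)) * Gamma (l + 1) * unit_ball_vol CARD('n))"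
proof -
  have a0: "a > 0" and l: "l > -1" using a by (auto simp: l_def field_simps)
  have g: "has_bochner_integral (power_measure l) (\<lambda>u. u powr 0 * exp (- u)) (Gamma (l + 0 + 1))"
    using l by (intro has_bochner_integral_power_measure_Gamma) simp
  have "has_bochner_integral (power_measure l) (\<lambda>u. exp (- u)) (Gamma (l + 1))"
  proof -
    have "has_bochner_integral (power_measure l) (\<lambda>u. u powr 0 * exp (- u)) (Gamma (l + 1)) \<longleftrightarrow>
       has_bochner_integral (power_measure l) (\<lambda>u. exp (- u)) (Gamma (l + 1))"
      by (rule has_bochner_integral_cong_AE) (use AE_power_measure_pos[of l] in \<open>auto elim!:
          eventually_mono\<close>)
    then show ?thesis using g by simp
  qed
  then have i: "integrable (power_measure l) (\<lambda>u. exp (- u))" "(\<integral>u. exp (- u) \<partial>power_measure l) =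
      Gamma (l + 1)"
    by (auto simp only: has_bochner_integral_iff)
  have one: "integrable (cone_measure :: (real ^ 'n) measure) (\<lambda>\<eta>. 1 :: real)"
    by (rule integrable_cone_measure[of _ 1]) auto
  have "has_bochner_integral lborel (\<lambda>x::real ^ 'n. exp (- (1 / a * norm x powr a)) * 1 *
      (1 / norm x powr (2 - a)))
     (CARD('n) / a * (1 / a) powr (- (l + 1)) * Gamma (l + 1) * unit_ball_vol CARD('n))"
    using has_bochner_integral_polar[where 'a = "real ^ 'n" and c = "1 / a" and a =
        a, OF a0 _ _ one, of "\<lambda>u. exp (- u)"] a0 i
    by (simp add: l_def measure_cone_measure_UNIV)
  then show ?thesis
    by (simp add: norm_const_def has_bochner_integral_iff)
qed

section \<open>Separated terms of the kernel series\<close>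

locale deformed_kernel =
  fixes a t :: real and N :: nat and b \<nu> l :: real
  assumes a: "a > max 0 (2 - real N)" and t: "t > 0" and N: "N \<ge> 1"
  defines "b \<equiv> 2 / a" and "\<nu> \<equiv> (real N - 2) / 2" and "l \<equiv> (real N - 2) / a"
begin

text \<open>Half the modulus of the kernel's argument at a point of norm rho with u = (t / a) * rho
  powr a, for which rho powr (a / 2) = sqrt (a * u / t).\<close>

definition radius :: "real \<Rightarrow> real \<Rightarrow> real" where
  "radius r u = r powr (a / 2) * sqrt (a * u / t) / a"

text \<open>The m-th series term without phase and polynomial. The argument of
  \<open>bessel_J_norm\<close> is the square of \<open>radius r u\<close>.\<close>

definition radial_part :: "real \<Rightarrow> nat \<Rightarrow> real \<Rightarrow> real" where
  "radial_part r m u = rpow (radius r u) (b * real m) * bessel_J_norm (b * (real m + \<nu>))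
      (r powr a / (a * t) * u)"

text \<open>The phases have modulus 1 and cancel in the product of one kernel with the conjugate of the other.\<close>

definition phase :: "nat \<Rightarrow> complex" where
  "phase m = cis (- (pi * (b * real m) / 2))"

lemma a_pos: "a > 0" and b_pos: "b > 0" and b\<nu>: "b * \<nu> = l" and l_gt: "l > -1" and \<nu>_gt: "\<nu> > -1"
  using a N by (auto simp: b_def \<nu>_def l_def field_simps)

lemma bessel_order: "b * (real m + \<nu>) = l + b * real m" "l + b * real m > -1"
proof -
  show "b * (real m + \<nu>) = l + b * real m"
    by (simp add: distrib_left b\<nu>)
  have "0 \<le> b * real m" using b_pos by simp
  then show "l + b * real m > -1" using l_gt by linarith
qed

lemma borel_measurable_radial_part [measurable]: "radial_part r m \<in> borel_measurable borel"
  unfolding radial_part_def[abs_def] radius_def rpow_def by measurable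

lemma radius_nonneg: "u \<ge> 0 \<Longrightarrow> radius r u \<ge> 0"
  using a_pos t by (simp add: radius_def)

lemma radius_mult:
  assumes "u \<ge> 0" "r \<ge> 0" "s \<ge> 0"
  shows "radius r u * radius s u = (r * s) powr (a / 2) / (a * t) * u"
proof -
  have "sqrt (a * u / t) * sqrt (a * u / t) = a * u / t"
    using assms a_pos t by simp
  moreover have "radius r u * radius s u = r powr (a / 2) * s powr (a / 2) *
      (sqrt (a * u / t) * sqrt (a * u / t)) / (a * a)"
    unfolding radius_def by (simp only: times_divide_times_eq mult_ac)
  ultimately have "radius r u * radius s u = r powr (a / 2) * s powr (a / 2) * (a * u / t) /
      (a * a)"
    by (simp only:)
  then show ?thesis
    using assms a_pos t by (simp add: powr_mult mult_ac)
qed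

text \<open>The factor \<open>g\<close> is kept arbitrary: a Gegenbauer value gives the full term,
  and 1 isolates the radial factor.\<close>

lemma series_term_eq:
  assumes u: "u \<ge> 0" and r: "r \<ge> 0"
  defines "w \<equiv> 2 * (- (\<i> * of_real (radius r u)))"
  shows "cpow (w / 2) (b * real m) * bessel_I_norm (b * (real m + \<nu>)) w * of_real g =
    of_real (radial_part r m u * g) * phase m"
proof -
  have w2: "w / 2 = - (\<i> * of_real (radius r u))" by (simp add: w_def)
  have "(w / 2)\<^sup>2 = - of_real (radius r u * radius r u)"
    unfolding w2 by (simp add: power_mult_distrib) (simp add: power2_eq_square)
  also have "radius r u * radius r u = r powr a / (a * t) * u"
    using radius_mult[OF u r r] r by (simp add: powr_mult flip: powr_add)
  finally have "bessel_I_norm (b * (real m + \<nu>)) w =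
      of_real (bessel_J_norm (b * (real m + \<nu>)) (r powr a / (a * t) * u))"
    using bessel_order[of m] by (intro bessel_I_norm_conv_J) auto
  then show ?thesis
    unfolding w2 cpow_minus_i_times[OF radius_nonneg[OF u]]
    by (simp add: radial_part_def phase_def mult_ac)
qed

lemma radial_part_bound:
  obtains K where "K > 0"
    and "\<And>u r m. u \<ge> 0 \<Longrightarrow> r \<ge> 0 \<Longrightarrow> \<bar>radial_part r m u\<bar> \<le> K * exp (K * radius r u)"
    and "\<And>u r \<tau> m. u \<ge> 0 \<Longrightarrow> r \<ge> 0 \<Longrightarrow> \<bar>\<tau>\<bar> \<le> 1 \<Longrightarrow>
       \<bar>radial_part r m u * gegenbauer_norm \<nu> m \<tau>\<bar> \<le> K * exp (K * radius r u) * (1 / 2) ^ m"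
proof -
  have b\<nu>': "b * \<nu> + 1 > 0" using b\<nu> l_gt by simp
  obtain K where K: "K > 0"
    "\<And>w m. norm (cpow (w / 2) (b * real m) * bessel_I_norm (b * (real m + \<nu>)) w) \<le>
        K * exp (K * norm w)"
    "\<And>w t m. \<bar>t\<bar> \<le> 1 \<Longrightarrow> norm (cpow (w / 2) (b * real m) * bessel_I_norm (b * (real m + \<nu>)) w *
          of_real (gegenbauer_norm \<nu> m t)) \<le> K * exp (K * norm w) * (1 / 2) ^ m"
    using script_I_term_le[OF b_pos \<nu>_gt b\<nu>'] by blast
  have w: "norm (2 * (- (\<i> * complex_of_real (radius r u)))) = 2 * radius r u" if "u \<ge> 0" for r u
    using radius_nonneg[OF that] by (simp add: norm_mult)
  \<comment> \<open>The argument of the series has modulus twice \<open>radius\<close>, hence the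
    doubled constant.\<close>
  have le: "K * exp (K * (2 * radius r u)) \<le> 2 * K * exp (2 * K * radius r u)" for r u
  proof -
    have "K * (2 * radius r u) = 2 * K * radius r u" by (simp only: mult_ac)
    moreover have "0 \<le> K * exp (2 * K * radius r u)" using K(1) by simp
    ultimately show ?thesis by (simp only: mult.assoc[of 2 K])
  qed
  show thesis
  proof (rule that[of "2 * K"])
    fix u r :: real and m :: nat
    assume u: "u \<ge> 0" "r \<ge> 0"
    show "\<bar>radial_part r m u\<bar> \<le> 2 * K * exp (2 * K * radius r u)"
    proof -
      have "norm (complex_of_real (radial_part r m u) * phase m) \<le> K * exp (K * (2 * radius r u))"
        using K(2)[of "2 * (- (\<i> * complex_of_real (radius r u)))" m] series_term_eq[OF u, of m 1]
        unfolding w[OF u(1)] by (simp only: of_real_1 mult_1_right)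
      then have "\<bar>radial_part r m u\<bar> \<le> K * exp (K * (2 * radius r u))"
        by (simp add: norm_mult phase_def)
      then show ?thesis using le by (rule order_trans)
    qed
    fix \<tau> :: real
    assume \<tau>: "\<bar>\<tau>\<bar> \<le> 1"
    have "\<bar>radial_part r m u * gegenbauer_norm \<nu> m \<tau>\<bar> \<le> K * exp (K * (2 * radius r u)) *
        (1 / 2) ^ m"
      using K(3)[OF \<tau>, of "2 * (- (\<i> * complex_of_real (radius r u)))" m]
      unfolding series_term_eq[OF u] w[OF u(1)] by (simp add: norm_mult phase_def abs_mult)
    also have "\<dots> \<le> 2 * K * exp (2 * K * radius r u) * (1 / 2) ^ m"
      by (rule mult_right_mono[OF le]) simp
    finally show "\<bar>radial_part r m u * gegenbauer_norm \<nu> m \<tau>\<bar> \<le> 2 * K * exp (2 * K * radius r u) *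
        (1 / 2) ^ m" .
  qed (use K(1) in simp)
qed

text \<open>The two powers multiply to (v * u)^p with v = w / 2. After u^p has gone into the
  measure, Weber's integral yields order l + p at -(X * Y) = -(v^2), an I-Bessel function at the
  real point w.\<close>

lemma integral_radial_part:
  assumes r: "r \<ge> 0" and s: "s \<ge> 0"
  defines "w \<equiv> complex_of_real (2 * (r * s) powr (a / 2) / (a * t))"
  shows "of_real (\<integral>u. radial_part r m u * radial_part s m u * exp (- u) \<partial>power_measure l) =
    of_real (exp (- (r powr a + s powr a) / (a * t))) * (cpow (w / 2) (b * real m) * bessel_I_norm
        (b * (real m + \<nu>)) w)"
proof -
  define p where "p = b * real m"
  define X where "X = r powr a / (a * t)"
  define Y where "Y = s powr a / (a * t)"
  define v where "v = (r * s) powr (a / 2) / (a * t)"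
  have v: "v \<ge> 0" "w / 2 = of_real v" using a_pos t by (auto simp: v_def w_def)
  have XY: "X \<ge> 0" "Y \<ge> 0" using a_pos t by (auto simp: X_def Y_def)
  have "(\<integral>u. radial_part r m u * radial_part s m u * exp (- u) \<partial>power_measure l) =
     (\<integral>u. rpow v p * (u powr p * (bessel_J_norm (l + p) (X * u) * bessel_J_norm (l + p) (Y * u) *
         exp (- u))) \<partial>power_measure l)"
  proof (rule integral_cong_AE)
    show "AE u in power_measure l. radial_part r m u * radial_part s m u * exp (- u) =
      rpow v p * (u powr p * (bessel_J_norm (l + p) (X * u) * bessel_J_norm (l + p) (Y * u) *
          exp (- u)))"
      using AE_power_measure_pos[of l]
    proof eventually_elim
      case (elim u)
      have "rpow (radius r u) p * rpow (radius s u) p = rpow (v * u) p"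
        using elim radius_nonneg[of u] radius_mult[OF _ r s, of u]
            by (simp add: v_def flip: rpow_mult)
      also have "\<dots> = rpow v p * u powr p"
        using elim v by (simp add: rpow_mult) (simp add: rpow_def)
      finally have "rpow (radius r u) p * rpow (radius s u) p = rpow v p * u powr p" .
      then have "(rpow (radius r u) p * rpow (radius s u) p) * (bessel_J_norm (l + p) (X * u) *
          bessel_J_norm (l + p) (Y * u) * exp (- u)) =
         (rpow v p * u powr p) * (bessel_J_norm (l + p) (X * u) * bessel_J_norm (l + p) (Y * u) *
             exp (- u))"
        by (simp only:)
      then show ?case
        unfolding radial_part_def bessel_order(1) p_def[symmetric] X_def[symmetric]
            Y_def[symmetric] by (simp only: mult_ac)
    qed
  qed auto
  also have "\<dots> = rpow v p * (\<integral>u. bessel_J_norm (l + p) (X * u) * bessel_J_norm (l + p) (Y * u) *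
      exp (- u) \<partial>power_measure (l + p))"
    by (simp only: integral_mult_right_zero) (subst integral_power_measure_add, auto)
  also have "\<dots> = rpow v p * (exp (- X - Y) * bessel_J_norm (l + p) (- (X * Y)))"
    using bessel_order(2)[of m] XY by (subst weber_integral) (auto simp: p_def)
  finally have I: "(\<integral>u. radial_part r m u * radial_part s m u * exp (- u) \<partial>power_measure l) =
     exp (- X - Y) * (rpow v p * bessel_J_norm (l + p) (- (X * Y)))"
    by (simp only: mult_ac)
  have half: "z powr a = z powr (a / 2) * z powr (a / 2)" for z
    by (simp flip: powr_add)
  have "X * Y = v * v"
    unfolding X_def Y_def v_def powr_mult half by simp
  then have "(w / 2)\<^sup>2 = - of_real (- (X * Y))"
    unfolding v(2) by (simp add: power2_eq_square)
  then have "bessel_I_norm (b * (real m + \<nu>)) w = of_real (bessel_J_norm (l + p) (- (X * Y)))"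
    using bessel_order[of m] by (subst bessel_I_norm_conv_J) (auto simp: p_def)
  moreover have "- X - Y = - (r powr a + s powr a) / (a * t)"
    by (simp add: X_def Y_def diff_divide_distrib)
  ultimately show ?thesis
    unfolding I v(2) cpow_of_real[OF v(1)] p_def[symmetric] by simp
qed

end

section \<open>Assembling the heat kernel\<close>

theorem theorem4p4:
  fixes a r s t :: real and \<omega> \<mu> :: "real ^ 'n"
  assumes "a > max 0 (2 - real CARD('n))"
    and "r \<ge> 0" and "s \<ge> 0"
    and "\<omega> \<in> sphere 0 1" and "\<mu> \<in> sphere 0 1"
    and "t > 0"
  shows "heat_kernel a (r *\<^sub>R \<omega>) (s *\<^sub>R \<mu>) t =
    of_real (t powr (- ((real CARD('n) - 2) / a + 1)) *
             exp (- (r powr a + s powr a) / (a * t))) *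
    script_I (2 / a) ((real CARD('n) - 2) / 2)
      (of_real (2 * (r * s) powr (a / 2) / (a * t))) (\<omega> \<bullet> \<mu>)"
proof -
  define b \<nu> l where "b = 2 / a" and "\<nu> = (real CARD('n) - 2) / 2" and "l = (real CARD('n) - 2) / a"
  interpret deformed_kernel a t "CARD('n)" b \<nu> l
    by unfold_locales (use assms in \<open>auto simp: b_def \<nu>_def l_def Suc_le_eq\<close>)
  define U where "U \<xi> = t / a * norm \<xi> powr a" for \<xi> :: "real ^ 'n"
  define wt where "wt \<xi> = 1 / norm \<xi> powr (2 - a)" for \<xi> :: "real ^ 'n"
  define C where "C = CARD('n) / a * (t / a) powr (- (l + 1))"
  define V where "V = unit_ball_vol CARD('n)"
  define G where "G = Gamma (l + 1)"
  define c where "c m \<theta> r u \<eta> = complex_of_real (radial_part r m u * gegenbauer_norm \<nu> m (\<theta> \<bullet> \<eta>))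
      * phase m"
    for m \<theta> r u and \<eta> :: "real ^ 'n"
  \<comment> \<open>Isolates the dependence on u: \<open>radius r u\<close> is
    \<open>q r * sqrt u\<close>, the form in which the dominating functions are integrable.\<close>
  define q where "q r = r powr (a / 2) * sqrt (a / t) / a" for r
  define W where "W = complex_of_real (2 * (r * s) powr (a / 2) / (a * t))"
  define T where "T m = cpow (W / 2) (b * real m) * bessel_I_norm (b * (real m + \<nu>)) W *
      of_real (gegenbauer_norm \<nu> m (\<omega> \<bullet> \<mu>))" for m
  define E where "E = exp (- (r powr a + s powr a) / (a * t))"
  have unit: "norm \<omega> = 1" "norm \<mu> = 1" using assms by auto
  have G: "G > 0" using l_gt by (simp add: G_def)
  have V: "V > 0" by (simp add: V_def)
  have U_nonneg: "U \<xi> \<ge> 0" for \<xi> using a_pos t by (simp add: U_def)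
  have [measurable]: "U \<in> borel_measurable borel" "wt \<in> borel_measurable borel"
    unfolding U_def[abs_def] wt_def[abs_def] by measurable
  have q: "radius r u = q r * sqrt u" for r u
    by (simp add: radius_def q_def real_sqrt_mult real_sqrt_divide)
  have inner_sgn: "\<bar>\<theta> \<bullet> sgn \<xi>\<bar> \<le> 1" if "norm \<theta> = 1" for \<theta> \<xi> :: "real ^ 'n"
    using Cauchy_Schwarz_ineq2[of \<theta> "sgn \<xi>"] that by (simp add: norm_sgn split: if_splits)
  obtain K where K: "K > 0"
    "\<And>u r m. u \<ge> 0 \<Longrightarrow> r \<ge> 0 \<Longrightarrow> \<bar>radial_part r m u\<bar> \<le> K * exp (K * radius r u)"
    "\<And>u r \<tau> m. u \<ge> 0 \<Longrightarrow> r \<ge> 0 \<Longrightarrow> \<bar>\<tau>\<bar> \<le> 1 \<Longrightarrow>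
       \<bar>radial_part r m u * gegenbauer_norm \<nu> m \<tau>\<bar> \<le> K * exp (K * radius r u) * (1 / 2) ^ m"
    using radial_part_bound by blast
  have c_le: "norm (c m \<theta> r (U \<xi>) (sgn \<xi>)) \<le> K * exp (K * (q r * sqrt (U \<xi>))) * (1 / 2) ^ m"
    if "norm \<theta> = 1" "r \<ge> 0" for m \<theta> r \<xi>
    using K(3)[OF U_nonneg that(2) inner_sgn[OF that(1)], of m \<xi> \<xi>]
    by (simp add: c_def norm_mult phase_def q abs_mult)
  have half: "summable (\<lambda>m. K' * (1 / 2) ^ m)" "(\<Sum>m. K' * (1 / 2) ^ m) = 2 * K'" for K' :: real
    using geometric_sums[of "1 / 2 :: real"]
        by (auto simp: sums_iff suminf_mult intro!: summable_mult)
  have c_summable: "summable (\<lambda>m. c m \<theta> r (U \<xi>) (sgn \<xi>))" if "norm \<theta> = 1" "r \<ge> 0" for \<theta> r \<xi>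
    by (rule summable_comparison_test'[OF half(1) c_le[OF that]])
  have sum_c_le: "norm (\<Sum>m<M. c m \<theta> r (U \<xi>) (sgn \<xi>)) \<le> 2 * (K * exp (K * (q r * sqrt (U \<xi>))))"
    if "norm \<theta> = 1" "r \<ge> 0" for M \<theta> r \<xi>
  proof -
    have "norm (\<Sum>m<M. c m \<theta> r (U \<xi>) (sgn \<xi>)) \<le>
        (\<Sum>m<M. K * exp (K * (q r * sqrt (U \<xi>))) * (1 / 2) ^ m)"
      by (rule sum_norm_le) (rule c_le[OF that])
    also have "\<dots> \<le> (\<Sum>m. K * exp (K * (q r * sqrt (U \<xi>))) * (1 / 2) ^ m)"
      by (rule sum_le_suminf[OF half(1)]) (use K(1) in auto)
    finally show ?thesis by (simp only: half(2))
  qed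
  have kernel: "kernel_B a (r *\<^sub>R \<theta>) \<xi> = of_real G * (\<Sum>m. c m \<theta> r (U \<xi>) (sgn \<xi>))"
    if \<theta>: "norm \<theta> = 1" and r: "r \<ge> 0" and \<xi>: "\<xi> \<noteq> 0" for \<theta> \<xi> r
  proof -
    have w: "complex_of_real (2 * (r * norm \<xi>) powr (a / 2)) / (of_real a * \<i>) =
        2 * (- (\<i> * of_real (radius r (U \<xi>))))"
    proof -
      have "sqrt (a * U \<xi> / t) = norm \<xi> powr (a / 2)"
        using a_pos t by (simp add: U_def powr_half_sqrt[symmetric] powr_powr)
      then have R: "radius r (U \<xi>) = (r * norm \<xi>) powr (a / 2) / a"
        by (simp add: radius_def powr_mult)
      show ?thesis unfolding R using a_pos by (simp add: field_simps)
    qed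
    have "kernel_B a (r *\<^sub>R \<theta>) \<xi> = kernel_B a (r *\<^sub>R \<theta>) (norm \<xi> *\<^sub>R sgn \<xi>)"
      using \<xi> by (simp add: sgn_div_norm)
    also have "\<dots> = script_I b \<nu> (2 * (- (\<i> * of_real (radius r (U \<xi>))))) (\<theta> \<bullet> sgn \<xi>)"
      using kernel_B_polar[OF a_pos r norm_ge_zero[of \<xi>], of \<theta> "sgn \<xi>"] \<theta> \<xi>
      unfolding w b_def \<nu>_def by (simp add: norm_sgn)
    also have "\<dots> = of_real G * (\<Sum>m. c m \<theta> r (U \<xi>) (sgn \<xi>))"
      unfolding script_I_def series_term_eq[OF U_nonneg r] c_def G_def b\<nu> ..
    finally show ?thesis .
  qed
  define F where "F \<xi> = cnj (\<Sum>m. c m \<omega> r (U \<xi>) (sgn \<xi>)) * (\<Sum>m. c m \<mu> s (U \<xi>) (sgn \<xi>)) *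
      of_real (exp (- U \<xi>) * wt \<xi>)" for \<xi>
  define P where "P M \<xi> = cnj (\<Sum>m<M. c m \<omega> r (U \<xi>) (sgn \<xi>)) * (\<Sum>m<M. c m \<mu> s (U \<xi>) (sgn \<xi>)) *
      of_real (exp (- U \<xi>) * wt \<xi>)" for M \<xi>
  have heat: "heat_kernel a (r *\<^sub>R \<omega>) (s *\<^sub>R \<mu>) t = of_real (norm_const TYPE('n) a * G\<^sup>2) *
      (\<integral>\<xi>. F \<xi> \<partial>lborel)"
  proof -
    have "cnj (kernel_B a (r *\<^sub>R \<omega>) \<xi>) * kernel_B a (s *\<^sub>R \<mu>) \<xi> *
          of_real (exp (- (t / a) * norm \<xi> powr a) / norm \<xi> powr (2 - a)) = of_real (G\<^sup>2) * F \<xi>"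
              for \<xi>
    proof (cases "\<xi> = 0")
      \<comment> \<open>At the origin \<open>wt\<close> is 0, because
        \<open>0 powr (2 - a) = 0\<close> and division by 0 gives 0. So it does not matter that
        \<open>sgn 0\<close> is not a unit vector.\<close>
      case True
      then show ?thesis by (simp add: F_def wt_def)
    next
      case False
      then show ?thesis
        unfolding kernel[OF unit(1) assms(2) False] kernel[OF unit(2) assms(3) False] F_def
        by (simp add: U_def wt_def power2_eq_square mult_ac)
    qed
    then show ?thesis by (simp add: heat_kernel_def)
  qed
  have cc_meas [measurable]: "(\<lambda>\<xi>. c m \<theta> r (U \<xi>) (sgn \<xi>)) \<in> borel_measurable borel" for m \<theta> r
    unfolding c_def by measurable
  have lim: "(\<lambda>M. \<integral>\<xi>. P M \<xi> \<partial>lborel) \<longlonglongrightarrow> (\<integral>\<xi>. F \<xi> \<partial>lborel)"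
  proof (rule integral_dominated_convergence)
    \<comment> \<open>Each partial sum is dominated by a geometric series of ratio 1/2, which
      doubles \<open>K\<close> for either kernel.\<close>
    define Q where "Q \<xi> = (2 * K) * (2 * K) * (exp (K * (q r + q s) * sqrt (U \<xi>)) * exp (- U \<xi>)) *
        1 * wt \<xi>" for \<xi>
    have one: "integrable (cone_measure :: (real ^ 'n) measure) (\<lambda>\<eta>. 1 :: real)"
      by (rule integrable_cone_measure[of _ 1]) auto
    have "integrable (power_measure l) (\<lambda>u. (2 * K) * (2 * K) * (exp (K * (q r + q s) * sqrt u) *
        exp (- u)))"
      by (intro integrable_mult_right integrable_power_measure_exp_sqrt l_gt)
    from has_bochner_integral_polar[where 'a = "real ^ 'n" and c = "t / a", OF a_pos _ _ one,
        of "\<lambda>u. (2 * K) * (2 * K) * (exp (K * (q r + q s) * sqrt u) * exp (- u))"] this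
    show "integrable lborel Q"
      using a_pos t by (simp add: has_bochner_integral_iff Q_def[abs_def] U_def wt_def l_def)
    show "AE \<xi> in lborel. norm (P M \<xi>) \<le> Q \<xi>" for M
    proof (rule AE_I2)
      fix \<xi> :: "real ^ 'n"
      have "norm (P M \<xi>) = norm (\<Sum>m<M. c m \<omega> r (U \<xi>) (sgn \<xi>)) * norm (\<Sum>m<M. c m \<mu> s (U \<xi>) (sgn \<xi>))
          * (exp (- U \<xi>) * wt \<xi>)"
        unfolding P_def norm_mult complex_mod_cnj norm_of_real by (simp add: wt_def abs_mult)
      also have "\<dots> \<le> (2 * (K * exp (K * (q r * sqrt (U \<xi>))))) *
          (2 * (K * exp (K * (q s * sqrt (U \<xi>))))) * (exp (- U \<xi>) * wt \<xi>)"
        using sum_c_le[OF unit(1) assms(2)] sum_c_le[OF unit(2) assms(3)] K(1)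
        by (intro mult_mono) (auto simp: wt_def)
      also have "\<dots> = (2 * K) * (2 * K) * (exp (K * (q r * sqrt (U \<xi>))) *
          exp (K * (q s * sqrt (U \<xi>)))) * (exp (- U \<xi>) * wt \<xi>)"
        by (simp only: mult_ac)
      also have "exp (K * (q r * sqrt (U \<xi>))) * exp (K * (q s * sqrt (U \<xi>))) =
          exp (K * (q r + q s) * sqrt (U \<xi>))"
        unfolding exp_add[symmetric] by (simp add: algebra_simps)
      finally show "norm (P M \<xi>) \<le> Q \<xi>"
        by (simp add: Q_def mult_ac)
    qed
    show "AE \<xi> in lborel. (\<lambda>M. P M \<xi>) \<longlonglongrightarrow> F \<xi>"
      unfolding P_def F_def
      by (intro AE_I2 tendsto_intros tendsto_cnj summable_LIMSEQ c_summable unit assms)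
  next
    have [measurable]: "cnj \<in> borel_measurable borel"
      by (intro borel_measurable_continuous_onI continuous_on_cnj continuous_on_id)
    show "F \<in> borel_measurable lborel" "P M \<in> borel_measurable lborel" for M
      unfolding P_def[abs_def] F_def[abs_def] by measurable
  qed
  have part: "(\<integral>\<xi>. P M \<xi> \<partial>lborel) = of_real (C * V * E) * (\<Sum>m<M. T m)" for M
  proof -
    \<comment> \<open>A single product of terms separates into a radial factor, an angular factor
      and constant phases. The angular integral removes m \<noteq> n; for m = n the phases multiply
      to 1 and Weber's integral gives the m-th term on the right.\<close>
    have pair: "has_bochner_integral lborel
       (\<lambda>\<xi>. cnj (c m \<omega> r (U \<xi>) (sgn \<xi>)) * c n \<mu> s (U \<xi>) (sgn \<xi>) * of_real (exp (- U \<xi>) * wt \<xi>))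
       (if m = n then of_real (C * V * E) * T m else 0)" for m n
    proof -
      define \<phi> where "\<phi> u = radial_part r m u * radial_part s n u * exp (- u)" for u
      define \<psi> where "\<psi> \<eta> = gegenbauer_norm \<nu> m (\<omega> \<bullet> \<eta>) * gegenbauer_norm \<nu> n (\<mu> \<bullet> \<eta>)" for \<eta>
      have \<phi>: "integrable (power_measure l) \<phi>"
      proof (rule Bochner_Integration.integrable_bound)
        show "integrable (power_measure l) (\<lambda>u. K * K * (exp (K * (q r + q s) * sqrt u) *
            exp (- u)))"
          by (intro integrable_mult_right integrable_power_measure_exp_sqrt l_gt)
        show "AE u in power_measure l. norm (\<phi> u) \<le>
            norm (K * K * (exp (K * (q r + q s) * sqrt u) * exp (- u)))"
          using AE_power_measure_pos[of l]
        proof eventually_elim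
          case (elim u)
          have "\<bar>radial_part r m u\<bar> * \<bar>radial_part s n u\<bar> \<le> (K * exp (K * radius r u)) *
              (K * exp (K * radius s u))"
            using K elim assms by (intro mult_mono) auto
          also have "\<dots> = K * K * (exp (K * radius r u) * exp (K * radius s u))"
            by (simp only: mult_ac)
          also have "exp (K * radius r u) * exp (K * radius s u) = exp (K * (q r + q s) * sqrt u)"
            unfolding exp_add[symmetric] by (simp add: q algebra_simps)
          finally have "\<bar>radial_part r m u\<bar> * \<bar>radial_part s n u\<bar> * exp (- u) \<le>
              K * K * exp (K * (q r + q s) * sqrt u) * exp (- u)"
            by (rule mult_right_mono) simp
          then show ?case
            by (simp add: \<phi>_def abs_mult mult.assoc)
        qed
      qed (auto simp: \<phi>_def[abs_def])
      have \<psi>: "integrable cone_measure \<psi>"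
      proof (rule integrable_cone_measure)
        fix \<eta> :: "real ^ 'n" assume \<eta>: "norm \<eta> = 1"
        then have "\<bar>\<omega> \<bullet> \<eta>\<bar> \<le> 1" "\<bar>\<mu> \<bullet> \<eta>\<bar> \<le> 1"
          using Cauchy_Schwarz_ineq2[of \<omega> \<eta>] Cauchy_Schwarz_ineq2[of \<mu> \<eta>] unit by auto
        then show "norm (\<psi> \<eta>) \<le> (2 * (\<nu> + 2) * (4 * (\<nu> + 2)) ^ m) *
            (2 * (\<nu> + 2) * (4 * (\<nu> + 2)) ^ n)"
          unfolding \<psi>_def real_norm_def abs_mult[of "gegenbauer_norm _ _ _"]
          using \<nu>_gt by (intro mult_mono abs_gegenbauer_norm_le) auto
      qed (simp add: \<psi>_def[abs_def])
      have ta: "t / a > 0" using a_pos t by simp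
      have "has_bochner_integral lborel (\<lambda>\<xi>. \<phi> (U \<xi>) * \<psi> (sgn \<xi>) * wt \<xi>)
         (C * (\<integral>u. \<phi> u \<partial>power_measure l) * (\<integral>\<eta>. \<psi> \<eta> \<partial>cone_measure))"
        using has_bochner_integral_polar[where 'a = "real ^ 'n" and c = "t / a", OF a_pos ta _ \<psi>,
            of \<phi>] \<phi>
        by (simp add: U_def[abs_def] wt_def[abs_def] C_def l_def)
      then have "has_bochner_integral lborel (\<lambda>\<xi>. complex_of_real (\<phi> (U \<xi>) * \<psi> (sgn \<xi>) * wt \<xi>))
         (of_real (C * (\<integral>u. \<phi> u \<partial>power_measure l) * (\<integral>\<eta>. \<psi> \<eta> \<partial>cone_measure)))"
        by (rule has_bochner_integral_of_real)
      then have "has_bochner_integral lborel (\<lambda>\<xi>. (cnj (phase m) * phase n) * complex_of_real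
          (\<phi> (U \<xi>) * \<psi> (sgn \<xi>) * wt \<xi>))
         ((cnj (phase m) * phase n) * of_real (C * (\<integral>u. \<phi> u \<partial>power_measure l) *
             (\<integral>\<eta>. \<psi> \<eta> \<partial>cone_measure)))"
        by (intro has_bochner_integral_mult_right)
      also have "(\<lambda>\<xi>. (cnj (phase m) * phase n) * complex_of_real (\<phi> (U \<xi>) * \<psi> (sgn \<xi>) * wt \<xi>)) =
         (\<lambda>\<xi>. cnj (c m \<omega> r (U \<xi>) (sgn \<xi>)) * c n \<mu> s (U \<xi>) (sgn \<xi>) * of_real (exp (- U \<xi>) * wt \<xi>))"
        by (simp add: c_def \<phi>_def \<psi>_def fun_eq_iff mult_ac)
      also have "(cnj (phase m) * phase n) * of_real (C * (\<integral>u. \<phi> u \<partial>power_measure l) *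
          (\<integral>\<eta>. \<psi> \<eta> \<partial>cone_measure)) =
         (if m = n then of_real (C * V * E) * T m else 0)"
      proof -
        have ps: "(\<integral>\<eta>. \<psi> \<eta> \<partial>cone_measure) = (if m = n then V * gegenbauer_norm \<nu> m (\<omega> \<bullet> \<mu>) else 0)"
          using cone_integral_gegenbauer[OF unit, of m n] by (simp add: \<psi>_def[abs_def] \<nu>_def V_def)
        show ?thesis
        proof (cases "m = n")
          case True
          have "cnj (phase m) * phase n = 1"
            using True by (simp add: phase_def cis_cnj cis_mult)
          moreover have "complex_of_real (\<integral>u. \<phi> u \<partial>power_measure l) =
              of_real E * (cpow (W / 2) (b * real m) * bessel_I_norm (b * (real m + \<nu>)) W)"
            using integral_radial_part[OF assms(2,3), of m] True unfolding \<phi>_def E_def W_def by simp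
          ultimately show ?thesis
            using True unfolding ps T_def by (simp add: mult_ac)
        qed (simp add: ps)
      qed
      finally show ?thesis .
    qed
    have "P M = (\<lambda>\<xi>. \<Sum>m<M. \<Sum>n<M. cnj (c m \<omega> r (U \<xi>) (sgn \<xi>)) * c n \<mu> s (U \<xi>) (sgn \<xi>) *
        of_real (exp (- U \<xi>) * wt \<xi>))"
      unfolding P_def[abs_def] cnj_sum sum_product by (simp only: sum_distrib_right)
    moreover have "has_bochner_integral lborel
       (\<lambda>\<xi>. \<Sum>m<M. \<Sum>n<M. cnj (c m \<omega> r (U \<xi>) (sgn \<xi>)) * c n \<mu> s (U \<xi>) (sgn \<xi>) *
           of_real (exp (- U \<xi>) * wt \<xi>))
       (\<Sum>m<M. \<Sum>n<M. if m = n then of_real (C * V * E) * T m else 0)"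
      by (intro has_bochner_integral_sum pair)
    ultimately have "(\<integral>\<xi>. P M \<xi> \<partial>lborel) = (\<Sum>m<M. \<Sum>n<M. if m = n then of_real (C * V * E) *
        T m else 0)"
      by (simp only: has_bochner_integral_integral_eq)
    also have "\<dots> = of_real (C * V * E) * (\<Sum>m<M. T m)"
      by (simp add: sum.delta' sum_distrib_left)
    finally show ?thesis .
  qed
  have T_summable: "summable T"
  proof -
    have "b * \<nu> + 1 > 0" using b\<nu> l_gt by simp
    then obtain K where K: "\<And>w t m. \<bar>t\<bar> \<le> 1 \<Longrightarrow>
        norm (cpow (w / 2) (b * real m) * bessel_I_norm (b * (real m + \<nu>)) w *
          of_real (gegenbauer_norm \<nu> m t)) \<le> K * exp (K * norm w) * (1 / 2) ^ m"
      using script_I_term_le[OF b_pos \<nu>_gt] by metis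
    have "\<bar>\<omega> \<bullet> \<mu>\<bar> \<le> 1" using Cauchy_Schwarz_ineq2[of \<omega> \<mu>] unit by simp
    from K[OF this] show ?thesis
      unfolding T_def by (rule summable_comparison_test'[OF half(1)])
  qed
  have "(\<integral>\<xi>. F \<xi> \<partial>lborel) = of_real (C * V * E) * (\<Sum>m. T m)"
    by (rule LIMSEQ_unique[OF lim]) (simp only: part, intro tendsto_intros summable_LIMSEQ
        T_summable)
  moreover have "script_I b \<nu> W (\<omega> \<bullet> \<mu>) = of_real G * (\<Sum>m. T m)"
    unfolding script_I_def T_def G_def b\<nu> ..
  \<comment> \<open>The normalizing constant is the inverse of the same polar constant at t = 1,
    with one factor \<open>G\<close>. The quotient leaves the power of t, and the second
    \<open>G\<close> is the prefactor of \<open>script_I\<close>.\<close>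
  moreover have "norm_const TYPE('n) a * G\<^sup>2 * (C * V * E) = t powr (- (l + 1)) * E * G"
  proof -
    have "(t / a) powr (- (l + 1)) = t powr (- (l + 1)) * (1 / a) powr (- (l + 1))"
      using powr_mult[of t "1 / a"] by simp
    moreover have "(1 / a) powr (- (l + 1)) > 0" using a_pos by simp
    moreover have "norm_const TYPE('n) a = inverse (CARD('n) / a * (1 / a) powr (- (l + 1)) * G *
        V)"
      unfolding G_def V_def l_def by (rule norm_const_eq[OF assms(1)])
    ultimately show ?thesis
      using G V a_pos unfolding C_def by (simp add: field_simps power2_eq_square)
  qed
  ultimately have "heat_kernel a (r *\<^sub>R \<omega>) (s *\<^sub>R \<mu>) t = of_real (t powr (- (l + 1)) * E) *
      script_I b \<nu> W (\<omega> \<bullet> \<mu>)"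
    unfolding heat by (simp add: mult.assoc[symmetric] flip: of_real_mult)
  then show ?thesis
    by (simp only: E_def W_def l_def b_def \<nu>_def)
qed

end
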